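(* Let $\alpha\in\mathbb{R}\setminus\mathbb{Q}$ with denominators of best rational approximations $(q_s)$. Let $f\in C^2(\mathbb{T}\setminus\{a_1,\dots,a_k\})$, $f>0$, $f\in L^1(\mathbb{T})$, have singularities of type $h$ at $\{a_1,\dots,a_k\}$ with constants $A_i,B_i\ge 0$, and suppose $\{a_1,\dots,a_k\}$ is badly approximable by $\alpha$ with some associated constant $C>1$. Assume that $\sum_{i=1}^kA_i\ne\sum_{i=1}^kB_i$ and that there exist a constant $m_0>0$ and a sequence $(x_s)$ of positive reals such that for every $s\in\mathbb{N}$ we have $x_s<\frac1{q_s}$ and 1. $\displaystyle\lim_{s\to+\infty}\frac{h'(\frac{x_s}{4C})}{q_s\,h(\frac1{2q_s})}=0$ and $\displaystyle\lim_{s\to+\infty}x_s\,q_s\,h(\tfrac1{2q_s})=+\infty$; 2. $\displaystyle\sum_{i\notin K_\alpha}q_ix_i<+\infty$, where $K_\alpha:=\{s\in\mathbb{N}: q_{s+1}<\frac1{x_s}\}$; 3. $h(\frac1{2q_s})/h(\frac1{2q_{s+1}})>m_0$ for every $s\in\mathbb{N}$. Then the special flow $(T^f_t)_{t\in\mathbb{R}}$ above the rotation $R_\alpha$ and under $f$ has the SWR-property.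
   Context: $\mathbb{T}=\mathbb{R}/\mathbb{Z}$, with Lebesgue (Haar) measure $\lambda$ and metric $\|x-y\|$ (distance to the nearest integer); functions on $\mathbb{T}\setminus\{0\}$ are identified with functions on $(0,1)$; $R_\alpha x=x+\alpha$. Denominators: $(q_s)_{s\ge0}$ is the unique increasing sequence of integers with $q_0=1$ and $\|q_s\alpha\|<\|k\alpha\|$ for every $1\le k<q_{s+1}$, $k\ne q_s$. Singularities of type $h$: $h$ is a positive function in $C^2(\mathbb{T}\setminus\{0\})$, decreasing on $(0,1)$, with $\lim_{x\to0^+}h(x)=+\infty$ and $h'$ increasing on $(0,1)$. A function $f\in C^2(\mathbb{T}\setminus\{a_1,\dots,a_k\})$ has singularities of type $h$ at $\{a_1,\dots,a_k\}$ if for each $i$, $\lim_{x\to a_i^+}\frac{f'(x)}{h'(x-a_i)}=A_i$ and $\lim_{x\to a_i^-}\frac{f'(x)}{h'(a_i-x)}=-B_i$ for some numbers $A_i,B_i\ge0$. Badly approximable: $\{a_1,\dots,a_k\}\subset\mathbb{T}$ is badly approximable by $\alpha$ (with constant $C>1$) if for every $x\in\mathbb{T}$ and every $s\in\mathbb{N}$ there is at most one $i_0\in\{0,\dots,q_s-1\}$ with $x+i_0\alpha\in\bigcup_{i=1}^k\left[a_i-\frac1{2Cq_s},a_i+\frac1{2Cq_s}\right]$. Special flow: let $T$ be an automorphism of $(X,\mathscr{B},\mu)$, and let $f>0$, $f\in L^1(X,\mu)$. The special flow $(T^f_t)$ above $T$ and under $f$ acts on $X^f=\{(x,s): x\in X,\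 0\le s<f(x)\}$ (equivalently on $X\times\mathbb{R}$ modulo $(x,s+f(x))\sim(Tx,s)$) by $T^f_t(x,s)=(T^nx,\,t+s-f^{(n)}(x))$, where $n\in\mathbb{Z}$ is the unique integer with $f^{(n)}(x)\le t+s<f^{(n+1)}(x)$. Here $f^{(n)}(x)=f(x)+\dots+f(T^{n-1}x)$ for $n>0$, $f^{(0)}=0$, and $f^{(n)}(x)=-(f(T^nx)+\dots+f(T^{-1}x))$ for $n<0$. It preserves the normalized restriction of $\mu\otimes$Lebesgue to $X^f$. If $(X,d)$ is a metric space, $X^f$ carries the metric $d^f((x,s),(x',s'))=d(x,x')+|s-s'|$. SWR-property: let $(T_t)_{t\in\mathbb{R}}$ be an ergodic flow on a standard Borel probability space $(X,\mathscr{B},\mu)$, with $X$ a metric space with metric $d$. Let $t_0>0$ and $P\subset\mathbb{R}\setminus\{0\}$ compact. The flow has the switchable $R(t_0,P)$-property if for every $\epsilon>0$ and $N\in\mathbb{N}$ there exist $\kappa=\kappa(\epsilon)>0$, $\delta=\delta(\epsilon,N)>0$ and $Z=Z(\epsilon,N)\in\mathscr{B}$ with $\mu(Z)>1-\epsilon$ such that for any $x,y\in Z$ with $d(x,y)<\delta$ and $x$ not in the orbit of $y$, there exist $M,L\in\mathbb{N}$ with $M,L>N$ and $L/M\ge\kappa$, and $p\in P$, such that $\frac1L|\{n\in[M,M+L]\cap\mathbb{Z}: d(T_{nt_0}(x),T_{nt_0+p}(y))<\epsilon\}|>1-\epsilon$ or $\frac1L|\{n\in[M,M+L]\cap\mathbb{Z}: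 d(T_{-nt_0}(x),T_{-nt_0+p}(y))<\epsilon\}|>1-\epsilon$. The flow has the SWR-property if for some compact $P\subset\mathbb{R}\setminus\{0\}$ the set of $t_0>0$ for which it has the switchable $R(t_0,P)$-property is uncountable. *)

theory Defs
  imports "HOL-Probability.Probability"
begin

section \<open>The circle\<close>

text \<open>
  A point of the circle (the reals modulo the integers) is represented by its representative
  in the interval from 0 (included) to 1 (excluded), and a function on the circle by a
  1-periodic function on the reals.
\<close>

definition circle :: "real measure" where
  "circle = restrict_space lborel {0..<1}"

definition circle_norm :: "real \<Rightarrow> real" where
  "circle_norm x = infdist x \<int>"

definition circle_dist :: "real \<Rightarrow> real \<Rightarrow> real" where
  "circle_dist x y = circle_norm (x - y)"

definition rotation :: "real \<Rightarrow> real \<Rightarrow> real" where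
  "rotation \<alpha> x = frac (x + \<alpha>)"

definition circle_function :: "(real \<Rightarrow> real) \<Rightarrow> bool" where
  "circle_function f \<longleftrightarrow> (\<forall>x. f (x + 1) = f x)"

text \<open>For irrational \<open>\<alpha>\<close> there is exactly one such sequence.\<close>

definition denominators :: "real \<Rightarrow> (nat \<Rightarrow> nat) \<Rightarrow> bool" where
  "denominators \<alpha> q \<longleftrightarrow> strict_mono q \<and> q 0 = 1 \<and>
     (\<forall>s k. 1 \<le> k \<and> k < q (Suc s) \<and> k \<noteq> q s \<longrightarrow>
        circle_norm (real (q s) * \<alpha>) < circle_norm (real k * \<alpha>))"

text \<open>The image under \<open>frac\<close> projects intervals of the line to the circle.\<close>

definition badly_approximable :: "real \<Rightarrow> (nat \<Rightarrow> nat) \<Rightarrow> real \<Rightarrow> real set \<Rightarrow> bool" where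
  "badly_approximable \<alpha> q C S \<longleftrightarrow> C > 1 \<and>
     (\<forall>x\<in>space circle. \<forall>s. \<exists>\<^sub>\<le>\<^sub>1 i. i \<in> {0..<q s} \<and>
        (rotation \<alpha> ^^ i) x \<in>
          frac ` (\<Union>a\<in>S. {a - 1 / (2 * C * real (q s)) .. a + 1 / (2 * C * real (q s))}))"

section \<open>Singularities\<close>

text \<open>Meant for open sets \<open>S\<close> of reals only.\<close>

definition C2_on :: "real set \<Rightarrow> (real \<Rightarrow> real) \<Rightarrow> bool" where
  "C2_on S f \<longleftrightarrow> (\<forall>x\<in>S. f differentiable at x) \<and> (\<forall>x\<in>S. deriv f differentiable at x) \<and>
     continuous_on S (deriv (deriv f))"

text \<open>
  Here a function on the circle without 0 is a function on the open unit interval; the values of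
  \<open>h\<close> elsewhere are irrelevant. Monotonicity is not required to be strict.
\<close>

definition singularity_type :: "(real \<Rightarrow> real) \<Rightarrow> bool" where
  "singularity_type h \<longleftrightarrow>
     C2_on {0<..<1} h \<and> (\<forall>x\<in>{0<..<1}. h x > 0) \<and> antimono_on {0<..<1} h \<and>
     filterlim h at_top (at_right 0) \<and> mono_on {0<..<1} (deriv h)"

text \<open>
  The function \<open>f\<close> is total, so it also takes (arbitrary) values at the singularities \<open>a i\<close>, a null set.
\<close>

definition has_singularities ::
    "(real \<Rightarrow> real) \<Rightarrow> (real \<Rightarrow> real) \<Rightarrow> nat \<Rightarrow> (nat \<Rightarrow> real) \<Rightarrow> (nat \<Rightarrow> real) \<Rightarrow> (nat \<Rightarrow> real) \<Rightarrow> bool" where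
  "has_singularities h f k a A B \<longleftrightarrow>
     C2_on {x. frac x \<notin> a ` {1..k}} f \<and>
     (\<forall>i\<in>{1..k}. A i \<ge> 0 \<and> B i \<ge> 0 \<and>
        ((\<lambda>x. deriv f x / deriv h (x - a i)) \<longlongrightarrow> A i) (at_right (a i)) \<and>
        ((\<lambda>x. deriv f x / deriv h (a i - x)) \<longlongrightarrow> - B i) (at_left (a i)))"

section \<open>Special flows\<close>

definition int_iterate :: "'a set \<Rightarrow> ('a \<Rightarrow> 'a) \<Rightarrow> int \<Rightarrow> 'a \<Rightarrow> 'a" where
  "int_iterate X T n = (if n \<ge> 0 then T ^^ nat n else the_inv_into X T ^^ nat (- n))"

definition birkhoff_sum :: "'a set \<Rightarrow> ('a \<Rightarrow> 'a) \<Rightarrow> ('a \<Rightarrow> real) \<Rightarrow> int \<Rightarrow> 'a \<Rightarrow> real" where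
  "birkhoff_sum X T f n x =
     (if n \<ge> 0 then \<Sum>j\<in>{0..<n}. f (int_iterate X T j x)
      else - (\<Sum>j\<in>{n..<0}. f (int_iterate X T j x)))"

definition flow_space :: "'a set \<Rightarrow> ('a \<Rightarrow> real) \<Rightarrow> ('a \<times> real) set" where
  "flow_space X f = {(x, s). x \<in> X \<and> 0 \<le> s \<and> s < f x}"

definition flow_measure :: "'a measure \<Rightarrow> ('a \<Rightarrow> real) \<Rightarrow> ('a \<times> real) measure" where
  "flow_measure M f =
     (let \<nu> = restrict_space (M \<Otimes>\<^sub>M lborel) (flow_space (space M) f)
      in scale_measure (inverse (emeasure \<nu> (space \<nu>))) \<nu>)"

definition flow_dist :: "('a \<Rightarrow> 'a \<Rightarrow> real) \<Rightarrow> 'a \<times> real \<Rightarrow> 'a \<times> real \<Rightarrow> real" where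
  "flow_dist d = (\<lambda>(x, s) (x', s'). d x x' + \<bar>s - s'\<bar>)"

definition special_flow ::
    "'a set \<Rightarrow> ('a \<Rightarrow> 'a) \<Rightarrow> ('a \<Rightarrow> real) \<Rightarrow> real \<Rightarrow> 'a \<times> real \<Rightarrow> 'a \<times> real" where
  "special_flow X T f t = (\<lambda>(x, s).
     let n = (THE n. birkhoff_sum X T f n x \<le> t + s \<and> t + s < birkhoff_sum X T f (n + 1) x)
     in (int_iterate X T n x, t + s - birkhoff_sum X T f n x))"

section \<open>The switchable Ratner property\<close>

definition standard_borel :: "'a measure \<Rightarrow> bool" where
  "standard_borel M \<longleftrightarrow> (\<exists>\<tau>. completely_metrizable_space \<tau> \<and> separable_space \<tau> \<and>
     topspace \<tau> = space M \<and> sets M = sigma_sets (space M) {U. openin \<tau> U})"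

definition measure_preserving_flow :: "'a measure \<Rightarrow> (real \<Rightarrow> 'a \<Rightarrow> 'a) \<Rightarrow> bool" where
  "measure_preserving_flow M T \<longleftrightarrow>
     (\<forall>x\<in>space M. T 0 x = x) \<and>
     (\<forall>s t. \<forall>x\<in>space M. T (s + t) x = T s (T t x)) \<and>
     (\<lambda>(t, x). T t x) \<in> borel \<Otimes>\<^sub>M M \<rightarrow>\<^sub>M M \<and>
     (\<forall>t. distr M M (T t) = M)"

definition ergodic_flow :: "'a measure \<Rightarrow> (real \<Rightarrow> 'a \<Rightarrow> 'a) \<Rightarrow> bool" where
  "ergodic_flow M T \<longleftrightarrow> measure_preserving_flow M T \<and>
     (\<forall>A\<in>sets M. (\<forall>t. T t -` A \<inter> space M = A) \<longrightarrow> measure M A = 0 \<or> measure M A = 1)"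

definition switchable_R ::
    "'a measure \<Rightarrow> ('a \<Rightarrow> 'a \<Rightarrow> real) \<Rightarrow> (real \<Rightarrow> 'a \<Rightarrow> 'a) \<Rightarrow> real \<Rightarrow> real set \<Rightarrow> bool" where
  "switchable_R M d T t\<^sub>0 P \<longleftrightarrow>
     (\<forall>\<epsilon>>0. \<exists>\<kappa>>0. \<forall>N::nat. \<exists>\<delta>>0. \<exists>Z\<in>sets M. measure M Z > 1 - \<epsilon> \<and>
        (\<forall>x\<in>Z. \<forall>y\<in>Z. d x y < \<delta> \<and> x \<notin> range (\<lambda>t. T t y) \<longrightarrow>
           (\<exists>m L::nat. m > N \<and> L > N \<and> real L / real m \<ge> \<kappa> \<and>
              (\<exists>p\<in>P.
                 1 / real L * real (card {n\<in>{m..m+L}.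
                    d (T (real n * t\<^sub>0) x) (T (real n * t\<^sub>0 + p) y) < \<epsilon>}) > 1 - \<epsilon> \<or>
                 1 / real L * real (card {n\<in>{m..m+L}.
                    d (T (- (real n * t\<^sub>0)) x) (T (- (real n * t\<^sub>0) + p) y) < \<epsilon>}) > 1 - \<epsilon>))))"

text \<open>
  The first four conjuncts are the standing assumptions under which the property is defined: an
  ergodic flow on a standard Borel probability space that is also a metric space.
\<close>

definition SWR_property ::
    "'a measure \<Rightarrow> ('a \<Rightarrow> 'a \<Rightarrow> real) \<Rightarrow> (real \<Rightarrow> 'a \<Rightarrow> 'a) \<Rightarrow> bool" where
  "SWR_property M d T \<longleftrightarrow>
     prob_space M \<and> standard_borel M \<and> Metric_space (space M) d \<and> ergodic_flow M T \<and>
     (\<exists>P. compact P \<and> 0 \<notin> P \<and> uncountable {t\<^sub>0. t\<^sub>0 > 0 \<and> switchable_R M d T t\<^sub>0 P})"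

end

theory Submission
  imports Defs "HOL-Analysis.Kronecker_Approximation_Theorem"
begin

text \<open>
  Two points of the flow space that start close together travel along fibres over the orbits of two
  nearby base points \<open>y\<close> and \<open>y'\<close>. They stay close up to a time shift \<open>p\<close> exactly as long as the
  difference \<open>\<Delta>(n)\<close> of the Birkhoff sums of \<open>f\<close> at \<open>y\<close> and \<open>y'\<close> stays close to \<open>- p\<close>. So the
  property follows once \<open>\<Delta>\<close> has, for almost every \<open>y\<close> and every close \<open>y'\<close>, a plateau: a window
  of times \<open>[M, M + L]\<close> with \<open>L / M\<close> bounded below, on which \<open>\<Delta>\<close> is almost constant and bounded away
  from \<open>0\<close> and from infinity. The forward or the backward orbit may be used, and this freedom decides.
  
  The plateau comes from two estimates on a time range \<open>[0, 3 R)\<close> (lemma \<open>base_divergence\<close>): the total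
  variation of \<open>\<Delta>\<close> there is at most a constant \<open>c2\<close>, and \<open>\<bar>\<Delta>(n + R) - \<Delta>(n)\<bar>\<close> is at least a
  constant \<open>c1 > 0\<close> for every \<open>n\<close>. Cut the range into many short windows. By the first estimate
  \<open>\<Delta>\<close> is almost constant on some window and on its translate by \<open>R\<close>, and by the second it is not
  close to \<open>0\<close> on both of them (lemma \<open>stable_window\<close>).
  
  Both estimates are statements about sums of \<open>f'\<close> along the orbit. Over a block of \<open>q\<close> consecutive
  times, \<open>q\<close> a denominator, the orbit is almost equidistributed at scale \<open>1 / q\<close>. As \<open>h'\<close> is monotone,
  its sum over the block is a Riemann sum, equal to \<open>- q h(1 / (2 q))\<close> up to the contribution of the
  points nearest to the singularity (lemma \<open>block_sum_u\<close>). With the asymptotics of \<open>f'\<close> at the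
  singularities, the sum of \<open>f'\<close> over a block is therefore
  \<open>(\<Sum>B - \<Sum>A) q h(1 / (2 q))\<close> up to a small relative error, provided that the block keeps a distance
  of order \<open>x s\<close> from the singularities; here the asymmetry \<open>\<Sum>A \<noteq> \<Sum>B\<close> and the first half of
  condition 1 enter (lemma \<open>block_derivative\<close>). A time scale \<open>R\<close> at which this sum, multiplied by the
  distance of \<open>y\<close> and \<open>y'\<close>, has order 1 is a multiple of a denominator; condition 3 makes it possible
  to pass from one denominator to the next (lemma \<open>select_scales\<close>).
  
  It remains to keep the orbit away from the singularities during that time (lemma \<open>switching\<close>). If
  \<open>q (s + 1) < 1 / x s\<close>, bad approximability allows at most one close visit in a time span of
  length \<open>q (s + 1)\<close>, hence none in the past or none in the future. Otherwise the close visits form one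
  run of an arithmetic progression of times with step \<open>q s\<close>; a run that meets both past and future
  contains a time between \<open>0\<close> and \<open>q s\<close>, and by condition 2 and the Borel-Cantelli lemma almost
  every point has no such visit for large \<open>s\<close>.
  
  The transfer from the base to the flow needs that a typical flow orbit, sampled at multiples of a
  given \<open>t\<^sub>0 > 0\<close>, is rarely near the top or the bottom of the fibres. Apply the pointwise ergodic
  theorem to the map \<open>T\<^sub>t\<^sub>0\<close> and to its inverse: the frequencies of visits to a small neighbourhood of the
  ends of the fibres converge, and their limit, which may vary from orbit to orbit, is small outside
  a small set by Markov's inequality. This holds for every \<open>t\<^sub>0 > 0\<close>.
\<close>

section \<open>Maximal and pointwise ergodic theorems\<close>

definition orbit_sum :: "('a \<Rightarrow> 'a) \<Rightarrow> ('a \<Rightarrow> real) \<Rightarrow> nat \<Rightarrow> 'a \<Rightarrow> real" where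
  "orbit_sum T \<phi> n x = (\<Sum>j<n. \<phi> ((T ^^ j) x))"

lemma orbit_sum_Suc: "orbit_sum T \<phi> (Suc n) x = \<phi> x + orbit_sum T \<phi> n (T x)"
  unfolding orbit_sum_def by (subst sum.lessThan_Suc_shift) (simp add: funpow_swap1)

text \<open>
  The maximum of \<open>0\<close> and the first \<open>n\<close> orbit sums. The recursion separates the first step, which is
  what the proof of the maximal ergodic lemma needs.
\<close>

fun maximal_sum :: "('a \<Rightarrow> 'a) \<Rightarrow> ('a \<Rightarrow> real) \<Rightarrow> nat \<Rightarrow> 'a \<Rightarrow> real" where
  "maximal_sum T \<phi> 0 x = 0"
| "maximal_sum T \<phi> (Suc n) x = max 0 (\<phi> x + maximal_sum T \<phi> n (T x))"

lemma maximal_sum_nonneg: "maximal_sum T \<phi> n x \<ge> 0"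
  by (cases n) auto

lemma maximal_sum_mono_Suc: "maximal_sum T \<phi> n x \<le> maximal_sum T \<phi> (Suc n) x"
proof (induction n arbitrary: x)
  case (Suc n)
  from Suc[of "T x"] show ?case by (auto simp: max_def)
qed auto

lemma maximal_sum_mono: "m \<le> n \<Longrightarrow> maximal_sum T \<phi> m x \<le> maximal_sum T \<phi> n x"
  by (rule lift_Suc_mono_le[of "\<lambda>n. maximal_sum T \<phi> n x"]) (simp_all add: maximal_sum_mono_Suc del: maximal_sum.simps)

lemma orbit_sum_le_maximal_sum: "orbit_sum T \<phi> n x \<le> maximal_sum T \<phi> n x"
proof (induction n arbitrary: x)
  case 0 then show ?case by (simp add: orbit_sum_def)
next
  case (Suc n)
  from Suc[of "T x"] show ?case by (simp add: orbit_sum_Suc)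
qed

locale measure_preserving = prob_space M for M :: "'a measure" +
  fixes T :: "'a \<Rightarrow> 'a"
  assumes measurable_T [measurable]: "T \<in> measurable M M"
    and distr_T: "distr M M T = M"
begin

lemma integrable_compose_T:
  fixes g :: "'a \<Rightarrow> real"
  shows "integrable M g \<Longrightarrow> integrable M (\<lambda>x. g (T x))"
  using integrable_distr[OF measurable_T, of g] distr_T by simp

lemma integral_compose_T:
  fixes g :: "'a \<Rightarrow> real"
  assumes "g \<in> borel_measurable M"
  shows "(\<integral>x. g (T x) \<partial>M) = (\<integral>x. g x \<partial>M)"
  using integral_distr[OF measurable_T, of g] assms distr_T by simp

lemma measurable_funpow_T [measurable]: "(T ^^ n) \<in> measurable M M"
  by (induction n) auto

lemma borel_measurable_orbit_sum [measurable]: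
  "\<phi> \<in> borel_measurable M \<Longrightarrow> orbit_sum T \<phi> n \<in> borel_measurable M"
  unfolding orbit_sum_def[abs_def] by (intro borel_measurable_sum measurable_compose[OF measurable_funpow_T])

lemma integrable_maximal_sum:
  assumes "integrable M \<phi>"
  shows "integrable M (maximal_sum T \<phi> n)"
proof (induction n)
  case (Suc n)
  have "integrable M (\<lambda>x. \<phi> x + maximal_sum T \<phi> n (T x))"
    using assms integrable_compose_T[OF Suc] by auto
  then show ?case by simp
qed auto

text \<open>
  Where the maximal sum \<open>F\<close> is positive, its recursion gives \<open>\<phi> \<ge> F - F \<circ> T\<close>; elsewhere \<open>F = 0\<close> and
  \<open>F \<circ> T \<ge> 0\<close>. Integrating, the right-hand side vanishes because \<open>T\<close> preserves the measure.
\<close>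

lemma maximal_ergodic_lemma:
  assumes "integrable M \<phi>"
  shows "0 \<le> (\<integral>x. \<phi> x * indicator {x\<in>space M. maximal_sum T \<phi> n x > 0} x \<partial>M)"
proof -
  let ?F = "maximal_sum T \<phi> n"
  have iF: "integrable M ?F" by (rule integrable_maximal_sum[OF assms])
  then have mF[measurable]: "?F \<in> borel_measurable M" by auto
  have "(\<integral>x. ?F x - ?F (T x) \<partial>M) = 0"
    using iF integrable_compose_T[OF iF] integral_compose_T[OF mF] by simp
  moreover have "(\<integral>x. ?F x - ?F (T x) \<partial>M)
      \<le> (\<integral>x. \<phi> x * indicator {x\<in>space M. ?F x > 0} x \<partial>M)"
  proof (rule integral_mono)
    show "integrable M (\<lambda>x. ?F x - ?F (T x))"
      using iF integrable_compose_T[OF iF] by simp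
    show "integrable M (\<lambda>x. \<phi> x * indicator {x\<in>space M. ?F x > 0} x)"
      by (rule integrable_mult_indicator[where 'b=real, simplified mult.commute real_scaleR_def])
        (use assms in auto)
    fix x assume x: "x \<in> space M"
    show "?F x - ?F (T x) \<le> \<phi> x * indicator {x\<in>space M. ?F x > 0} x"
    proof (cases "?F x > 0")
      case True
      then obtain m where m: "n = Suc m" by (cases n) auto
      have "?F x = \<phi> x + maximal_sum T \<phi> m (T x)" using True by (auto simp: m max_def split: if_splits)
      also have "\<dots> \<le> \<phi> x + ?F (T x)" using maximal_sum_mono_Suc[of T \<phi> m "T x"] m by simp
      finally show ?thesis using True x by simp
    next
      case False
      then show ?thesis using maximal_sum_nonneg[of T \<phi> n x] maximal_sum_nonneg[of T \<phi> n "T x"]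
        by simp
    qed
  qed
  ultimately show ?thesis by simp
qed

text \<open>
  The maximal lemma for \<open>\<phi> - K\<close> is a weak-type estimate: the points where some average exceeds \<open>K\<close>
  have measure at most \<open>\<integral>\<phi> / K\<close>, which tends to \<open>0\<close>.
\<close>

lemma AE_orbit_sum_linear_bound:
  assumes \<phi>: "integrable M \<phi>" and nonneg: "\<And>x. x \<in> space M \<Longrightarrow> \<phi> x \<ge> 0"
  shows "AE x in M. \<exists>K::nat. \<forall>n. orbit_sum T \<phi> n x \<le> real K * real n"
proof -
  have [measurable]: "\<phi> \<in> borel_measurable M" using \<phi> by auto
  define B where "B K = {x\<in>space M. \<exists>n. orbit_sum T \<phi> n x > real K * real n}" for K :: nat
  have B_sets[measurable]: "B K \<in> sets M" for K unfolding B_def by measurable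
  have bound: "measure M (B K) \<le> (\<integral>x. \<phi> x \<partial>M) / real K" if "K > 0" for K
  proof -
    define \<psi> where "\<psi> x = \<phi> x - real K" for x
    have i\<psi>: "integrable M \<psi>" unfolding \<psi>_def using \<phi> by auto
    define P where "P n = {x\<in>space M. maximal_sum T \<psi> n x > 0}" for n
    have [measurable]: "maximal_sum T \<psi> n \<in> borel_measurable M" for n
      using integrable_maximal_sum[OF i\<psi>] by auto
    have P_sets[measurable]: "P n \<in> sets M" for n unfolding P_def by measurable
    have Pn: "measure M (P n) \<le> (\<integral>x. \<phi> x \<partial>M) / real K" for n
    proof -
      have "0 \<le> (\<integral>x. \<psi> x * indicator (P n) x \<partial>M)"
        using maximal_ergodic_lemma[OF i\<psi>, of n] unfolding P_def .
      also have "\<dots> \<le> (\<integral>x. \<phi> x - real K * indicator (P n) x \<partial>M)"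
      proof (rule integral_mono)
        show "integrable M (\<lambda>x. \<psi> x * indicator (P n) x)"
          by (rule integrable_mult_indicator[where 'b=real, simplified mult.commute real_scaleR_def])
            (use i\<psi> in auto)
        show "integrable M (\<lambda>x. \<phi> x - real K * indicator (P n) x)"
          using \<phi> by (auto intro!: integrable_real_mult_indicator)
        show "\<psi> x * indicator (P n) x \<le> \<phi> x - real K * indicator (P n) x" if "x \<in> space M" for x
          using nonneg[OF that] by (auto simp: \<psi>_def indicator_def)
      qed
      also have "\<dots> = (\<integral>x. \<phi> x \<partial>M) - real K * measure M (P n)"
        using \<phi> by (subst Bochner_Integration.integral_diff) (auto simp: less_top[symmetric])
      finally show ?thesis using that by (simp add: field_simps)
    qed
    have "B K \<subseteq> (\<Union>n. P n)"
    proof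
      fix x assume "x \<in> B K"
      then obtain n where x: "x \<in> space M" and n: "orbit_sum T \<phi> n x > real K * real n"
        by (auto simp: B_def)
      have "orbit_sum T \<psi> n x = orbit_sum T \<phi> n x - real K * real n"
        by (simp add: orbit_sum_def \<psi>_def sum_subtractf)
      then have "maximal_sum T \<psi> n x > 0" using n orbit_sum_le_maximal_sum[of T \<psi> n x] by simp
      then show "x \<in> (\<Union>n. P n)" using x by (auto simp: P_def)
    qed
    then have "measure M (B K) \<le> measure M (\<Union>n. P n)"
      by (intro finite_measure_mono) auto
    moreover have "(\<lambda>n. measure M (P n)) \<longlonglongrightarrow> measure M (\<Union>n. P n)"
    proof (rule finite_Lim_measure_incseq)
      show "incseq P" unfolding incseq_def P_def
        using maximal_sum_mono by (fastforce intro: less_le_trans)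
    qed auto
    then have "measure M (\<Union>n. P n) \<le> (\<integral>x. \<phi> x \<partial>M) / real K"
      by (rule LIMSEQ_le_const2) (use Pn in auto)
    ultimately show ?thesis by simp
  qed
  have "measure M (\<Inter>K. B K) = 0"
  proof -
    have "(\<lambda>K. (\<integral>x. \<phi> x \<partial>M) / real K) \<longlonglongrightarrow> 0" by (rule lim_const_over_n)
    moreover have "\<exists>N. \<forall>K\<ge>N. measure M (\<Inter>K. B K) \<le> (\<integral>x. \<phi> x \<partial>M) / real K"
    proof (intro exI allI impI)
      fix K :: nat assume "K \<ge> 1"
      have "measure M (\<Inter>K. B K) \<le> measure M (B K)" by (rule finite_measure_mono) auto
      then show "measure M (\<Inter>K. B K) \<le> (\<integral>x. \<phi> x \<partial>M) / real K" using bound[of K] \<open>K \<ge> 1\<close> by auto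
    qed
    ultimately have "measure M (\<Inter>K. B K) \<le> 0" by (rule LIMSEQ_le_const)
    then show ?thesis using measure_nonneg[of M "\<Inter>K. B K"] by linarith
  qed
  then have "(\<Inter>K. B K) \<in> null_sets M" by (simp add: emeasure_eq_measure null_sets_def)
  then have "AE x in M. x \<notin> (\<Inter>K. B K)" by (rule AE_not_in)
  then show ?thesis using AE_space by eventually_elim (auto simp: B_def not_less)
qed

definition upper_average :: "('a \<Rightarrow> real) \<Rightarrow> 'a \<Rightarrow> real" where
  "upper_average \<phi> x = real_of_ereal (limsup (\<lambda>n. ereal (orbit_sum T \<phi> n x / real n)))"

lemma funpow_T_space: "x \<in> space M \<Longrightarrow> (T ^^ j) x \<in> space M"
  using measurable_space[OF measurable_funpow_T] .

lemma abs_average_le_1: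
  assumes "\<And>x. x \<in> space M \<Longrightarrow> \<bar>\<phi> x\<bar> \<le> 1" "x \<in> space M"
  shows "\<bar>orbit_sum T \<phi> n x / real n\<bar> \<le> 1"
proof -
  have "\<bar>orbit_sum T \<phi> n x\<bar> \<le> (\<Sum>j<n. 1)"
    unfolding orbit_sum_def
    by (rule order.trans[OF sum_abs]) (intro sum_mono assms funpow_T_space)
  then show ?thesis by (cases "n = 0") (auto simp: field_simps)
qed

lemma ereal_upper_average:
  assumes "\<And>x. x \<in> space M \<Longrightarrow> \<bar>\<phi> x\<bar> \<le> 1" "x \<in> space M"
  shows "ereal (upper_average \<phi> x) = limsup (\<lambda>n. ereal (orbit_sum T \<phi> n x / real n))"
    and "\<bar>upper_average \<phi> x\<bar> \<le> 1"
proof -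
  let ?l = "limsup (\<lambda>n. ereal (orbit_sum T \<phi> n x / real n))"
  have *: "- 1 \<le> orbit_sum T \<phi> n x / real n" "orbit_sum T \<phi> n x / real n \<le> 1" for n
    using abs_average_le_1[where \<phi>=\<phi> and x=x and n=n, OF assms] by linarith+
  have up: "?l \<le> ereal 1" by (rule Limsup_bounded) (use * in auto)
  have "ereal (- 1) \<le> liminf (\<lambda>n. ereal (orbit_sum T \<phi> n x / real n))"
    by (rule Liminf_bounded) (use * in \<open>auto simp del: uminus_ereal.simps\<close>)
  also have "\<dots> \<le> ?l" by (rule Liminf_le_Limsup) auto
  finally have lo: "ereal (- 1) \<le> ?l" .
  from up lo obtain r where r: "?l = ereal r" by (cases ?l) auto
  then show "ereal (upper_average \<phi> x) = ?l" by (simp add: upper_average_def)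
  show "\<bar>upper_average \<phi> x\<bar> \<le> 1" using up lo by (simp add: upper_average_def r abs_le_iff)
qed

text \<open>
  The averages of \<open>n\<close> terms at \<open>T x\<close> and of \<open>n + 1\<close> terms at \<open>x\<close> differ by at most \<open>2 / n\<close>.
\<close>

lemma upper_average_invariant:
  assumes "\<And>x. x \<in> space M \<Longrightarrow> \<bar>\<phi> x\<bar> \<le> 1" "x \<in> space M"
  shows "upper_average \<phi> (T x) = upper_average \<phi> x"
proof -
  have Tx: "T x \<in> space M" using assms(2) measurable_space[OF measurable_T] by auto
  define A where "A n y = orbit_sum T \<phi> n y / real n" for n y
  define d where "d n = A n (T x) - A (Suc n) x" for n
  have A1: "\<bar>A n y\<bar> \<le> 1" if "y \<in> space M" for n y
    using abs_average_le_1[OF assms(1) that] by (simp add: A_def)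
  have dn: "\<bar>d n\<bar> \<le> 2 / real n" if "n > 0" for n
  proof -
    have "real (Suc n) * A (Suc n) x = \<phi> x + real n * A n (T x)"
      using that by (simp add: A_def orbit_sum_Suc)
    then have "real n * d n = A (Suc n) x - \<phi> x" unfolding d_def by (simp add: algebra_simps)
    then have "real n * \<bar>d n\<bar> = \<bar>A (Suc n) x - \<phi> x\<bar>" by (metis abs_mult abs_of_nat)
    also have "\<dots> \<le> 2"
      using A1[OF assms(2), of "Suc n"] assms(1)[OF assms(2)] by linarith
    finally show ?thesis using that by (simp add: field_simps)
  qed
  have "d \<longlonglongrightarrow> 0"
    by (rule Lim_null_comparison[OF _ lim_const_over_n[of 2]])
      (use dn in \<open>auto intro: eventually_sequentiallyI[of 1]\<close>)
  then have "(\<lambda>n. ereal (d n)) \<longlonglongrightarrow> 0" by (simp add: zero_ereal_def)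
  then have "limsup (\<lambda>n. ereal (d n) + ereal (A (Suc n) x)) = 0 + limsup (\<lambda>n. ereal (A (Suc n) x))"
    by (rule ereal_limsup_lim_add) auto
  moreover have "limsup (\<lambda>n. ereal (A (Suc n) x)) = limsup (\<lambda>n. ereal (A n x))"
    using limsup_shift[of "\<lambda>n. ereal (A n x)"] by simp
  ultimately have "limsup (\<lambda>n. ereal (A n (T x))) = limsup (\<lambda>n. ereal (A n x))"
    by (simp add: d_def)
  then show ?thesis by (simp add: upper_average_def A_def)
qed

lemma borel_measurable_upper_average [measurable]:
  "\<phi> \<in> borel_measurable M \<Longrightarrow> upper_average \<phi> \<in> borel_measurable M"
  unfolding upper_average_def[abs_def]
  by (intro borel_measurable_real_of_ereal borel_measurable_limsup borel_measurable_ereal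
      borel_measurable_divide borel_measurable_orbit_sum borel_measurable_const)

text \<open>
  Since the upper average \<open>g\<close> is invariant, the orbit sums of \<open>\<psi> = \<phi> - g + e\<close> are positive for some
  \<open>n\<close> at every point. So the maximal lemma, in the limit of large \<open>n\<close>, gives \<open>\<integral>\<psi> \<ge> 0\<close>.
\<close>

lemma integral_upper_average_le:
  assumes b: "\<And>x. x \<in> space M \<Longrightarrow> \<bar>\<phi> x\<bar> \<le> 1" and [measurable]: "\<phi> \<in> borel_measurable M"
  shows "(\<integral>x. upper_average \<phi> x \<partial>M) \<le> (\<integral>x. \<phi> x \<partial>M)"
proof (rule field_le_epsilon)
  fix e :: real assume e: "e > 0"
  define g where "g = upper_average \<phi>"
  define \<psi> where "\<psi> x = \<phi> x - g x + e" for x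
  have [measurable]: "g \<in> borel_measurable M" by (simp add: g_def)
  have gb: "\<bar>g x\<bar> \<le> 1" if "x \<in> space M" for x
    using ereal_upper_average(2)[OF b that] by (simp add: g_def)
  have i\<phi>: "integrable M \<phi>" by (rule integrable_const_bound[of _ 1]) (use b in auto)
  have ig: "integrable M g" by (rule integrable_const_bound[of _ 1]) (use gb in auto)
  have i\<psi>: "integrable M \<psi>" unfolding \<psi>_def using i\<phi> ig by auto
  have [measurable]: "maximal_sum T \<psi> n \<in> borel_measurable M" for n
    using integrable_maximal_sum[OF i\<psi>] by auto
  define P where "P n = {x\<in>space M. maximal_sum T \<psi> n x > 0}" for n
  have P_sets[measurable]: "P n \<in> sets M" for n unfolding P_def by measurable
  have ev: "\<exists>n. maximal_sum T \<psi> n x > 0" if x: "x \<in> space M" for x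
  proof -
    have "g ((T ^^ j) x) = g x" for j
      by (induction j) (use upper_average_invariant[OF b funpow_T_space[OF x]] in \<open>auto simp: g_def\<close>)
    then have s: "orbit_sum T \<psi> n x = orbit_sum T \<phi> n x - real n * (g x - e)" for n
      by (simp add: orbit_sum_def \<psi>_def sum.distrib sum_subtractf algebra_simps)
    have lt: "ereal (g x - e) < limsup (\<lambda>n. ereal (orbit_sum T \<phi> n x / real n))"
    proof -
      have "ereal (g x - e) < ereal (g x)" using e by simp
      also have "ereal (g x) = limsup (\<lambda>n. ereal (orbit_sum T \<phi> n x / real n))"
        unfolding g_def by (rule ereal_upper_average(1)[OF b x])
      finally show ?thesis .
    qed
    have "\<exists>\<^sub>F n in sequentially. ereal (g x - e) < ereal (orbit_sum T \<phi> n x / real n)"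
      unfolding frequently_def
    proof (rule notI)
      assume "\<forall>\<^sub>F n in sequentially. \<not> ereal (g x - e) < ereal (orbit_sum T \<phi> n x / real n)"
      then have "\<forall>\<^sub>F n in sequentially. ereal (orbit_sum T \<phi> n x / real n) \<le> ereal (g x - e)"
        by eventually_elim (simp add: not_less)
      then have "limsup (\<lambda>n. ereal (orbit_sum T \<phi> n x / real n)) \<le> ereal (g x - e)"
        by (rule Limsup_bounded)
      with lt show False by simp
    qed
    then have "\<exists>\<^sub>F n in sequentially. g x - e < orbit_sum T \<phi> n x / real n \<and> n > 0"
      using frequently_eventually_conj[OF _ eventually_gt_at_top[of "0::nat"], of
          "\<lambda>n. ereal (g x - e) < ereal (orbit_sum T \<phi> n x / real n)"] by (simp add: conj_commute)
    then obtain n where "g x - e < orbit_sum T \<phi> n x / real n" "n > 0"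
      by (auto dest: frequently_ex)
    then have "orbit_sum T \<psi> n x > 0" by (simp add: s field_simps)
    then show ?thesis using orbit_sum_le_maximal_sum[of T \<psi> n x] by (intro exI[of _ n]) linarith
  qed
  have "(\<lambda>n. \<integral>x. \<psi> x * indicator (P n) x \<partial>M) \<longlonglongrightarrow> (\<integral>x. \<psi> x \<partial>M)"
  proof (rule integral_dominated_convergence[where w="\<lambda>x. \<bar>\<psi> x\<bar>"])
    show "AE x in M. (\<lambda>n. \<psi> x * indicator (P n) x) \<longlonglongrightarrow> \<psi> x"
    proof (rule AE_I2)
      fix x assume x: "x \<in> space M"
      from ev[OF x] obtain m where m: "maximal_sum T \<psi> m x > 0" by blast
      have "x \<in> P n" if "n \<ge> m" for n
        using maximal_sum_mono[OF that, of T \<psi> x] m x by (auto simp: P_def)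
      then have "\<forall>\<^sub>F n in sequentially. \<psi> x = \<psi> x * indicator (P n) x"
        by (intro eventually_sequentiallyI[of m]) auto
      then show "(\<lambda>n. \<psi> x * indicator (P n) x) \<longlonglongrightarrow> \<psi> x"
        by (rule Lim_transform_eventually[OF tendsto_const])
    qed
  qed (use i\<psi> in \<open>auto simp: indicator_def\<close>)
  then have "0 \<le> (\<integral>x. \<psi> x \<partial>M)"
    by (rule LIMSEQ_le_const) (use maximal_ergodic_lemma[OF i\<psi>] in \<open>auto simp: P_def\<close>)
  also have "\<dots> = (\<integral>x. \<phi> x \<partial>M) - (\<integral>x. g x \<partial>M) + e"
    unfolding \<psi>_def using i\<phi> ig by (simp add: prob_space)
  finally show "(\<integral>x. upper_average \<phi> x \<partial>M) \<le> (\<integral>x. \<phi> x \<partial>M) + e" by (simp add: g_def)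
qed

text \<open>
  The previous lemma for \<open>\<phi>\<close> and for \<open>- \<phi>\<close> bounds the integral of the upper average from above and
  that of the lower average from below by the same number, so the two averages agree almost
  everywhere.
\<close>

theorem birkhoff_bounded:
  assumes b: "\<And>x. x \<in> space M \<Longrightarrow> 0 \<le> \<phi> x \<and> \<phi> x \<le> 1" and m[measurable]: "\<phi> \<in> borel_measurable M"
  obtains g where "g \<in> borel_measurable M" "\<And>x. x \<in> space M \<Longrightarrow> 0 \<le> g x \<and> g x \<le> 1"
    "(\<integral>x. g x \<partial>M) \<le> (\<integral>x. \<phi> x \<partial>M)"
    "AE x in M. (\<lambda>n. orbit_sum T \<phi> n x / real n) \<longlonglongrightarrow> g x"
proof -
  define \<phi>' where "\<phi>' x = - \<phi> x" for x
  have b1: "\<bar>\<phi> x\<bar> \<le> 1" "\<bar>\<phi>' x\<bar> \<le> 1" if "x \<in> space M" for x using b[OF that] by (auto simp: \<phi>'_def)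
  have m'[measurable]: "\<phi>' \<in> borel_measurable M" by (simp add: \<phi>'_def[abs_def])
  define g where "g = upper_average \<phi>"
  define g' where "g' = upper_average \<phi>'"
  have [measurable]: "g \<in> borel_measurable M" "g' \<in> borel_measurable M" by (simp_all add: g_def g'_def)
  have lim: "liminf (\<lambda>n. ereal (orbit_sum T \<phi> n x / real n)) = ereal (- g' x)" if x: "x \<in> space M" for x
  proof -
    have *: "orbit_sum T \<phi>' n x = - orbit_sum T \<phi> n x" for n
      by (simp add: orbit_sum_def \<phi>'_def sum_negf)
    have "ereal (g' x) = limsup (\<lambda>n. - ereal (orbit_sum T \<phi> n x / real n))"
      using ereal_upper_average(1)[OF b1(2) x] by (simp add: g'_def *)
    also have "\<dots> = - liminf (\<lambda>n. ereal (orbit_sum T \<phi> n x / real n))"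
      by (rule ereal_Limsup_uminus)
    finally show ?thesis by (cases "liminf (\<lambda>n. ereal (orbit_sum T \<phi> n x / real n))") auto
  qed
  have le: "- g' x \<le> g x" if x: "x \<in> space M" for x
  proof -
    have "liminf (\<lambda>n. ereal (orbit_sum T \<phi> n x / real n)) \<le> limsup (\<lambda>n. ereal (orbit_sum T \<phi> n x / real n))"
      by (rule Liminf_le_Limsup) simp
    also have "\<dots> = ereal (g x)"
      unfolding g_def by (rule ereal_upper_average(1)[OF b1(1) x, symmetric])
    finally have "ereal (- g' x) \<le> ereal (g x)" unfolding lim[OF x] .
    then show ?thesis by simp
  qed
  have gb: "\<bar>g x\<bar> \<le> 1" "\<bar>g' x\<bar> \<le> 1" if "x \<in> space M" for x
    using ereal_upper_average(2)[OF b1(1) that] ereal_upper_average(2)[OF b1(2) that]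
    by (auto simp: g_def g'_def)
  have ig: "integrable M g" "integrable M g'"
    by (rule integrable_const_bound[of _ 1]; use gb in auto)+
  have "(\<integral>x. g x \<partial>M) + (\<integral>x. g' x \<partial>M) \<le> (\<integral>x. \<phi> x \<partial>M) + (\<integral>x. \<phi>' x \<partial>M)"
    using integral_upper_average_le[of \<phi>] integral_upper_average_le[of \<phi>'] b1
    by (auto simp: g_def g'_def intro!: add_mono)
  then have "(\<integral>x. g x + g' x \<partial>M) \<le> 0" using ig by (simp add: \<phi>'_def)
  moreover have nn: "AE x in M. 0 \<le> g x + g' x"
  proof (rule AE_I2)
    show "0 \<le> g x + g' x" if "x \<in> space M" for x using le[OF that] by linarith
  qed
  ultimately have "(\<integral>x. g x + g' x \<partial>M) = 0" using integral_nonneg_AE[OF nn] by simp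
  then have ae: "AE x in M. g x + g' x = 0"
    using integral_nonneg_eq_0_iff_AE[OF _ nn] ig by auto
  show ?thesis
  proof
    show "g \<in> borel_measurable M" by measurable
    show "(\<integral>x. g x \<partial>M) \<le> (\<integral>x. \<phi> x \<partial>M)"
      unfolding g_def by (rule integral_upper_average_le) (use b1 in auto)
    show "0 \<le> g x \<and> g x \<le> 1" if x: "x \<in> space M" for x
    proof -
      have "ereal 0 \<le> liminf (\<lambda>n. ereal (orbit_sum T \<phi> n x / real n))"
        by (rule Liminf_bounded)
          (auto simp: orbit_sum_def intro!: always_eventually divide_nonneg_nonneg sum_nonneg b[THEN conjunct1] funpow_T_space x)
      also have "\<dots> \<le> ereal (g x)"
        using ereal_upper_average(1)[OF b1(1) x] Liminf_le_Limsup[of sequentially]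
        by (simp add: g_def)
      finally show ?thesis using gb[OF x] by auto
    qed
    from ae show "AE x in M. (\<lambda>n. orbit_sum T \<phi> n x / real n) \<longlonglongrightarrow> g x"
      using AE_space
    proof eventually_elim
      case (elim x)
      then have x: "x \<in> space M" and e: "g' x = - g x" by auto
      have "limsup (\<lambda>n. ereal (orbit_sum T \<phi> n x / real n)) = ereal (g x)"
        using ereal_upper_average(1)[OF b1(1) x] by (simp add: g_def)
      moreover have "liminf (\<lambda>n. ereal (orbit_sum T \<phi> n x / real n)) = ereal (g x)"
        using lim[OF x] e by simp
      ultimately have "(\<lambda>n. ereal (orbit_sum T \<phi> n x / real n)) \<longlonglongrightarrow> ereal (g x)"
        using tendsto_iff_Liminf_eq_Limsup[OF sequentially_bot,
            of "\<lambda>n. ereal (orbit_sum T \<phi> n x / real n)" "ereal (g x)"] by blast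
      then show ?case by simp
    qed
  qed
qed

end

section \<open>The circle and its rotations\<close>

lemma frac_frac_add [simp]: "frac (frac x + y) = frac (x + y)" for x y :: real
  by (simp add: frac_def algebra_simps) 

lemma frac_frac_diff [simp]: "frac (frac x - y) = frac (x - y)" for x y :: real
  using frac_frac_add[of x "- y"] by simp

lemma space_circle [simp]: "space circle = {0..<1}"
  by (simp add: circle_def space_restrict_space)

lemma frac_in_circle [simp]: "frac x \<in> {0..<1}" for x :: real
  by (simp add: frac_lt_1)

lemma borel_measurable_frac [measurable]: "(frac :: real \<Rightarrow> real) \<in> borel_measurable borel"
  unfolding frac_def[abs_def] by measurable

lemma emeasure_circle: "A \<in> sets borel \<Longrightarrow> A \<subseteq> {0..<1} \<Longrightarrow> emeasure circle A = emeasure lborel A"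
  unfolding circle_def by (rule emeasure_restrict_space) auto

lemma sets_circle: "A \<in> sets circle \<longleftrightarrow> A \<in> sets borel \<and> A \<subseteq> {0..<1}"
  unfolding circle_def by (subst sets_restrict_space_iff) auto

lemma measurable_circleI: "f \<in> borel_measurable borel \<Longrightarrow> f \<in> borel_measurable circle"
  unfolding circle_def by (intro measurable_restrict_space1) simp

lemma measurable_to_circle:
  "f \<in> borel_measurable M \<Longrightarrow> (\<And>x. x \<in> space M \<Longrightarrow> f x \<in> {0..<1}) \<Longrightarrow> f \<in> measurable M circle"
  unfolding circle_def by (intro measurable_restrict_space2) auto

lemma measurable_frac_circle [measurable]: "frac \<in> measurable borel circle"
  by (rule measurable_to_circle) (auto simp: frac_lt_1)

lemma measurable_rotate [measurable]: "(\<lambda>x. frac (x + \<beta>)) \<in> measurable circle circle"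
proof (rule measurable_to_circle)
  show "(\<lambda>x. frac (x + \<beta>)) \<in> borel_measurable circle"
    by (rule measurable_circleI) measurable
qed (auto simp: frac_lt_1)

interpretation circle: prob_space circle
proof
  show "emeasure circle (space circle) = 1"
    by (subst emeasure_circle) auto
qed

lemma nn_integral_lborel_shift:
  fixes c :: real
  assumes [measurable]: "g \<in> borel_measurable borel"
  shows "(\<integral>\<^sup>+x. g (x + c) \<partial>lborel) = (\<integral>\<^sup>+x. g x \<partial>lborel)"
proof -
  have "(\<integral>\<^sup>+x. g x \<partial>lborel) = (\<integral>\<^sup>+x. g x \<partial>distr lborel borel ((+) c))"
    by (simp add: lborel_distr_plus)
  also have "\<dots> = (\<integral>\<^sup>+x. g (c + x) \<partial>lborel)" by (subst nn_integral_distr) auto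
  finally show ?thesis by (simp add: add.commute)
qed

lemma nn_integral_circle:
  assumes "g \<in> borel_measurable borel"
  shows "(\<integral>\<^sup>+x. g x \<partial>circle) = (\<integral>\<^sup>+x. g x * indicator {0..<1} x \<partial>lborel)"
  unfolding circle_def by (subst nn_integral_restrict_space) auto

lemma nn_integral_rotate:
  fixes g :: "real \<Rightarrow> ennreal"
  assumes [measurable]: "g \<in> borel_measurable borel"
  shows "(\<integral>\<^sup>+x. g (frac (x + \<beta>)) \<partial>circle) = (\<integral>\<^sup>+x. g x \<partial>circle)"
proof -
  \<comment> \<open>the rotation exchanges two intervals, each moved by a translation\<close>
  define b where "b = frac \<beta>"
  have b: "0 \<le> b" "b < 1" by (auto simp: b_def frac_lt_1)
  have eq: "frac (x + \<beta>) = frac (x + b)" for x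
    using frac_frac_add[of \<beta> x] by (simp add: b_def add.commute)
  have 1: "frac (x + b) = x + b" if "x \<in> {0..<1-b}" for x using that b by (auto simp: frac_eq)
  have 2: "frac (x + b) = x + (b - 1)" if "x \<in> {1-b..<1}" for x
    using that b by (auto simp: frac_unique_iff)
  have "(\<integral>\<^sup>+x. g (frac (x + \<beta>)) \<partial>circle) = (\<integral>\<^sup>+x. g (frac (x + b)) * indicator {0..<1} x \<partial>lborel)"
    unfolding eq by (rule nn_integral_circle) measurable
  also have "\<dots> = (\<integral>\<^sup>+x. g (x + b) * indicator {b..<1} (x + b)
      + g (x + (b - 1)) * indicator {0..<b} (x + (b - 1)) \<partial>lborel)"
    using b by (intro nn_integral_cong) (auto simp: indicator_def 1 2)
  also have "\<dots> = (\<integral>\<^sup>+x. g (x + b) * indicator {b..<1} (x + b) \<partial>lborel)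
      + (\<integral>\<^sup>+x. g (x + (b - 1)) * indicator {0..<b} (x + (b - 1)) \<partial>lborel)"
    by (rule nn_integral_add) auto
  also have "\<dots> = (\<integral>\<^sup>+x. g x * indicator {b..<1} x \<partial>lborel) + (\<integral>\<^sup>+x. g x * indicator {0..<b} x \<partial>lborel)"
    by (subst (1 2) nn_integral_lborel_shift[where g="\<lambda>x. g x * indicator _ x"]) auto
  also have "\<dots> = (\<integral>\<^sup>+x. g x * indicator {b..<1} x + g x * indicator {0..<b} x \<partial>lborel)"
    by (rule nn_integral_add[symmetric]) auto
  also have "\<dots> = (\<integral>\<^sup>+x. g x * indicator {0..<1} x \<partial>lborel)"
    using b by (intro nn_integral_cong) (auto simp: indicator_def)
  also have "\<dots> = (\<integral>\<^sup>+x. g x \<partial>circle)" by (rule nn_integral_circle[symmetric]) auto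
  finally show ?thesis .
qed

lemma distr_rotate: "distr circle circle (\<lambda>x. frac (x + \<beta>)) = circle"
proof (rule measure_eqI)
  fix A assume "A \<in> sets (distr circle circle (\<lambda>x. frac (x + \<beta>)))"
  then have A: "A \<in> sets circle" by simp
  then have A'[measurable]: "A \<in> sets borel" by (simp add: sets_circle)
  have "emeasure (distr circle circle (\<lambda>x. frac (x + \<beta>))) A
      = (\<integral>\<^sup>+x. indicator A x \<partial>distr circle circle (\<lambda>x. frac (x + \<beta>)))"
    using A by (subst nn_integral_indicator) auto
  also have "\<dots> = (\<integral>\<^sup>+x. indicator A (frac (x + \<beta>)) \<partial>circle)"
    by (rule nn_integral_distr) (use A in auto)
  also have "\<dots> = (\<integral>\<^sup>+x. indicator A x \<partial>circle)" by (rule nn_integral_rotate) auto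
  also have "\<dots> = emeasure circle A" using A by simp
  finally show "emeasure (distr circle circle (\<lambda>x. frac (x + \<beta>))) A = emeasure circle A" .
qed simp

lemma emeasure_rotate:
  assumes A: "A \<in> sets borel"
  shows "emeasure circle {x\<in>{0..<1}. frac (x + \<beta>) \<in> A} = emeasure circle (A \<inter> {0..<1})"
proof -
  have 0: "A \<inter> {0..<1} \<in> sets circle" using A by (auto simp: sets_circle)
  have "emeasure circle (A \<inter> {0..<1}) = emeasure (distr circle circle (\<lambda>x. frac (x + \<beta>))) (A \<inter> {0..<1})"
    by (simp add: distr_rotate)
  also have "\<dots> = emeasure circle ((\<lambda>x. frac (x + \<beta>)) -` (A \<inter> {0..<1}) \<inter> space circle)"
    by (rule emeasure_distr) (use 0 in auto)
  also have "(\<lambda>x. frac (x + \<beta>)) -` (A \<inter> {0..<1}) \<inter> space circle = {x\<in>{0..<1}. frac (x + \<beta>) \<in> A}"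
    by (auto simp: frac_lt_1)
  finally show ?thesis by simp
qed

lemma measure_rotate:
  "A \<in> sets borel \<Longrightarrow> measure circle {x\<in>{0..<1}. frac (x + \<beta>) \<in> A} = measure circle (A \<inter> {0..<1})"
  using emeasure_rotate by (simp add: measure_def)

lemma measure_circle_interval: "0 \<le> u \<Longrightarrow> u \<le> v \<Longrightarrow> v \<le> 1 \<Longrightarrow> measure circle {u..<v} = v - u"
  unfolding measure_def by (subst emeasure_circle) auto

text \<open>
  For an arc \<open>[0, r]\<close>, let \<open>\<phi> t\<close> be the measure of the points of \<open>E\<close> which the rotation by \<open>t\<close> takes
  into the arc. This is a Lipschitz function of \<open>t\<close>, and invariance of \<open>E\<close> makes it constant on the
  dense set of multiples of \<open>\<alpha>\<close> modulo 1, hence constant. Averaging over \<open>t\<close>, its value is \<open>r\<close> times the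
  measure of \<open>E\<close>: the set \<open>E\<close> meets all arcs in proportion to their lengths. So if it is not a null
  set, the normalized restriction of Lebesgue measure to \<open>E\<close> has the same distribution function as
  Lebesgue measure, and \<open>E\<close> has full measure.
\<close>

theorem irrational_rotation_ergodic:
  assumes \<alpha>: "\<alpha> \<notin> \<rat>" and E: "E \<in> sets borel" "E \<subseteq> {0..<1}"
    and inv: "\<And>x. x \<in> {0..<1} \<Longrightarrow> frac (x + \<alpha>) \<in> E \<longleftrightarrow> x \<in> E"
  shows "measure circle E = 0 \<or> measure circle E = 1"
proof -
  note [measurable] = E(1)
  have Ec: "E \<in> sets circle" using E by (simp add: sets_circle)
  have main: "measure circle {x\<in>E. x \<le> r} = r * measure circle E" if r: "0 \<le> r" "r < 1" for r
  proof -
    define \<phi> where "\<phi> t = measure circle {x\<in>E. frac (x + t) \<le> r}" for t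
    have sets_\<phi>: "{x\<in>E. frac (x + t) \<le> r} \<in> sets circle" for t
    proof -
      have "{x\<in>E. frac (x + t) \<le> r} = E \<inter> {x\<in>space borel. frac (x + t) \<le> r}" by auto
      also have "\<dots> \<in> sets borel" by measurable
      finally show ?thesis using E by (auto simp: sets_circle)
    qed
    have per: "\<phi> (t + of_int n) = \<phi> t" for t n
      unfolding \<phi>_def by (simp add: frac_def flip: add.assoc)
    have sh: "\<phi> (t + \<alpha>) = \<phi> t" for t
    proof -
      have "\<phi> (t + \<alpha>) = measure circle {x\<in>{0..<1}. frac (x + \<alpha>) \<in> {y\<in>E. frac (y + t) \<le> r}}"
        unfolding \<phi>_def using E inv by (intro arg_cong[where f="measure circle"]) (auto simp: ac_simps)
      also have "\<dots> = measure circle ({y\<in>E. frac (y + t) \<le> r} \<inter> {0..<1})"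
        by (rule measure_rotate) (use sets_\<phi>[of t] in \<open>simp add: sets_circle\<close>)
      also have "{y\<in>E. frac (y + t) \<le> r} \<inter> {0..<1} = {y\<in>E. frac (y + t) \<le> r}" using E by auto
      finally show ?thesis by (simp add: \<phi>_def)
    qed
    have sh_nat: "\<phi> (of_nat n * \<alpha>) = \<phi> 0" for n
      by (induction n) (use sh[of "of_nat _ * \<alpha>"] in \<open>auto simp: algebra_simps\<close>)
    have lip: "\<bar>\<phi> (t + e) - \<phi> t\<bar> \<le> 2 * e" if e: "0 \<le> e" "e \<le> r \<or> r = 0" "e < 1 - r" for t e
    proof -
      \<comment> \<open>an additional rotation by \<open>e\<close> moves only points of these two intervals across an end of the arc\<close>
      define B where "B = {max 0 (r - e)..r} \<union> {1 - e..<1}"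
      have Bs: "B \<in> sets borel" by (auto simp: B_def)
      have *: "frac (x + (t + e)) \<le> r \<longleftrightarrow> frac (x + t) \<le> r" if "frac (x + t) \<notin> B" for x
      proof -
        define y where "y = frac (x + t)"
        have y: "0 \<le> y" "y < 1" by (auto simp: y_def frac_lt_1)
        have eq: "frac (x + (t + e)) = frac (y + e)" by (simp add: y_def add.assoc)
        have "y < 1 - e" using that y by (auto simp: B_def y_def)
        then have "frac (y + e) = y + e" using y e by (simp add: frac_eq)
        then show ?thesis unfolding eq using that y e by (auto simp: B_def y_def)
      qed
      have Bc: "{x\<in>{0..<1}. frac (x + t) \<in> B} \<in> sets circle"
      proof -
        have "{x\<in>{0..<1}. frac (x + t) \<in> B} = (\<lambda>x. frac (x + t)) -` (B \<inter> {0..<1}) \<inter> space circle"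
          by (auto simp: frac_lt_1)
        also have "\<dots> \<in> sets circle"
          by (rule measurable_sets[OF measurable_rotate]) (use Bs in \<open>auto simp: sets_circle\<close>)
        finally show ?thesis .
      qed
      have mB: "measure circle {x\<in>{0..<1}. frac (x + t) \<in> B} \<le> 2 * e"
      proof -
        have "measure circle {x\<in>{0..<1}. frac (x + t) \<in> B} = measure circle (B \<inter> {0..<1})"
          by (rule measure_rotate[OF Bs])
        also have "B \<inter> {0..<1} = B" using e r by (auto simp: B_def)
        also have "measure circle B \<le> measure circle {max 0 (r - e)..r} + measure circle {1 - e..<1}"
          unfolding B_def by (rule measure_Un_le) (use e r in \<open>auto simp: sets_circle\<close>)
        also have "measure circle {max 0 (r - e)..r} = measure lborel {max 0 (r - e)..r}"
          unfolding measure_def using r by (subst emeasure_circle) auto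
        also have "measure lborel {max 0 (r - e)..r} \<le> e" using e r by auto
        also have "measure circle {1 - e..<1} = e" using e r by (subst measure_circle_interval) auto
        finally show ?thesis by simp
      qed
      have "\<phi> (t + e) \<le> \<phi> t + 2 * e"
      proof -
        have "\<phi> (t + e) \<le> measure circle ({x\<in>E. frac (x + t) \<le> r} \<union> {x\<in>{0..<1}. frac (x + t) \<in> B})"
          unfolding \<phi>_def using E * by (intro circle.finite_measure_mono sets.Un sets_\<phi> Bc) blast
        also have "\<dots> \<le> \<phi> t + measure circle {x\<in>{0..<1}. frac (x + t) \<in> B}"
          unfolding \<phi>_def by (rule measure_Un_le[OF sets_\<phi> Bc])
        finally show ?thesis using mB by simp
      qed
      moreover have "\<phi> t \<le> \<phi> (t + e) + 2 * e"
      proof -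
        have "\<phi> t \<le> measure circle ({x\<in>E. frac (x + (t + e)) \<le> r} \<union> {x\<in>{0..<1}. frac (x + t) \<in> B})"
          unfolding \<phi>_def using E * by (intro circle.finite_measure_mono sets.Un sets_\<phi> Bc) blast
        also have "\<dots> \<le> \<phi> (t + e) + measure circle {x\<in>{0..<1}. frac (x + t) \<in> B}"
          unfolding \<phi>_def by (rule measure_Un_le[OF sets_\<phi> Bc])
        finally show ?thesis using mB by simp
      qed
      ultimately show ?thesis by linarith
    qed
    have const: "\<phi> t = \<phi> 0" for t
    proof (rule ccontr)
      assume "\<phi> t \<noteq> \<phi> 0"
      define d where "d = \<bar>\<phi> t - \<phi> 0\<bar>"
      have d: "d > 0" using \<open>\<phi> t \<noteq> \<phi> 0\<close> by (simp add: d_def)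
      define e where "e = min (d / 3) (min (if r = 0 then 1 else r) ((1 - r) / 2))"
      have e: "e > 0" "e \<le> r \<or> r = 0" "e < 1 - r" "2 * e < d" using d r by (auto simp: e_def min_def)
      obtain m k :: int where k: "k > 0" and km: "\<bar>of_int k * \<alpha> - of_int m - (t + e / 2)\<bar> < e / 2"
        using sequence_of_fractional_parts_is_dense[OF \<alpha> half_gt_zero[OF e(1)], of "t + e / 2"] by blast
      define e' where "e' = of_int k * \<alpha> - of_int m - t"
      have e': "0 \<le> e'" "e' \<le> e" using km by (auto simp: e'_def abs_if split: if_splits)
      have "\<phi> (t + e') = \<phi> 0"
        using sh_nat[of "nat k"] k per[of "of_int k * \<alpha>" "- m"] by (simp add: e'_def)
      moreover have "\<bar>\<phi> (t + e') - \<phi> t\<bar> \<le> 2 * e'" by (rule lip) (use e e' in auto)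
      ultimately show False using e e' by (auto simp: d_def)
    qed
    have "ennreal (\<phi> 0) = (\<integral>\<^sup>+t. ennreal (\<phi> t) \<partial>circle)"
    proof -
      have "(\<lambda>t. ennreal (\<phi> t)) = (\<lambda>t. ennreal (\<phi> 0))" by (rule ext) (subst const, rule refl)
      then show ?thesis using circle.emeasure_space_1 by (simp only: nn_integral_const mult_1_right)
    qed
    also have "\<dots> = (\<integral>\<^sup>+t. (\<integral>\<^sup>+x. indicator E x * indicator {..r} (frac (x + t)) \<partial>circle) \<partial>circle)"
    proof (rule nn_integral_cong)
      fix t
      have "ennreal (\<phi> t) = emeasure circle {x\<in>E. frac (x + t) \<le> r}"
        by (simp add: \<phi>_def circle.emeasure_eq_measure)
      also have "\<dots> = (\<integral>\<^sup>+x. indicator {x\<in>E. frac (x + t) \<le> r} x \<partial>circle)"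
        using sets_\<phi> by simp
      also have "\<dots> = (\<integral>\<^sup>+x. indicator E x * indicator {..r} (frac (x + t)) \<partial>circle)"
        by (intro nn_integral_cong) (auto simp: indicator_def)
      finally show "ennreal (\<phi> t) = (\<integral>\<^sup>+x. indicator E x * indicator {..r} (frac (x + t)) \<partial>circle)" .
    qed
    also have "\<dots> = (\<integral>\<^sup>+x. (\<integral>\<^sup>+t. indicator E x * indicator {..r} (frac (x + t)) \<partial>circle) \<partial>circle)"
    proof -
      interpret pair_sigma_finite circle circle ..
      have "(\<lambda>(x, t). indicator E x * indicator {..r} (frac (x + t)) :: ennreal)
          \<in> borel_measurable (circle \<Otimes>\<^sub>M circle)"
      proof -
        have [measurable]: "(\<lambda>x. x) \<in> measurable circle borel" by (rule measurable_circleI) simp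
        have [measurable]: "fst \<in> borel_measurable (circle \<Otimes>\<^sub>M circle)" "snd \<in> borel_measurable (circle \<Otimes>\<^sub>M circle)"
          using measurable_compose[OF measurable_fst \<open>(\<lambda>x. x) \<in> measurable circle borel\<close>]
            measurable_compose[OF measurable_snd \<open>(\<lambda>x. x) \<in> measurable circle borel\<close>] by (simp_all add: comp_def)
        show ?thesis unfolding split_beta' by measurable
      qed
      from Fubini'[OF this] show ?thesis by simp
    qed
    also have "\<dots> = (\<integral>\<^sup>+x. ennreal r * indicator E x \<partial>circle)"
    proof (rule nn_integral_cong)
      fix x
      have "(\<integral>\<^sup>+t. indicator {..r} (frac (x + t)) \<partial>circle) = (\<integral>\<^sup>+t. indicator {..r} (frac (t + x)) \<partial>circle)"
        by (simp add: add.commute)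
      also have "\<dots> = (\<integral>\<^sup>+t. indicator {..r} t \<partial>circle)" by (rule nn_integral_rotate) auto
      also have "\<dots> = (\<integral>\<^sup>+t. indicator {0..r} t \<partial>circle)" by (intro nn_integral_cong) (auto simp: indicator_def)
      also have "\<dots> = ennreal r"
      proof -
        have sub: "{0..r} \<subseteq> {0..<1}" using r by (intro subsetI) simp
        then have "{0..r} \<in> sets circle" by (simp add: sets_circle)
        then show ?thesis using r emeasure_circle[OF _ sub] by simp
      qed
      finally have *: "(\<integral>\<^sup>+t. indicator {..r} (frac (x + t)) \<partial>circle) = ennreal r" .
      show "(\<integral>\<^sup>+t. indicator E x * indicator {..r} (frac (x + t)) \<partial>circle) = ennreal r * indicator E x"
        using * by (cases "x \<in> E") auto
    qed
    also have "\<dots> = ennreal r * emeasure circle E" using Ec by (simp add: nn_integral_cmult)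
    also have "\<dots> = ennreal (r * measure circle E)"
      using r by (simp add: circle.emeasure_eq_measure ennreal_mult'')
    finally have "\<phi> 0 = r * measure circle E"
      using r by (subst (asm) ennreal_inj) (auto simp: \<phi>_def)
    moreover have "\<phi> 0 = measure circle {x\<in>E. x \<le> r}"
      unfolding \<phi>_def using E by (intro arg_cong[where f="measure circle"]) (auto simp: frac_eq)
    ultimately show ?thesis by simp
  qed
  show ?thesis
  proof (cases "measure circle E = 0")
    case False
    then have pos: "measure circle E > 0" using measure_nonneg[of circle E] by linarith
    have mE: "emeasure lborel E = ennreal (measure circle E)"
      using E by (simp add: circle.emeasure_eq_measure flip: emeasure_circle)
    have fin: "emeasure lborel E \<noteq> \<infinity>" "emeasure lborel E \<noteq> 0" using pos mE by auto
    let ?M1 = "uniform_measure lborel E" and ?M2 = "uniform_measure lborel {0..<1::real}"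
    interpret M1: prob_space ?M1 by (rule prob_space_uniform_measure) (use fin in auto)
    interpret M2: prob_space ?M2 by (rule prob_space_uniform_measure) auto
    have r1: "real_distribution ?M1" "real_distribution ?M2"
      by (unfold_locales; simp)+
    have m: "measure lborel A = measure circle A" if "A \<in> sets borel" "A \<subseteq> {0..<1}" for A
      using that by (simp add: measure_def emeasure_circle)
    have "cdf ?M1 = cdf ?M2"
    proof
      fix r
      have "cdf ?M1 r = measure circle {x\<in>E. x \<le> r} / measure circle E"
      proof -
        have "E \<inter> {..r} = {x\<in>E. x \<le> r}" by auto
        then show ?thesis unfolding cdf_def using fin E m[of E] m[of "E \<inter> {..r}"]
          by (subst measure_uniform_measure) auto
      qed
      also have "\<dots> = measure circle {x\<in>{0..<1}. x \<le> r}"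
      proof -
        consider "r < 0" | "0 \<le> r" "r < 1" | "r \<ge> 1" by linarith
        then show ?thesis
        proof cases
          case 1
          then have "{x\<in>E. x \<le> r} = {}" "{x\<in>{0..<1}. x \<le> r} = {}" using E by auto
          then show ?thesis by (simp only: measure_empty div_0)
        next
          case 2
          have sub: "{0..r} \<subseteq> {0..<1}" using 2 by (intro subsetI) simp
          have "{x\<in>{0..<1}. x \<le> r} = {0..r}" using 2 by auto
          then have "measure circle {x\<in>{0..<1}. x \<le> r} = measure circle {0..r}" by (simp only:)
          also have "\<dots> = r" using m[OF _ sub] 2 by simp
          finally show ?thesis using main[OF 2] pos by simp
        next
          case 3
          then have "{x\<in>E. x \<le> r} = E" "{x\<in>{0..<1}. x \<le> r} = space circle" using E by auto
          then show ?thesis using pos circle.prob_space by (simp only: divide_self_if) simp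
        qed
      qed
      also have "\<dots> = cdf ?M2 r"
      proof -
        have eq: "{0..<1} \<inter> {..r} = {x\<in>{0..<1}. x \<le> r}" by auto
        have "cdf ?M2 r = measure lborel ({0..<1} \<inter> {..r}) / measure lborel {0..<1::real}"
          unfolding cdf_def by (rule measure_uniform_measure) auto
        also have "measure lborel {0..<1::real} = 1" by simp
        also have "measure lborel ({0..<1} \<inter> {..r}) = measure circle ({0..<1} \<inter> {..r})" by (rule m) auto
        finally show ?thesis by (simp only: eq div_by_1)
      qed
      finally show "cdf ?M1 r = cdf ?M2 r" .
    qed
    then have "?M1 = ?M2" by (rule cdf_unique[OF r1])
    then have "measure ?M1 E = measure ?M2 E" by simp
    moreover have "measure ?M1 E = 1" using fin E m[of E] pos by (subst measure_uniform_measure) auto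
    moreover have "measure ?M2 E = measure circle E"
    proof -
      have "{0..<1} \<inter> E = E" using E by auto
      then show ?thesis using m[of E] E by (subst measure_uniform_measure) auto
    qed
    ultimately show ?thesis by simp
  qed simp
qed

section \<open>Special flows over irrational rotations\<close>

text \<open>
  The roof \<open>f\<close> may come arbitrarily close to \<open>0\<close>. The linear growth of the Birkhoff sums, uniform in
  the base point, makes the orbits of the flow exist for all times.
\<close>

locale rotation_flow =
  fixes \<alpha> c b :: real and f :: "real \<Rightarrow> real"
  assumes irrational: "\<alpha> \<notin> \<rat>"
    and periodic: "f (x + 1) = f x"
    and positive: "f x > 0"
    and integrable_f: "integrable circle f"
    and c_pos: "c > 0"
    and growth: "c * real n - b \<le> (\<Sum>j<n. f (z + real j * \<alpha>))"
begin

lemma periodic_int: "f (x + of_int n) = f x"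
proof -
  have nat: "f (x + real m) = f x" for m x
  proof (induction m)
    case (Suc m)
    have "x + real (Suc m) = x + real m + 1" by simp
    then show ?case using Suc periodic[of "x + real m"] by (simp only:)
  qed simp
  show ?thesis
  proof (cases "n \<ge> 0")
    case True then show ?thesis using nat[of x "nat n"] by simp
  next
    case False then show ?thesis using nat[of "x + of_int n" "nat (- n)"] by simp
  qed
qed

lemma f_frac: "f (frac x) = f x"
  using periodic_int[of x "- \<lfloor>x\<rfloor>"] by (simp add: frac_def)

lemma f_frac_add: "f (frac x + y) = f (x + y)"
  using f_frac[of "frac x + y"] f_frac[of "x + y"] by simp

lemma borel_measurable_f [measurable]: "f \<in> borel_measurable borel"
proof -
  have "f \<in> borel_measurable circle" using integrable_f by auto
  then have "(\<lambda>x. f (frac x)) \<in> borel_measurable borel"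
    by (rule measurable_compose[OF measurable_frac_circle])
  then show ?thesis by (simp add: f_frac)
qed

text \<open>
  The Birkhoff sums, extended from the circle to all reals by periodicity, so that the rotation becomes
  a translation.
\<close>

definition S :: "int \<Rightarrow> real \<Rightarrow> real" where
  "S n z = (if n \<ge> 0 then \<Sum>j\<in>{0..<n}. f (z + of_int j * \<alpha>) else - (\<Sum>j\<in>{n..<0}. f (z + of_int j * \<alpha>)))"

lemma S_0 [simp]: "S 0 z = 0" by (simp add: S_def)

lemma S_Suc: "S (n + 1) z = S n z + f (z + of_int n * \<alpha>)"
proof -
  consider "n \<ge> 0" | "n = -1" | "n < -1" by linarith
  then show ?thesis
  proof cases
    case 1
    then have "{0..<n + 1} = insert n {0..<n}" by auto
    then show ?thesis using 1 by (simp add: S_def)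
  next
    case 2
    have "{-1..<0::int} = {-1}" by auto
    then show ?thesis using 2 by (simp add: S_def)
  next
    case 3
    then have "{n..<0} = insert n {n + 1..<0}" by auto
    then show ?thesis using 3 by (simp add: S_def)
  qed
qed

lemma S_add: "S (m + n) z = S m z + S n (z + of_int m * \<alpha>)"
proof (induction n rule: int_induct[where k=0])
  case (step1 i)
  then show ?case using S_Suc[of "m + i" z] S_Suc[of i "z + of_int m * \<alpha>"] by (simp add: algebra_simps)
next
  case (step2 i)
  then show ?case using S_Suc[of "m + (i - 1)" z] S_Suc[of "i - 1" "z + of_int m * \<alpha>"]
    by (simp add: algebra_simps)
qed simp

lemma S_frac: "S n (frac z) = S n z"
  by (simp add: S_def f_frac_add)

lemma S_less_Suc: "S n z < S (n + 1) z"
  using positive by (simp add: S_Suc)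

lemma S_less_nat: "k > 0 \<Longrightarrow> S n z < S (n + int k) z"
proof (induction k)
  case (Suc k)
  have "S n z \<le> S (n + int k) z" using Suc by (cases "k = 0") auto
  also have "\<dots> < S (n + int (Suc k)) z" using S_less_Suc[of "n + int k" z] by (simp add: algebra_simps)
  finally show ?case .
qed simp

lemma S_strict_mono: "m < n \<Longrightarrow> S m z < S n z"
  using S_less_nat[of "nat (n - m)" m z] by simp

lemma S_mono: "m \<le> n \<Longrightarrow> S m z \<le> S n z"
  using S_strict_mono[of m n z] by (cases "m = n") auto

lemma S_nat: "S (int n) z = (\<Sum>j<n. f (z + real j * \<alpha>))"
  by (induction n) (use S_Suc[of "int _" z] in \<open>auto simp: add.commute\<close>)

lemma S_neg_nat: "S (- int n) z = - (\<Sum>j<n. f (z - real (Suc j) * \<alpha>))"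
proof (induction n)
  case (Suc n)
  have "S (- int n) z = S (- int (Suc n)) z + f (z - real (Suc n) * \<alpha>)"
    using S_Suc[of "- int (Suc n)" z] by (simp add: algebra_simps)
  then show ?case using Suc by simp
qed simp

lemma S_diff_ge:
  assumes "m \<le> n"
  shows "S n z - S m z \<ge> c * of_int (n - m) - b"
proof -
  have "S n z - S m z = S (n - m) (z + of_int m * \<alpha>)" using S_add[of m "n - m" z] by simp
  also have "\<dots> = S (int (nat (n - m))) (z + of_int m * \<alpha>)" using assms by simp
  also have "\<dots> \<ge> c * of_int (n - m) - b"
    unfolding S_nat using growth[of "nat (n - m)" "z + of_int m * \<alpha>"] assms by simp
  finally show ?thesis .
qed

lemma ex1_index: "\<exists>!n. S n z \<le> r \<and> r < S (n + 1) z"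
proof -
  \<comment> \<open>far enough for the sums of order \<open>N\<close> and \<open>- N\<close> to enclose \<open>r\<close>\<close>
  define N :: int where "N = \<lceil>(\<bar>r\<bar> + \<bar>b\<bar> + 1) / c\<rceil>"
  have "(\<bar>r\<bar> + \<bar>b\<bar> + 1) / c \<le> of_int N" by (simp add: N_def)
  then have N: "\<bar>r\<bar> + \<bar>b\<bar> + 1 \<le> c * of_int N" using c_pos by (simp add: field_simps)
  then have "c * of_int N > 0" by linarith
  then have N0: "N > 0" using c_pos by (simp add: zero_less_mult_iff)
  have hi: "r < S N z" using S_diff_ge[of 0 N z] N N0 by auto
  have lo: "S (- N) z \<le> r" using S_diff_ge[of "- N" 0 z] N N0 by auto
  define k where "k = (LEAST k. r < S (- N + int k) z)"
  have ex: "r < S (- N + int (nat (2 * N))) z" using hi N0 by simp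
  have k: "r < S (- N + int k) z" unfolding k_def by (rule LeastI[of "\<lambda>k. r < S (- N + int k) z", OF ex])
  have k0: "k > 0" using k lo by (cases "k = 0") auto
  have "k - 1 < (LEAST k. r < S (- N + int k) z)" unfolding k_def[symmetric] using k0 by simp
  then have "\<not> r < S (- N + int (k - 1)) z" by (rule not_less_Least)
  then have "S (- N + int k - 1) z \<le> r \<and> r < S (- N + int k - 1 + 1) z"
    using k k0 by (simp add: of_nat_diff algebra_simps)
  moreover have "m = n" if "S n z \<le> r \<and> r < S (n + 1) z" "S m z \<le> r \<and> r < S (m + 1) z" for m n
  proof (rule ccontr)
    assume "m \<noteq> n"
    then consider "m + 1 \<le> n" | "n + 1 \<le> m" by linarith
    then show False using S_mono[of "m + 1" n z] S_mono[of "n + 1" m z] that by cases auto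
  qed
  ultimately show ?thesis by blast
qed

definition index :: "real \<Rightarrow> real \<Rightarrow> int" where
  "index z r = (THE n. S n z \<le> r \<and> r < S (n + 1) z)"

lemma index: "S (index z r) z \<le> r \<and> r < S (index z r + 1) z"
  using theI'[OF ex1_index[of z r]] by (simp add: index_def)

lemma index_eq: "S n z \<le> r \<Longrightarrow> r < S (n + 1) z \<Longrightarrow> index z r = n"
  unfolding index_def by (rule the1_equality[OF ex1_index]) simp

lemma rotation_funpow: "x \<in> {0..<1} \<Longrightarrow> (rotation \<alpha> ^^ n) x = frac (x + real n * \<alpha>)"
  by (induction n) (auto simp: rotation_def frac_eq algebra_simps)

lemma inv_rotation: "x \<in> {0..<1} \<Longrightarrow> the_inv_into {0..<1} (rotation \<alpha>) x = frac (x - \<alpha>)"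
proof (rule the_inv_into_f_eq)
  show "inj_on (rotation \<alpha>) {0..<1}"
  proof (rule inj_onI)
    fix x y assume xy: "x \<in> {0..<1}" "y \<in> {0..<1}" "rotation \<alpha> x = rotation \<alpha> y"
    then have "frac (frac (x + \<alpha>) - \<alpha>) = frac (frac (y + \<alpha>) - \<alpha>)" by (simp add: rotation_def)
    then have "frac x = frac y" by (simp only: frac_frac_diff add_diff_cancel_right')
    then show "x = y" using xy by (simp add: frac_eq)
  qed
  assume "x \<in> {0..<1}"
  then show "rotation \<alpha> (frac (x - \<alpha>)) = x" by (simp add: rotation_def frac_eq)
qed (auto simp: frac_lt_1)

lemma inv_rotation_funpow:
  "x \<in> {0..<1} \<Longrightarrow> (the_inv_into {0..<1} (rotation \<alpha>) ^^ n) x = frac (x - real n * \<alpha>)"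
proof (induction n)
  case (Suc n)
  then show ?case by (simp add: inv_rotation frac_lt_1 algebra_simps)
qed (simp add: frac_eq)

lemma int_iterate_rotation:
  "x \<in> {0..<1} \<Longrightarrow> int_iterate {0..<1} (rotation \<alpha>) n x = frac (x + of_int n * \<alpha>)"
  by (auto simp: int_iterate_def rotation_funpow inv_rotation_funpow)

lemma birkhoff_sum_eq:
  assumes "x \<in> {0..<1}"
  shows "birkhoff_sum {0..<1} (rotation \<alpha>) f n x = S n x"
  unfolding birkhoff_sum_def S_def using assms by (simp add: int_iterate_rotation f_frac)

abbreviation flow :: "real \<Rightarrow> real \<times> real \<Rightarrow> real \<times> real" where
  "flow \<equiv> special_flow {0..<1} (rotation \<alpha>) f"

abbreviation "X \<equiv> flow_space {0..<1} f"

lemma X_iff: "(x, s) \<in> X \<longleftrightarrow> x \<in> {0..<1} \<and> 0 \<le> s \<and> s < f x"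
  by (simp add: flow_space_def)

lemma flow_index:
  assumes "x \<in> {0..<1}"
  shows "flow t (x, s) = (frac (x + of_int (index x (t + s)) * \<alpha>), t + s - S (index x (t + s)) x)"
  using assms unfolding special_flow_def index_def
  by (simp add: birkhoff_sum_eq int_iterate_rotation Let_def)

lemma flow_eq:
  assumes "x \<in> {0..<1}" "S n x \<le> t + s" "t + s < S (n + 1) x"
  shows "flow t (x, s) = (frac (x + of_int n * \<alpha>), t + s - S n x)"
  using flow_index[OF assms(1)] index_eq[OF assms(2,3)] by simp

lemma flow_in_X:
  assumes "z \<in> X"
  shows "flow t z \<in> X"
proof -
  obtain x s where z: "z = (x, s)" by force
  have x: "x \<in> {0..<1}" using assms by (simp add: z X_iff)
  show ?thesis
    unfolding z flow_index[OF x] X_iff using index[of x "t + s"]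
    by (auto simp: f_frac S_Suc frac_lt_1)
qed

lemma flow_0: "z \<in> X \<Longrightarrow> flow 0 z = z"
  using flow_eq[of "fst z" 0 0 "snd z"] by (cases z) (auto simp: X_iff S_Suc[of 0, simplified] frac_eq)

lemma flow_add:
  assumes "z \<in> X"
  shows "flow (s + t) z = flow s (flow t z)"
proof -
  obtain x r where z: "z = (x, r)" by force
  have x: "x \<in> {0..<1}" using assms by (simp add: z X_iff)
  define n where "n = index x (t + r)"
  define y where "y = frac (x + of_int n * \<alpha>)"
  define r' where "r' = t + r - S n x"
  define m where "m = index y (s + r')"
  have ft: "flow t z = (y, r')" unfolding z flow_index[OF x] y_def r'_def n_def ..
  have y: "y \<in> {0..<1}" by (simp add: y_def frac_lt_1)
  have Sy: "S k y = S (n + k) x - S n x" for k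
    unfolding y_def S_frac using S_add[of n k x] by simp
  have "S m y \<le> s + r' \<and> s + r' < S (m + 1) y" unfolding m_def by (rule index)
  then have "S (n + m) x \<le> s + t + r" "s + t + r < S (n + m + 1) x"
    unfolding Sy r'_def add.assoc[of n m 1] by linarith+
  then have "flow (s + t) z = (frac (x + of_int (n + m) * \<alpha>), s + t + r - S (n + m) x)"
    unfolding z by (intro flow_eq x) auto
  also have "\<dots> = (frac (y + of_int m * \<alpha>), s + r' - S m y)"
  proof -
    have "frac (x + of_int (n + m) * \<alpha>) = frac (y + of_int m * \<alpha>)" by (simp add: y_def algebra_simps)
    moreover have "s + t + r - S (n + m) x = s + r' - S m y" unfolding Sy r'_def by simp
    ultimately show ?thesis by simp
  qed
  also have "\<dots> = flow s (y, r')" unfolding flow_index[OF y] m_def ..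
  finally show ?thesis by (simp add: ft)
qed

lemma flow_funpow: "z \<in> X \<Longrightarrow> (flow t ^^ n) z = flow (real n * t) z"
  by (induction n) (auto simp: flow_0 algebra_simps flow_add[symmetric])

lemma same_fibre_same_orbit:
  assumes "(x, s) \<in> X" "(x, s') \<in> X"
  shows "(x, s) = flow (s - s') (x, s')"
  using assms by (subst flow_eq[of x 0]) (auto simp: X_iff S_Suc[of 0, simplified] frac_eq)

section \<open>The invariant measure of a special flow\<close>

abbreviation "P \<equiv> circle \<Otimes>\<^sub>M (lborel :: real measure)"
abbreviation "M \<equiv> flow_measure circle f"

definition mean_f :: real where "mean_f = (\<integral>x. f x \<partial>circle)"

lemma borel_measurable_S [measurable]: "S n \<in> borel_measurable borel"
  unfolding S_def[abs_def] by measurable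

lemma measurable_id_circle: "(\<lambda>x. x) \<in> measurable circle borel"
  by (rule measurable_circleI) simp

lemma measurable_P_fst [measurable]: "fst \<in> borel_measurable P"
  by (rule measurable_compose[OF measurable_fst measurable_id_circle])

lemma measurable_P_snd [measurable]: "snd \<in> borel_measurable P"
  by (rule measurable_compose[OF measurable_snd]) simp

lemma space_P: "space P = {0..<1} \<times> UNIV"
  by (simp add: space_pair_measure)

lemma X_sets [measurable]: "X \<in> sets P"
proof -
  have "X = {z\<in>space P. 0 \<le> snd z \<and> snd z < f (fst z)}"
    by (auto simp: flow_space_def space_P)
  also have "\<dots> \<in> sets P" by measurable
  finally show ?thesis .
qed

lemma X_Int_space: "X \<inter> space P \<in> sets P"
  by (rule sets.Int[OF X_sets sets.top])

lemma X_subset: "X \<subseteq> space P"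
  by (auto simp: space_P flow_space_def)

lemma emeasure_P_X: "emeasure P X = ennreal mean_f"
proof -
  have "emeasure P X = (\<integral>\<^sup>+x. emeasure lborel (Pair x -` X) \<partial>circle)"
    by (rule lborel.emeasure_pair_measure_alt[OF X_sets])
  also have "\<dots> = (\<integral>\<^sup>+x. ennreal (f x) \<partial>circle)"
  proof (rule nn_integral_cong)
    fix x assume "x \<in> space circle"
    then have "Pair x -` X = {0..<f x}" by (auto simp: X_iff)
    then show "emeasure lborel (Pair x -` X) = ennreal (f x)" using positive[of x] by simp
  qed
  also have "\<dots> = ennreal mean_f"
    unfolding mean_f_def using positive by (intro nn_integral_eq_integral integrable_f) (auto intro: less_imp_le)
  finally show ?thesis .
qed

lemma mean_f_pos: "mean_f > 0"
proof -
  have "mean_f \<ge> 0" unfolding mean_f_def using positive by (intro integral_nonneg_AE) (auto intro: less_imp_le)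
  moreover have "mean_f \<noteq> 0"
  proof
    assume "mean_f = 0"
    then have "AE x in circle. f x = 0"
      unfolding mean_f_def using integral_nonneg_eq_0_iff_AE[OF integrable_f] positive by (auto intro: less_imp_le)
    then have "AE x in circle. False" using positive by (auto elim!: eventually_mono simp: less_le)
    then show False by (simp add: circle.AE_False)
  qed
  ultimately show ?thesis by simp
qed

lemma M_eq: "M = scale_measure (inverse (ennreal mean_f)) (restrict_space P X)"
proof -
  have "space (restrict_space P X) = X" using X_subset by (auto simp: space_restrict_space)
  moreover have "emeasure (restrict_space P X) X = ennreal mean_f"
    by (subst emeasure_restrict_space[OF X_Int_space subset_refl]) (rule emeasure_P_X)
  ultimately show ?thesis unfolding flow_measure_def Let_def by simp
qed

lemma sets_M_eq: "sets M = sets (restrict_space P X)" by (simp add: M_eq)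

lemma space_M: "space M = X"
  using X_subset by (auto simp: M_eq space_restrict_space space_scale_measure)

lemma sets_M: "A \<in> sets M \<longleftrightarrow> A \<in> sets P \<and> A \<subseteq> X"
  unfolding sets_M_eq by (subst sets_restrict_space_iff[OF X_Int_space]) auto

lemma emeasure_M: "A \<in> sets M \<Longrightarrow> emeasure M A = emeasure P A / ennreal mean_f"
proof -
  assume "A \<in> sets M"
  then have "A \<subseteq> X" by (simp only: sets_M)
  then show ?thesis unfolding M_eq emeasure_scale_measure
    by (subst emeasure_restrict_space[OF X_Int_space]) (auto simp: divide_ennreal_def mult.commute)
qed

lemma prob_space_M: "prob_space M"
proof
  have "X \<in> sets M" unfolding sets_M using X_sets by blast
  then show "emeasure M (space M) = 1"
    using mean_f_pos by (simp add: space_M emeasure_M emeasure_P_X ennreal_divide_self)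
qed

lemma measurable_M_P: "(\<lambda>z. z) \<in> measurable M P"
  using measurable_restrict_space1[of "\<lambda>z. z" P P X] sets_M_eq by (simp cong: measurable_cong_sets)

lemma measurable_M_fst [measurable]: "fst \<in> borel_measurable M"
  by (rule measurable_compose[OF measurable_M_P measurable_P_fst])

lemma measurable_M_snd [measurable]: "snd \<in> borel_measurable M"
  by (rule measurable_compose[OF measurable_M_P measurable_P_snd])

lemma measurable_to_M:
  assumes "(\<lambda>y. fst (g y)) \<in> borel_measurable N" "(\<lambda>y. snd (g y)) \<in> borel_measurable N"
    and "\<And>y. y \<in> space N \<Longrightarrow> g y \<in> X"
  shows "g \<in> measurable N M"
proof -
  have "(\<lambda>y. fst (g y)) \<in> measurable N circle"
    by (rule measurable_to_circle[OF assms(1)]) (use assms(3) in \<open>fastforce simp: flow_space_def\<close>)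
  moreover have "(\<lambda>y. snd (g y)) \<in> measurable N lborel" using assms(2) by simp
  ultimately have "(\<lambda>y. (fst (g y), snd (g y))) \<in> measurable N P" by (rule measurable_Pair)
  then have "g \<in> measurable N (restrict_space P X)"
    using assms(3) by (intro measurable_restrict_space2) auto
  then show ?thesis by (simp add: sets_M_eq cong: measurable_cong_sets)
qed

lemma AE_fst:
  assumes "AE x in circle. Q x"
  shows "AE z in M. Q (fst z)"
proof -
  obtain N where N: "N \<in> null_sets circle" "{x\<in>space circle. \<not> Q x} \<subseteq> N"
    using assms by (auto simp: eventually_ae_filter)
  have NP: "N \<times> UNIV \<in> sets P" using N(1) pair_measureI[of N circle UNIV lborel] by auto
  have "emeasure P (N \<times> UNIV) = emeasure circle N * emeasure lborel (UNIV :: real set)"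
    using N(1) by (intro lborel.emeasure_pair_measure_Times) auto
  also have "\<dots> = 0" using N(1) by auto
  finally have 0: "emeasure P (N \<times> UNIV) = 0" .
  have sets: "(N \<times> UNIV) \<inter> X \<in> sets M" unfolding sets_M using NP X_sets by blast
  have "emeasure P ((N \<times> UNIV) \<inter> X) \<le> emeasure P (N \<times> UNIV)" by (rule emeasure_mono[OF _ NP]) auto
  then have "emeasure M ((N \<times> UNIV) \<inter> X) = 0" using 0 by (simp add: emeasure_M[OF sets])
  then have "(N \<times> UNIV) \<inter> X \<in> null_sets M" using sets by auto
  moreover have "{z\<in>space M. \<not> Q (fst z)} \<subseteq> (N \<times> UNIV) \<inter> X"
    using N(2) by (auto simp: space_M X_iff)
  ultimately show ?thesis by (rule AE_I')
qed

lemma measurable_skew: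
  assumes [measurable]: "g \<in> borel_measurable borel"
  shows "(\<lambda>(x, s). (frac (x + \<beta>), s + g x)) \<in> measurable P P"
proof -
  have "(\<lambda>z. (frac (fst z + \<beta>), snd z + g (fst z))) \<in> measurable P P"
  proof (rule measurable_Pair)
    show "(\<lambda>z. frac (fst z + \<beta>)) \<in> measurable P circle"
      by (rule measurable_to_circle) (auto simp: frac_lt_1)
    show "(\<lambda>z. snd z + g (fst z)) \<in> measurable P lborel" by simp
  qed
  then show ?thesis by (simp add: split_beta')
qed

text \<open>
  Each fibre is translated and the base is rotated, so by Fubini's theorem the product measure is
  preserved.
\<close>

lemma emeasure_skew:
  assumes g[measurable]: "g \<in> borel_measurable borel" and A: "A \<in> sets P"
  shows "emeasure P ((\<lambda>(x, s). (frac (x + \<beta>), s + g x)) -` A \<inter> space P) = emeasure P A"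
proof -
  let ?V = "\<lambda>(x, s). (frac (x + \<beta>), s + g x)"
  define h where "h y = emeasure lborel (Pair y -` A)" for y
  have h[measurable]: "h \<in> borel_measurable circle"
    unfolding h_def by (rule lborel.measurable_emeasure_Pair[OF A])
  have "emeasure P (?V -` A \<inter> space P) = (\<integral>\<^sup>+x. emeasure lborel (Pair x -` (?V -` A \<inter> space P)) \<partial>circle)"
    by (rule lborel.emeasure_pair_measure_alt) (rule measurable_sets[OF measurable_skew[OF g] A])
  also have "\<dots> = (\<integral>\<^sup>+x. h (frac (x + \<beta>)) \<partial>circle)"
  proof (rule nn_integral_cong)
    fix x assume x: "x \<in> space circle"
    define B where "B = Pair (frac (x + \<beta>)) -` A"
    have B: "B \<in> sets borel" unfolding B_def using sets_Pair1[OF A] by simp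
    have "Pair x -` (?V -` A \<inter> space P) = (+) (g x) -` B"
      using x by (auto simp: B_def space_P add.commute)
    also have "emeasure lborel ((+) (g x) -` B) = emeasure (distr lborel borel ((+) (g x))) B"
      using B by (subst emeasure_distr) auto
    also have "\<dots> = emeasure lborel B" by (simp add: lborel_distr_plus)
    finally show "emeasure lborel (Pair x -` (?V -` A \<inter> space P)) = h (frac (x + \<beta>))"
      by (simp add: h_def B_def)
  qed
  also have "\<dots> = (\<integral>\<^sup>+x. h x \<partial>distr circle circle (\<lambda>x. frac (x + \<beta>)))"
    by (rule nn_integral_distr[symmetric]) auto
  also have "\<dots> = emeasure P A"
    unfolding distr_rotate h_def by (rule lborel.emeasure_pair_measure_alt[OF A, symmetric])
  finally show ?thesis .
qed

lemma measurable_flow_joint: "(\<lambda>(t, z). flow t z) \<in> measurable (borel \<Otimes>\<^sub>M M) M"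
proof -
  let ?Q = "borel \<Otimes>\<^sub>M M"
  let ?i = "\<lambda>y. index (fst (snd y)) (fst y + snd (snd y))"
  have sQ: "snd (snd y) \<ge> 0 \<and> fst (snd y) \<in> {0..<1} \<and> snd y \<in> X" if "y \<in> space ?Q" for y
    using that by (auto simp: space_pair_measure space_M X_iff)
  have m1[measurable]: "(\<lambda>y. fst (snd y)) \<in> borel_measurable ?Q" "(\<lambda>y. snd (snd y)) \<in> borel_measurable ?Q"
    by (rule measurable_compose[OF measurable_snd], simp)+
  have idx: "?i \<in> measurable ?Q (count_space UNIV)"
  proof (rule iffD2[OF measurable_count_space_eq2_countable], intro conjI ballI)
    fix n :: int
    have "?i -` {n} \<inter> space ?Q = {y\<in>space ?Q. S n (fst (snd y)) \<le> fst y + snd (snd y)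
        \<and> fst y + snd (snd y) < S (n + 1) (fst (snd y))}"
      using index index_eq by blast
    also have "\<dots> \<in> sets ?Q" by measurable
    finally show "?i -` {n} \<inter> space ?Q \<in> sets ?Q" .
  qed simp
  have fl: "flow (fst y) (snd y) = (frac (fst (snd y) + of_int (?i y) * \<alpha>), fst y + snd (snd y) - S (?i y) (fst (snd y)))"
    if "y \<in> space ?Q" for y
    using flow_index[of "fst (snd y)" "fst y" "snd (snd y)"] sQ[OF that] by simp
  show ?thesis
  proof (rule measurable_to_M)
    have "(\<lambda>y. frac (fst (snd y) + of_int (?i y) * \<alpha>)) \<in> borel_measurable ?Q"
      by (rule measurable_compose_countable[OF _ idx]) measurable
    then show "(\<lambda>y. fst (case y of (t, z) \<Rightarrow> flow t z)) \<in> borel_measurable ?Q"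
      by (rule subst[OF measurable_cong, rotated]) (simp add: fl split_beta')
    have "(\<lambda>y. fst y + snd (snd y) - S (?i y) (fst (snd y))) \<in> borel_measurable ?Q"
      by (rule measurable_compose_countable[OF _ idx]) measurable
    then show "(\<lambda>y. snd (case y of (t, z) \<Rightarrow> flow t z)) \<in> borel_measurable ?Q"
      by (rule subst[OF measurable_cong, rotated]) (simp add: fl split_beta')
    show "(case y of (t, z) \<Rightarrow> flow t z) \<in> X" if "y \<in> space ?Q" for y
      using sQ[OF that] flow_in_X by (auto simp: split_beta')
  qed
qed

lemma measurable_flow [measurable]: "flow t \<in> measurable M M"
  using measurable_compose[OF measurable_Pair1' measurable_flow_joint, of t] by simp

text \<open>
  On the set of points over which the flow crosses the roof exactly \<open>n\<close> times, the time-\<open>t\<close> map is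
  the skew translation \<open>V n\<close>. The images of these countably many pieces are again a partition of the
  flow space: they are the pieces of the time-\<open>(- t)\<close> map.
\<close>

lemma emeasure_flow_vimage:
  assumes A: "A \<in> sets M"
  shows "emeasure P (flow t -` A \<inter> X) = emeasure P A"
proof -
  have AP: "A \<in> sets P" "A \<subseteq> X" using A by (auto simp: sets_M)
  define V where "V n = (\<lambda>(x, s). (frac (x + of_int n * \<alpha>), s + (t - S n x)))" for n
  \<comment> \<open>the piece of the target in which the inverse map crosses the roof \<open>- n\<close> times\<close>
  define F where "F n = {z\<in>X. index (fst z) (snd z - t) = - n}" for n
  have F_iff: "z \<in> F n \<longleftrightarrow> z \<in> X \<and> S (- n) (fst z) \<le> snd z - t \<and> snd z - t < S (- n + 1) (fst z)" for z n
    using index[of "fst z" "snd z - t"] index_eq[of "- n" "fst z" "snd z - t"] by (auto simp: F_def)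
  have F_sets: "F n \<in> sets P" for n
  proof -
    have "F n = X \<inter> {z\<in>space P. S (- n) (fst z) \<le> snd z - t \<and> snd z - t < S (- n + 1) (fst z)}"
      using X_subset by (auto simp: F_iff)
    also have "\<dots> \<in> sets P" by measurable
    finally show ?thesis .
  qed
  define G where "G n = V n -` (A \<inter> F n) \<inter> space P" for n
  have V_m: "V n \<in> measurable P P" for n unfolding V_def by (rule measurable_skew) measurable
  have G_sets: "G n \<in> sets P" for n
    unfolding G_def using AP F_sets by (intro measurable_sets[OF V_m]) auto
  have G_iff: "z \<in> G n \<longleftrightarrow> z \<in> X \<and> flow t z \<in> A \<and> index (fst z) (t + snd z) = n" for z n
  proof -
    obtain x s where z: "z = (x, s)" by force
    show ?thesis
    proof (cases "x \<in> {0..<1}")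
      case False
      then show ?thesis by (auto simp: z G_def space_P X_iff)
    next
      case x: True
      define y where "y = frac (x + of_int n * \<alpha>)"
      have Sy: "S k y = S (n + k) x - S n x" for k
        unfolding y_def S_frac using S_add[of n k x] by simp
      have fy: "f y = S (n + 1) x - S n x" by (simp add: y_def f_frac S_Suc)
      have f1: "S 1 x = f x" using S_Suc[of 0 x] by simp
      have "z \<in> G n \<longleftrightarrow> V n z \<in> A \<and> V n z \<in> F n" using x by (auto simp: G_def z space_P)
      also have "\<dots> \<longleftrightarrow> V n z \<in> A \<and> V n z \<in> X \<and> 0 \<le> s \<and> s < f x"
        unfolding F_iff by (auto simp: V_def z y_def[symmetric] Sy f1)
      also have "\<dots> \<longleftrightarrow> z \<in> X \<and> V n z \<in> A \<and> index x (t + s) = n"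
      proof -
        have "V n z \<in> X \<longleftrightarrow> S n x \<le> t + s \<and> t + s < S (n + 1) x"
          by (auto simp: V_def z X_iff y_def[symmetric] fy) (auto simp: y_def frac_lt_1)
        also have "\<dots> \<longleftrightarrow> index x (t + s) = n" using index[of x "t + s"] index_eq[of n x "t + s"] by auto
        finally show ?thesis using x by (auto simp: z X_iff)
      qed
      also have "\<dots> \<longleftrightarrow> z \<in> X \<and> flow t z \<in> A \<and> index (fst z) (t + snd z) = n"
        using flow_index[OF x, of t s] by (auto simp: z V_def algebra_simps)
      finally show ?thesis .
    qed
  qed
  have "flow t -` A \<inter> X = (\<Union>n. G n)" by (auto simp: G_iff)
  then have "emeasure P (flow t -` A \<inter> X) = emeasure P (\<Union>n. G n)" by simp
  also have "\<dots> = (\<integral>\<^sup>+n. emeasure P (G n) \<partial>count_space UNIV)"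
    by (rule emeasure_UN_countable[OF G_sets]) (auto simp: disjoint_family_on_def G_iff)
  also have "\<dots> = (\<integral>\<^sup>+n. emeasure P (A \<inter> F n) \<partial>count_space UNIV)"
    unfolding G_def V_def using AP F_sets by (intro nn_integral_cong emeasure_skew) auto
  also have "\<dots> = emeasure P (\<Union>n. A \<inter> F n)"
    using AP F_sets by (intro emeasure_UN_countable[symmetric]) (auto simp: disjoint_family_on_def F_def)
  also have "(\<Union>n. A \<inter> F n) = A"
  proof -
    have "z \<in> (\<Union>n. A \<inter> F n)" if "z \<in> A" for z
      using that AP(2) by (auto simp: F_def intro!: exI[of _ "- index (fst z) (snd z - t)"])
    then show ?thesis by auto
  qed
  finally show ?thesis .
qed

lemma distr_flow: "distr M M (flow t) = M"
proof (rule measure_eqI)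
  fix A assume "A \<in> sets (distr M M (flow t))"
  then have A: "A \<in> sets M" by simp
  have "flow t -` A \<inter> space M \<in> sets M" by (rule measurable_sets[OF measurable_flow A])
  then show "emeasure (distr M M (flow t)) A = emeasure M A"
    using A by (simp add: emeasure_distr emeasure_M space_M emeasure_flow_vimage)
qed simp

lemma measure_preserving_flow_M: "measure_preserving_flow M flow"
  unfolding measure_preserving_flow_def
  using flow_0 flow_add measurable_flow_joint distr_flow by (auto simp: space_M)

text \<open>
  A flow-invariant set consists of full fibres over a base set, which is invariant under the rotation.
\<close>

lemma ergodic_flow_M: "ergodic_flow M flow"
  unfolding ergodic_flow_def
proof (intro conjI ballI impI)
  show "measure_preserving_flow M flow" by (rule measure_preserving_flow_M)
  fix A assume A: "A \<in> sets M" and inv: "\<forall>t. flow t -` A \<inter> space M = A"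
  have AX: "A \<subseteq> X" "A \<in> sets P" using A by (auto simp: sets_M)
  have flow_A: "flow t z \<in> A \<longleftrightarrow> z \<in> A" if "z \<in> X" for t z
    using inv that by (auto simp: space_M)
  define E where "E = {x\<in>{0..<1}. (x, 0) \<in> A}"
  have A_iff: "(x, s) \<in> A \<longleftrightarrow> x \<in> E" if xs: "(x, s) \<in> X" for x s
  proof -
    have x0: "(x, 0) \<in> X" using xs by (auto simp: X_iff)
    have x: "x \<in> {0..<1}" using xs by (simp add: X_iff)
    have "(x, s) \<in> A \<longleftrightarrow> flow s (x, 0) \<in> A" using same_fibre_same_orbit[OF xs x0] by simp
    also have "\<dots> \<longleftrightarrow> (x, 0) \<in> A" by (rule flow_A[OF x0])
    also have "\<dots> \<longleftrightarrow> x \<in> E" using x unfolding E_def by blast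
    finally show ?thesis .
  qed
  have E_sets: "E \<in> sets circle"
  proof -
    have "(\<lambda>x. (x, 0)) \<in> measurable circle P" by measurable
    then have "(\<lambda>x. (x, 0)) -` A \<inter> space circle \<in> sets circle" by (rule measurable_sets[OF _ AX(2)])
    also have "(\<lambda>x. (x, 0)) -` A \<inter> space circle = E" by (auto simp: E_def)
    finally show ?thesis .
  qed
  have "measure circle E = 0 \<or> measure circle E = 1"
  proof (rule irrational_rotation_ergodic[OF irrational])
    show "E \<in> sets borel" "E \<subseteq> {0..<1}" using E_sets by (auto simp: sets_circle)
    fix x :: real assume x: "x \<in> {0..<1}"
    have x0: "(x, 0) \<in> X" using x positive by (auto simp: X_iff)
    have "flow (f x) (x, 0) = (frac (x + \<alpha>), 0)"
      using flow_eq[OF x, of 1 "f x" 0] S_Suc[of 0 x] S_less_Suc[of 1 x] by simp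
    then show "frac (x + \<alpha>) \<in> E \<longleftrightarrow> x \<in> E"
      using flow_A[OF x0, of "f x"] x by (auto simp: E_def frac_lt_1)
  qed
  moreover interpret M: prob_space M by (rule prob_space_M)
  have "measure M A = 0" if "measure circle E = 0"
  proof -
    have "E \<in> null_sets circle" using that E_sets by (auto simp: circle.emeasure_eq_measure)
    then have "AE z in M. fst z \<notin> E" by (intro AE_fst AE_not_in)
    then have "AE z in M. z \<notin> A"
      using AE_space by eventually_elim (use A_iff in \<open>auto simp: space_M\<close>)
    then show ?thesis using A M.prob_eq_0 by auto
  qed
  moreover have "measure M A = 1" if "measure circle E = 1"
  proof -
    have "AE x in circle. x \<in> E" using that E_sets circle.prob_eq_1 by auto
    then have "AE z in M. fst z \<in> E" by (rule AE_fst)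
    then have "AE z in M. z \<in> A"
      using AE_space by eventually_elim (use A_iff in \<open>auto simp: space_M\<close>)
    then show ?thesis using A M.prob_eq_1 by auto
  qed
  ultimately show "measure M A = 0 \<or> measure M A = 1" by blast
qed

end

section \<open>Metric and Borel structure of the flow space\<close>

text \<open>
  In backward time the enumeration starts with \<open>x - \<alpha>\<close>, because a Birkhoff sum of negative order \<open>- n\<close>
  runs over the times \<open>- 1, \<dots>, - n\<close>.
\<close>

definition orbit_point :: "real \<Rightarrow> bool \<Rightarrow> real \<Rightarrow> nat \<Rightarrow> real" where
  "orbit_point \<alpha> fwd x j = (if fwd then x + real j * \<alpha> else x - real (Suc j) * \<alpha>)"

lemma circle_norm_le: "circle_norm x \<le> \<bar>x - of_int n\<bar>"
  unfolding circle_norm_def using infdist_le[of "of_int n" "\<int>" x] by (simp add: dist_real_def)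

lemma circle_norm_attains: obtains n where "circle_norm x = \<bar>x - of_int n\<bar>"
proof -
  have "(\<int> :: real set) \<noteq> {}" using Ints_0 by blast
  then obtain y where "y \<in> \<int>" "infdist x \<int> = dist x y"
    using infdist_attains_inf[OF closed_Ints, of x] by blast
  then show thesis using that by (auto simp: circle_norm_def dist_real_def elim: Ints_cases)
qed

lemma circle_norm_nonneg: "circle_norm x \<ge> 0"
  by (simp add: circle_norm_def infdist_nonneg)

lemma circle_norm_le_abs: "circle_norm x \<le> \<bar>x\<bar>"
  using circle_norm_le[of x 0] by simp

lemma circle_norm_minus: "circle_norm (- x) = circle_norm x"
proof -
  have "circle_norm (- x) \<le> circle_norm x" for x
  proof -
    obtain n where n: "circle_norm x = \<bar>x - of_int n\<bar>" by (rule circle_norm_attains)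
    show ?thesis using circle_norm_le[of "- x" "- n"] n by simp
  qed
  from this[of x] this[of "- x"] show ?thesis by simp
qed

lemma circle_norm_add_int: "circle_norm (x + of_int m) = circle_norm x"
proof -
  have le: "circle_norm (x + of_int m) \<le> circle_norm x" for x m
  proof -
    obtain n where n: "circle_norm x = \<bar>x - of_int n\<bar>" by (rule circle_norm_attains)
    show ?thesis using circle_norm_le[of "x + of_int m" "n + m"] n by simp
  qed
  show ?thesis using le[of x m] le[of "x + of_int m" "- m"] by simp
qed

lemma circle_norm_triangle: "circle_norm (x + y) \<le> circle_norm x + circle_norm y"
proof -
  obtain n where n: "circle_norm x = \<bar>x - of_int n\<bar>" by (rule circle_norm_attains)
  obtain m where m: "circle_norm y = \<bar>y - of_int m\<bar>" by (rule circle_norm_attains)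
  show ?thesis using circle_norm_le[of "x + y" "n + m"] n m by simp
qed

lemma circle_norm_eq_0: "circle_norm x = 0 \<longleftrightarrow> x \<in> \<int>"
proof
  assume "circle_norm x = 0"
  then show "x \<in> \<int>" by (metis circle_norm_attains Ints_of_int abs_eq_0 eq_iff_diff_eq_0)
next
  assume "x \<in> \<int>"
  then show "circle_norm x = 0" by (simp add: circle_norm_def)
qed

lemma Metric_space_circle: "Metric_space {0..<1} circle_dist"
proof
  fix x y z :: real
  show "0 \<le> circle_dist x y" by (simp add: circle_dist_def circle_norm_nonneg)
  show "circle_dist x y = circle_dist y x"
    using circle_norm_minus[of "x - y"] by (simp add: circle_dist_def)
  show "circle_dist x z \<le> circle_dist x y + circle_dist y z"
    using circle_norm_triangle[of "x - y" "y - z"] by (simp add: circle_dist_def)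
  assume xy: "x \<in> {0..<1}" "y \<in> {0..<1}"
  show "circle_dist x y = 0 \<longleftrightarrow> x = y"
  proof
    assume "circle_dist x y = 0"
    then obtain n where "x - y = of_int n" by (auto simp: circle_dist_def circle_norm_eq_0 elim: Ints_cases)
    moreover from this xy have "-1 < real_of_int n" "real_of_int n < 1" by auto
    then have "n = 0" by linarith
    ultimately show "x = y" by simp
  qed (simp add: circle_dist_def circle_norm_eq_0)
qed

context rotation_flow begin

lemma Metric_space_M: "Metric_space (space M) (flow_dist circle_dist)"
proof -
  interpret Metric_space "{0..<1::real}" circle_dist by (rule Metric_space_circle)
  show ?thesis
  proof
    fix z w v :: "real \<times> real"
    show "0 \<le> flow_dist circle_dist z w" by (auto simp: flow_dist_def split_beta')
    show "flow_dist circle_dist z w = flow_dist circle_dist w z"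
      by (simp add: flow_dist_def split_beta' commute abs_minus_commute)
    assume zw: "z \<in> space M" "w \<in> space M"
    then have "fst z \<in> {0..<1}" "fst w \<in> {0..<1}" by (auto simp: space_M flow_space_def)
    then have "circle_dist (fst z) (fst w) = 0 \<longleftrightarrow> fst z = fst w" by (rule zero)
    moreover have "flow_dist circle_dist z w = 0 \<longleftrightarrow> circle_dist (fst z) (fst w) = 0 \<and> \<bar>snd z - snd w\<bar> = 0"
      unfolding flow_dist_def split_beta' by (rule add_nonneg_eq_0_iff) auto
    ultimately show "flow_dist circle_dist z w = 0 \<longleftrightarrow> z = w" by (simp add: prod_eq_iff)
    assume v: "v \<in> space M"
    have "circle_dist (fst z) (fst v) \<le> circle_dist (fst z) (fst w) + circle_dist (fst w) (fst v)"
      by (rule triangle) (use zw v in \<open>auto simp: space_M flow_space_def\<close>)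
    then show "flow_dist circle_dist z v \<le> flow_dist circle_dist z w + flow_dist circle_dist w v"
      by (simp add: flow_dist_def split_beta')
  qed
qed

text \<open>
  Dividing the second coordinate by \<open>f\<close> is a Borel isomorphism of the flow space onto the unit square
  without its upper and right edges, which is a Polish space. The topology is pulled back from there; it
  may differ from the one of the plane when \<open>f\<close> is discontinuous.
\<close>

lemma standard_borel_M: "standard_borel M"
proof -
  define Q :: "(real \<times> real) set" where "Q = {0..<1} \<times> {0..<1}"
  define \<Phi> :: "real \<times> real \<Rightarrow> real \<times> real" where "\<Phi> = (\<lambda>z. (fst z, snd z / f (fst z)))"
  define \<Psi> :: "real \<times> real \<Rightarrow> real \<times> real" where "\<Psi> = (\<lambda>z. (fst z, snd z * f (fst z)))"
  have pos: "f x \<noteq> 0" "0 < f x" for x using positive[of x] by auto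
  have \<Phi>Q: "\<Phi> z \<in> Q" "\<Psi> (\<Phi> z) = z" if "z \<in> X" for z
    using that pos by (auto simp: \<Phi>_def \<Psi>_def Q_def flow_space_def intro: less_imp_le)
  have \<Psi>X: "\<Psi> w \<in> X" "\<Phi> (\<Psi> w) = w" if "w \<in> Q" for w
    using that pos by (auto simp: \<Phi>_def \<Psi>_def Q_def flow_space_def less_imp_le mult_less_cancel_right1)
  define \<tau> where "\<tau> = pullback_topology X \<Phi> (top_of_set Q)"
  have openin_\<tau>: "openin \<tau> U \<longleftrightarrow> (\<exists>W. openin (top_of_set Q) W \<and> U = \<Phi> -` W \<inter> X)" for U
    by (simp add: \<tau>_def openin_pullback_topology)
  have top_\<tau>: "topspace \<tau> = X" using \<Phi>Q by (auto simp: \<tau>_def topspace_pullback_topology)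
  have "homeomorphic_maps \<tau> (top_of_set Q) \<Phi> \<Psi>"
    unfolding homeomorphic_maps_def
  proof (intro conjI ballI)
    show "continuous_map \<tau> (top_of_set Q) \<Phi>"
      unfolding continuous_map_def top_\<tau> using \<Phi>Q by (auto simp: openin_\<tau>)
    show "continuous_map (top_of_set Q) \<tau> \<Psi>"
      unfolding continuous_map_def top_\<tau>
    proof (intro conjI allI impI)
      fix U assume "openin \<tau> U"
      then obtain W where W: "openin (top_of_set Q) W" "U = \<Phi> -` W \<inter> X" by (auto simp: openin_\<tau>)
      have "W \<subseteq> Q" using W(1) openin_subset by fastforce
      then have "{x \<in> topspace (top_of_set Q). \<Psi> x \<in> U} = W" using W \<Psi>X by auto
      then show "openin (top_of_set Q) {x \<in> topspace (top_of_set Q). \<Psi> x \<in> U}" using W by simp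
    qed (use \<Psi>X in auto)
  qed (use \<Phi>Q \<Psi>X in \<open>auto simp: top_\<tau>\<close>)
  then have homeo: "\<tau> homeomorphic_space top_of_set Q" by (auto simp: homeomorphic_space_def)
  have "completely_metrizable_space (top_of_set Q)"
  proof -
    \<comment> \<open>the square is closed in the open set \<open>U\<close>\<close>
    define U :: "(real \<times> real) set" where "U = {..<1} \<times> {..<1}"
    have "open U" by (simp add: U_def open_Times)
    then have "completely_metrizable_space (top_of_set U)"
      by (intro completely_metrizable_space_openin completely_metrizable_space_euclidean) simp
    moreover have "closedin (top_of_set U) Q"
    proof -
      have "Q = U \<inter> ({0..} \<times> {0..})" by (auto simp: Q_def U_def)
      moreover have "closed ({0..} \<times> {0..} :: (real \<times> real) set)" by (intro closed_Times) auto
      ultimately show ?thesis by (auto simp: closedin_closed)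
    qed
    ultimately have "completely_metrizable_space (subtopology (top_of_set U) Q)"
      by (rule completely_metrizable_space_closedin)
    moreover have "subtopology (top_of_set U) Q = top_of_set Q"
    proof -
      have "U \<inter> Q = Q" by (auto simp: Q_def U_def)
      then show ?thesis by (simp add: subtopology_subtopology)
    qed
    ultimately show ?thesis by simp
  qed
  then have cm: "completely_metrizable_space \<tau>"
    using homeomorphic_completely_metrizable_space[OF homeo] by simp
  have "separable_space (top_of_set Q)"
  proof -
    obtain C where "countable C" "C \<subseteq> Q" "Q \<subseteq> closure C" using separable[of Q] by blast
    then show ?thesis unfolding separable_space_def
      by (intro exI[of _ C]) (auto simp: closure_of_subtopology Int_absorb1)
  qed
  then have sep: "separable_space \<tau>" using homeomorphic_separable_space[OF homeo] by simp
  have "sets M = sigma_sets X {U. openin \<tau> U}"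
  proof -
    have eq: "{U. openin \<tau> U} = {\<Phi> -` W \<inter> X |W. W \<in> {W. openin (top_of_set Q) W}}"
      by (auto simp: openin_\<tau>)
    have "sigma_sets X {U. openin \<tau> U} = {\<Phi> -` W \<inter> X |W. W \<in> sigma_sets Q {W. openin (top_of_set Q) W}}"
      unfolding eq by (rule sigma_sets_vimage_commute[symmetric]) (use \<Phi>Q in auto)
    also have "sigma_sets Q {W. openin (top_of_set Q) W} = sets (restrict_space borel Q)"
    proof -
      have Qs: "Q \<in> sigma_sets UNIV {S. open S}"
        unfolding sets_borel[symmetric] unfolding Q_def borel_prod[symmetric] by (intro pair_measureI) auto
      have "sets (restrict_space borel Q) = (\<inter>) Q ` sigma_sets UNIV {S. open S}"
        unfolding sets_restrict_space sets_borel ..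
      also have "\<dots> = sigma_sets Q ((\<inter>) Q ` {S. open S})"
        by (rule sigma_sets_Int[OF Qs]) simp
      also have "(\<inter>) Q ` {S. open S} = {W. openin (top_of_set Q) W}"
        by (auto simp: openin_open)
      finally show ?thesis by simp
    qed
    also have "{\<Phi> -` W \<inter> X |W. W \<in> sets (restrict_space borel Q)} = sets M"
    proof -
      have m\<Phi>: "\<Phi> \<in> measurable M (restrict_space borel Q)"
      proof (rule measurable_restrict_space2)
        show "\<Phi> \<in> borel_measurable M" unfolding \<Phi>_def borel_prod[symmetric] by measurable
      qed (use \<Phi>Q in \<open>auto simp: space_M\<close>)
      have m\<Psi>: "\<Psi> \<in> measurable (restrict_space borel Q) M"
      proof (rule measurable_to_M)
        have "(\<lambda>w. fst (\<Psi> w)) \<in> borel_measurable (borel \<Otimes>\<^sub>M borel)"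
          "(\<lambda>w. snd (\<Psi> w)) \<in> borel_measurable (borel \<Otimes>\<^sub>M borel)"
          unfolding \<Psi>_def by measurable
        then show "(\<lambda>w. fst (\<Psi> w)) \<in> borel_measurable (restrict_space borel Q)"
          "(\<lambda>w. snd (\<Psi> w)) \<in> borel_measurable (restrict_space borel Q)"
          unfolding borel_prod by (auto intro: measurable_restrict_space1)
      qed (use \<Psi>X in \<open>auto simp: space_restrict_space\<close>)
      show ?thesis
      proof (intro equalityI subsetI)
        fix A assume "A \<in> {\<Phi> -` W \<inter> X |W. W \<in> sets (restrict_space borel Q)}"
        then show "A \<in> sets M" using measurable_sets[OF m\<Phi>] by (auto simp: space_M)
      next
        fix A assume A: "A \<in> sets M"
        then have "A \<subseteq> X" by (simp only: sets_M)
        define W where "W = \<Psi> -` A \<inter> space (restrict_space borel Q)"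
        have "W \<in> sets (restrict_space borel Q)" unfolding W_def by (rule measurable_sets[OF m\<Psi> A])
        moreover have "A = \<Phi> -` W \<inter> X"
        proof -
          have "\<Phi> z \<in> W \<longleftrightarrow> z \<in> A" if "z \<in> X" for z
            using \<Phi>Q[OF that] by (simp add: W_def space_restrict_space)
          then show ?thesis using \<open>A \<subseteq> X\<close> by blast
        qed
        ultimately show "A \<in> {\<Phi> -` W \<inter> X |W. W \<in> sets (restrict_space borel Q)}" by blast
      qed
    qed
    finally show ?thesis by simp
  qed
  then show ?thesis unfolding standard_borel_def using cm sep top_\<tau> by (auto simp: space_M)
qed

end

section \<open>Windows of almost constant sums\<close>

text \<open>
  Split \<open>[R, 2 R)\<close> into \<open>J\<close> windows and pair each of them with its translate by \<open>R\<close>. The total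
  variation on all pairs is at most \<open>c2 < J e\<close>, so on one pair it is at most \<open>e\<close>. Over a distance \<open>R\<close>
  the sum changes by at least \<open>c1\<close>, so it is at least \<open>c1 / 2\<close> in modulus at the start of one window
  of this pair.
\<close>

lemma stable_window:
  fixes v :: "nat \<Rightarrow> real"
  assumes var: "(\<Sum>j<3 * R. \<bar>v j\<bar>) \<le> c2"
    and block: "\<And>n. n \<le> 2 * R \<Longrightarrow> c1 \<le> \<bar>\<Sum>j\<in>{n..<n + R}. v j\<bar>"
    and J: "c2 < real J * e" "J > 0"
  obtains k where "R \<le> k" "k + R div J \<le> 3 * R" "c1 / 2 \<le> \<bar>\<Sum>j<k. v j\<bar>" "\<bar>\<Sum>j<k. v j\<bar> \<le> c2"
    "\<And>n. n \<in> {k..k + R div J} \<Longrightarrow> \<bar>(\<Sum>j<n. v j) - (\<Sum>j<k. v j)\<bar> \<le> e"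
proof -
  define W where "W = R div J"
  have JW: "J * W \<le> R" by (simp add: W_def)
  define D where "D n = (\<Sum>j<n. v j)" for n
  have diff: "D n - D m = (\<Sum>j\<in>{m..<n}. v j)" if "m \<le> n" for m n
    unfolding D_def using sum_diff_nat_ivl[of 0 m n v] that by (simp add: atLeast0LessThan)
  define V where "V i = (\<Sum>j\<in>{R + i * W..<R + i * W + W}. \<bar>v j\<bar>) + (\<Sum>j\<in>{2 * R + i * W..<2 * R + i * W + W}. \<bar>v j\<bar>)" for i
  have group: "(\<Sum>i<J. \<Sum>j\<in>{a + i * W..<a + i * W + W}. \<bar>v j\<bar>) \<le> (\<Sum>j\<in>{a..<a + R}. \<bar>v j\<bar>)" for a
  proof -
    have "(\<Sum>i<J. \<Sum>j\<in>{a + i * W..<a + i * W + W}. \<bar>v j\<bar>) = (\<Sum>i<J. \<Sum>j\<in>{i * W..<i * W + W}. \<bar>v (j + a)\<bar>)"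
    proof (rule sum.cong[OF refl])
      fix i
      show "(\<Sum>j\<in>{a + i * W..<a + i * W + W}. \<bar>v j\<bar>) = (\<Sum>j\<in>{i * W..<i * W + W}. \<bar>v (j + a)\<bar>)"
        using sum.shift_bounds_nat_ivl[of "\<lambda>j. \<bar>v j\<bar>" "i * W" a "i * W + W"] by (simp add: ac_simps)
    qed
    also have "\<dots> = (\<Sum>j<J * W. \<bar>v (j + a)\<bar>)" by (rule sum.nat_group)
    also have "\<dots> \<le> (\<Sum>j<R. \<bar>v (j + a)\<bar>)" using JW by (intro sum_mono2) auto
    also have "\<dots> = (\<Sum>j\<in>{a..<a + R}. \<bar>v j\<bar>)"
      using sum.shift_bounds_nat_ivl[of "\<lambda>j. \<bar>v j\<bar>" 0 a R] by (simp add: atLeast0LessThan ac_simps)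
    finally show ?thesis .
  qed
  have "\<exists>i<J. V i \<le> e"
  proof (rule ccontr)
    assume "\<not> ?thesis"
    then have "\<And>i. i < J \<Longrightarrow> e \<le> V i" by force
    then have "(\<Sum>i<J. e) \<le> (\<Sum>i<J. V i)" by (intro sum_mono) auto
    also have "\<dots> \<le> (\<Sum>j\<in>{R..<R + R}. \<bar>v j\<bar>) + (\<Sum>j\<in>{2 * R..<2 * R + R}. \<bar>v j\<bar>)"
      unfolding V_def sum.distrib by (intro add_mono group)
    also have "\<dots> = (\<Sum>j\<in>{R..<3 * R}. \<bar>v j\<bar>)"
    proof -
      have "R + R = 2 * R" "2 * R + R = 3 * R" by auto
      then show ?thesis
        using sum.atLeastLessThan_concat[of R "2 * R" "3 * R" "\<lambda>j. \<bar>v j\<bar>"] by (simp only:)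
    qed
    also have "\<dots> \<le> (\<Sum>j<3 * R. \<bar>v j\<bar>)" by (intro sum_mono2) auto
    finally show False using var J by simp
  qed
  then obtain i where i: "i < J" "V i \<le> e" by blast
  define w where "w = R + i * W"
  have iW: "i * W + W \<le> R"
  proof -
    have "i * W + W = Suc i * W" by simp
    also have "\<dots> \<le> J * W" using i by (intro mult_right_mono) auto
    finally show ?thesis using JW by simp
  qed
  have s1: "(\<Sum>j\<in>{w..<w + W}. \<bar>v j\<bar>) \<le> e" "(\<Sum>j\<in>{w + R..<w + R + W}. \<bar>v j\<bar>) \<le> e"
  proof -
    have nn: "0 \<le> (\<Sum>j\<in>{w..<w + W}. \<bar>v j\<bar>)" "0 \<le> (\<Sum>j\<in>{w + R..<w + R + W}. \<bar>v j\<bar>)"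
      by (auto intro: sum_nonneg)
    have "V i = (\<Sum>j\<in>{w..<w + W}. \<bar>v j\<bar>) + (\<Sum>j\<in>{w + R..<w + R + W}. \<bar>v j\<bar>)"
    proof -
      have "2 * R + i * W = w + R" by (simp add: w_def)
      then show ?thesis unfolding V_def w_def[symmetric] by (simp only:)
    qed
    then show "(\<Sum>j\<in>{w..<w + W}. \<bar>v j\<bar>) \<le> e" "(\<Sum>j\<in>{w + R..<w + R + W}. \<bar>v j\<bar>) \<le> e"
      using i nn by linarith+
  qed
  have stable: "\<bar>D n - D k\<bar> \<le> e" if "(\<Sum>j\<in>{k..<k + W}. \<bar>v j\<bar>) \<le> e" "n \<in> {k..k + W}" for k n
  proof -
    have "\<bar>D n - D k\<bar> \<le> (\<Sum>j\<in>{k..<n}. \<bar>v j\<bar>)" using that by (subst diff) auto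
    also have "\<dots> \<le> (\<Sum>j\<in>{k..<k + W}. \<bar>v j\<bar>)" using that by (intro sum_mono2) auto
    finally show ?thesis using that by simp
  qed
  have bd: "\<bar>D k\<bar> \<le> c2" if "k \<le> 3 * R" for k
  proof -
    have "\<bar>D k\<bar> \<le> (\<Sum>j<k. \<bar>v j\<bar>)" unfolding D_def by (rule sum_abs)
    also have "\<dots> \<le> (\<Sum>j<3 * R. \<bar>v j\<bar>)" using that by (intro sum_mono2) auto
    finally show ?thesis using var by simp
  qed
  have "c1 \<le> \<bar>D (w + R) - D w\<bar>"
    using block[of w] iW by (subst diff) (auto simp: w_def)
  then consider "c1 / 2 \<le> \<bar>D w\<bar>" | "c1 / 2 \<le> \<bar>D (w + R)\<bar>" by linarith
  then show thesis
  proof cases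
    case 1
    show thesis
      by (rule that[of w]) (use 1 bd[of w] stable[OF s1(1)] iW in \<open>auto simp: w_def W_def[symmetric] D_def[symmetric]\<close>)
  next
    case 2
    show thesis
      by (rule that[of "w + R"]) (use 2 bd[of "w + R"] stable[OF s1(2)] iW in \<open>auto simp: w_def W_def[symmetric] D_def[symmetric]\<close>)
  qed
qed

text \<open>
  Sampling at multiples of \<open>t0\<close>: the windows of flow time found below become windows of integers.
\<close>

lemma times_in_interval:
  fixes a0 b0 t0 :: real
  assumes "t0 > 0" "0 \<le> a0" "a0 + 3 * t0 \<le> b0"
  obtains m L :: nat where "a0 / t0 < real m" "real m \<le> a0 / t0 + 1" "real L \<ge> (b0 - a0) / t0 - 2"
    "\<And>n. n \<in> {m..m + L} \<Longrightarrow> a0 < real n * t0 \<and> real n * t0 < b0"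
proof -
  define m where "m = nat (\<lfloor>a0 / t0\<rfloor> + 1)"
  define r where "r = nat (\<lceil>b0 / t0\<rceil> - 1)"
  have a: "0 \<le> a0 / t0" using assms by simp
  have ab: "a0 / t0 + 3 \<le> b0 / t0"
  proof -
    have "a0 / t0 + 3 = (a0 + 3 * t0) / t0" using assms by (simp add: add_divide_distrib)
    then show ?thesis using assms by (simp add: divide_right_mono)
  qed
  have m: "a0 / t0 < real m" "real m \<le> a0 / t0 + 1" using a unfolding m_def by linarith+
  have r: "real r < b0 / t0" "b0 / t0 - 1 \<le> real r" using a ab unfolding r_def by linarith+
  have mr: "m \<le> r" using m r ab by linarith
  show thesis
  proof (rule that[of m "r - m"])
    show "real (r - m) \<ge> (b0 - a0) / t0 - 2"
      using mr m r by (simp add: of_nat_diff diff_divide_distrib)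
    fix n assume "n \<in> {m..m + (r - m)}"
    then have "a0 / t0 < real n" "real n < b0 / t0" using m r mr by auto
    then show "a0 < real n * t0 \<and> real n * t0 < b0" using assms by (simp add: field_simps)
  qed (use m in auto)
qed

text \<open>
  The averages over \<open>[0, m)\<close> and over \<open>[0, m + L]\<close> are both close to \<open>g\<close>, so the frequency of visits to
  \<open>A\<close> in \<open>[m, m + L]\<close> is close to \<open>g\<close> as well; the error \<open>\<omega>\<close> is enlarged by the factor \<open>m / L\<close>, which
  is at most \<open>1 / \<kappa>\<close>. The number \<open>g\<close> may depend on the orbit \<open>w\<close>, and only its upper bound \<open>\<gamma>\<close> enters the
  result.
\<close>

lemma count_good_times:
  fixes A :: "'a set" and w :: "nat \<Rightarrow> 'a"
  defines "B \<equiv> \<lambda>n. \<Sum>j<n. indicator A (w j) :: real"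
  assumes avg: "\<And>n. n \<ge> N \<Longrightarrow> \<bar>B n / real n - g\<bar> \<le> \<omega>"
    and g: "g \<le> \<gamma>" "\<gamma> \<le> 1" and m: "N \<le> m" "0 < m" and L: "0 < L" "\<kappa> > 0" "\<kappa> \<le> real L / real m"
    and \<epsilon>: "\<gamma> + \<omega> * (2 / \<kappa> + 2) < \<epsilon>" and \<omega>: "\<omega> \<ge> 0"
  shows "real (card {n\<in>{m..m + L}. w n \<notin> A}) > (1 - \<epsilon>) * real L"
proof -
  have sum_bad: "(\<Sum>n\<in>{m..m + L}. indicator A (w n)) = B (m + L + 1) - B m"
  proof -
    have "{m..m + L} = {m..<m + L + 1}" by auto
    then show ?thesis unfolding B_def lessThan_atLeast0
      by (simp only: sum_diff_nat_ivl[of 0 m "m + L + 1" "\<lambda>j. indicator A (w j) :: real"])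
  qed
  have up: "B (m + L + 1) \<le> (g + \<omega>) * real (m + L + 1)"
    using avg[of "m + L + 1"] m by (simp add: abs_le_iff field_simps)
  have lo: "(g - \<omega>) * real m \<le> B m"
    using avg[of m] m by (simp add: abs_le_iff field_simps)
  have card: "real (card {n\<in>{m..m + L}. w n \<notin> A}) = real (L + 1) - (\<Sum>n\<in>{m..m + L}. indicator A (w n))"
  proof -
    have "real (card {n\<in>{m..m + L}. w n \<notin> A}) = (\<Sum>n\<in>{m..m + L}. 1 - indicator A (w n))"
    proof -
      have "real (card {n\<in>{m..m + L}. w n \<notin> A}) = (\<Sum>n\<in>{n\<in>{m..m + L}. w n \<notin> A}. 1)" by simp
      also have "\<dots> = (\<Sum>n\<in>{m..m + L}. if w n \<notin> A then 1 else 0)" by (rule sum.inter_filter) simp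
      also have "\<dots> = (\<Sum>n\<in>{m..m + L}. 1 - indicator A (w n))" by (intro sum.cong) (auto simp: indicator_def)
      finally show ?thesis .
    qed
    also have "\<dots> = real (L + 1) - (\<Sum>n\<in>{m..m + L}. indicator A (w n))" by (simp add: sum_subtractf)
    finally show ?thesis .
  qed
  have mL: "real m \<le> real L / \<kappa>" using L m by (simp add: field_simps)
  have "(\<Sum>n\<in>{m..m + L}. indicator A (w n)) \<le> g * real (L + 1) + \<omega> * (2 * real m + real L + 1)"
    unfolding sum_bad using up lo by (simp add: algebra_simps)
  also have "\<dots> \<le> \<gamma> * real (L + 1) + \<omega> * ((2 / \<kappa> + 2) * real L)"
  proof (intro add_mono mult_right_mono mult_left_mono)
    have "2 * real m + real L + 1 \<le> 2 * (real L / \<kappa>) + 2 * real L" using mL L by linarith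
    then show "2 * real m + real L + 1 \<le> (2 / \<kappa> + 2) * real L" by (simp add: algebra_simps)
  qed (use g \<omega> in auto)
  finally have "real (card {n\<in>{m..m + L}. w n \<notin> A}) \<ge> (1 - \<gamma>) * real (L + 1) - \<omega> * ((2 / \<kappa> + 2) * real L)"
    unfolding card by (simp add: algebra_simps)
  moreover have "(1 - \<gamma>) * real (L + 1) \<ge> (1 - \<gamma>) * real L" using g by (intro mult_left_mono) auto
  moreover have "(\<gamma> + \<omega> * (2 / \<kappa> + 2)) * real L < \<epsilon> * real L" using \<epsilon> L by (intro mult_strict_right_mono) auto
  ultimately show ?thesis by (simp add: algebra_simps)
qed

lemma (in prob_space) AE_exhaust:
  assumes ae: "AE x in M. \<exists>n::nat. Q n x" and meas: "\<And>n. {x\<in>space M. Q n x} \<in> sets M"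
    and mono: "\<And>m n x. m \<le> n \<Longrightarrow> Q m x \<Longrightarrow> Q n x" and \<eta>: "\<eta> > 0"
  shows "\<exists>n. prob {x\<in>space M. Q n x} > 1 - \<eta>"
proof -
  let ?A = "\<lambda>n. {x\<in>space M. Q n x}"
  have "(\<lambda>n. prob (?A n)) \<longlonglongrightarrow> prob (\<Union>n. ?A n)"
    by (rule finite_Lim_measure_incseq) (use meas mono in \<open>auto simp: incseq_def\<close>)
  moreover have "prob (\<Union>n. ?A n) = 1"
  proof (subst prob_eq_1)
    show "(\<Union>n. ?A n) \<in> sets M" using meas by auto
    show "AE x in M. x \<in> (\<Union>n. ?A n)" using ae AE_space by eventually_elim auto
  qed
  ultimately have "\<forall>\<^sub>F n in sequentially. prob (?A n) > 1 - \<eta>" using \<eta> by (intro order_tendstoD(1)) auto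
  then show ?thesis by (auto simp: eventually_sequentially)
qed

lemma (in prob_space) prob_Int_gt:
  assumes "A \<in> sets M" "B \<in> sets M" "prob A > 1 - a" "prob B > 1 - b"
  shows "A \<inter> B \<in> sets M \<and> prob (A \<inter> B) > 1 - (a + b)"
proof -
  have "prob (A \<union> B) = prob A + prob B - prob (A \<inter> B)"
    using assms by (intro measure_Un3) (auto simp: fmeasurable_eq_sets)
  then show ?thesis using assms prob_le_1[of "A \<union> B"] by auto
qed

context rotation_flow begin

section \<open>Shadowing along a plateau\<close>

definition near_boundary :: "real \<Rightarrow> (real \<times> real) set" where
  "near_boundary e = {z\<in>X. snd z < 2 * e \<or> f (fst z) - 2 * e \<le> snd z}"

lemma near_boundary_sets [measurable]: "near_boundary e \<in> sets M"
proof -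
  have "near_boundary e = {z\<in>space M. snd z < 2 * e \<or> f (fst z) - 2 * e \<le> snd z}"
    by (simp add: near_boundary_def space_M)
  also have "\<dots> \<in> sets M" by measurable
  finally show ?thesis .
qed

lemma measure_near_boundary:
  assumes e: "e > 0"
  shows "measure M (near_boundary e) \<le> 4 * e / mean_f"
proof -
  interpret M: prob_space M by (rule prob_space_M)
  have nP: "near_boundary e \<in> sets P" using near_boundary_sets[of e] by (simp only: sets_M)
  have "emeasure P (near_boundary e) = (\<integral>\<^sup>+x. emeasure lborel (Pair x -` near_boundary e) \<partial>circle)"
    by (rule lborel.emeasure_pair_measure_alt[OF nP])
  also have "\<dots> \<le> (\<integral>\<^sup>+x. ennreal (4 * e) \<partial>circle)"
  proof (rule nn_integral_mono)
    fix x
    have "Pair x -` near_boundary e \<subseteq> {0..2 * e} \<union> {f x - 2 * e..f x}"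
      by (auto simp: near_boundary_def X_iff)
    then have "emeasure lborel (Pair x -` near_boundary e) \<le> emeasure lborel ({0..2 * e} \<union> {f x - 2 * e..f x})"
      by (intro emeasure_mono) auto
    also have "\<dots> \<le> emeasure lborel {0..2 * e} + emeasure lborel {f x - 2 * e..f x}"
      by (rule emeasure_subadditive) auto
    also have "\<dots> = ennreal (4 * e)" using e by (simp add: ennreal_plus[symmetric] del: ennreal_plus)
    finally show "emeasure lborel (Pair x -` near_boundary e) \<le> ennreal (4 * e)" .
  qed
  also have "\<dots> = ennreal (4 * e)" using circle.emeasure_space_1 by (simp only: nn_integral_const mult_1_right)
  finally have "emeasure M (near_boundary e) \<le> ennreal (4 * e) / ennreal mean_f"
    unfolding emeasure_M[OF near_boundary_sets] by (rule divide_right_mono_ennreal)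
  also have "\<dots> = ennreal (4 * e / mean_f)" using e mean_f_pos by (intro divide_ennreal) auto
  finally show ?thesis using e mean_f_pos by (simp add: M.emeasure_eq_measure)
qed

lemma circle_dist_rotate: "circle_dist (frac (x + u)) (frac (y + u)) = circle_dist x y"
proof -
  have "frac (x + u) - frac (y + u) = x - y + of_int (\<lfloor>y + u\<rfloor> - \<lfloor>x + u\<rfloor>)" by (simp add: frac_def)
  then show ?thesis by (simp only: circle_dist_def circle_norm_add_int)
qed

text \<open>
  Let \<open>k\<close> be the number of the fibre of the first point at time \<open>\<tau>\<close>. The time change \<open>p\<close> compensates the
  difference of the Birkhoff sums of orders \<open>k\<close> and \<open>k + 1\<close> up to \<open>e\<close>. If the first point is at
  distance at least \<open>2 e\<close> from both ends of its fibre, the second one therefore is in the fibre with the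
  same number, at almost the same height.
\<close>

lemma flows_stay_close:
  assumes xs: "(x, s) \<in> X" and ys: "(y, s') \<in> X" and e: "\<bar>s - s'\<bar> \<le> e"
    and close: "\<And>k. k1 \<le> k \<Longrightarrow> k \<le> k2 \<Longrightarrow> \<bar>p + S k x - S k y\<bar> \<le> e"
    and \<tau>: "S k1 x \<le> \<tau> + s" "\<tau> + s < S k2 x" and good: "flow \<tau> (x, s) \<notin> near_boundary e"
  shows "flow_dist circle_dist (flow \<tau> (x, s)) (flow (\<tau> + p) (y, s')) \<le> circle_dist x y + 2 * e"
proof -
  have x: "x \<in> {0..<1}" and y: "y \<in> {0..<1}" using xs ys by (auto simp: X_iff)
  define k where "k = index x (\<tau> + s)"
  have k: "S k x \<le> \<tau> + s" "\<tau> + s < S (k + 1) x" using index[of x "\<tau> + s"] by (auto simp: k_def)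
  have k2: "k + 1 \<le> k2" using S_mono[of k2 k x] k \<tau> by linarith
  have k1: "k1 \<le> k" using S_mono[of "k + 1" k1 x] k \<tau> by linarith
  have c: "\<bar>p + S k x - S k y\<bar> \<le> e" "\<bar>p + S (k + 1) x - S (k + 1) y\<bar> \<le> e"
    using close k1 k2 by auto
  have fx: "flow \<tau> (x, s) = (frac (x + of_int k * \<alpha>), \<tau> + s - S k x)" by (rule flow_eq[OF x k])
  have "flow \<tau> (x, s) \<in> X" by (rule flow_in_X[OF xs])
  then have v: "2 * e \<le> \<tau> + s - S k x" "\<tau> + s - S k x < f (x + of_int k * \<alpha>) - 2 * e"
    using good by (auto simp: near_boundary_def fx f_frac)
  have "flow (\<tau> + p) (y, s') = (frac (y + of_int k * \<alpha>), \<tau> + p + s' - S k y)"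
  proof (rule flow_eq[OF y])
    show "S k y \<le> \<tau> + p + s'" using c(1) e v(1) by linarith
    show "\<tau> + p + s' < S (k + 1) y" using c(2) e v(2) S_Suc[of k x] by linarith
  qed
  then show ?thesis using c(1) e
    by (simp add: fx flow_dist_def circle_dist_rotate)
qed

lemma orbit_sum_forward: "orbit_sum (\<lambda>x. frac (x + \<alpha>)) f n x = (\<Sum>j<n. f (orbit_point \<alpha> True x j))"
proof -
  have "f (((\<lambda>x. frac (x + \<alpha>)) ^^ j) x) = f (x + real j * \<alpha>)" for j
  proof -
    have "frac (((\<lambda>x. frac (x + \<alpha>)) ^^ j) x) = frac (x + real j * \<alpha>)"
    proof (induction j)
      case (Suc j)
      have "frac (((\<lambda>x. frac (x + \<alpha>)) ^^ Suc j) x) = frac (((\<lambda>x. frac (x + \<alpha>)) ^^ j) x + \<alpha>)" by simp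
      also have "\<dots> = frac (frac (((\<lambda>x. frac (x + \<alpha>)) ^^ j) x) + \<alpha>)" by (simp only: frac_frac_add)
      also have "\<dots> = frac (frac (x + real j * \<alpha>) + \<alpha>)" by (simp only: Suc)
      also have "\<dots> = frac (x + real (Suc j) * \<alpha>)" by (simp add: algebra_simps)
      finally show ?case .
    qed simp
    from arg_cong[OF this, of f] show ?thesis by (simp only: f_frac)
  qed
  then show ?thesis by (simp add: orbit_sum_def orbit_point_def)
qed

lemma orbit_sum_backward:
  "orbit_sum (\<lambda>x. frac (x - \<alpha>)) (\<lambda>x. f (frac (x - \<alpha>))) n x = (\<Sum>j<n. f (orbit_point \<alpha> False x j))"
proof -
  have "f (frac (((\<lambda>x. frac (x - \<alpha>)) ^^ j) x - \<alpha>)) = f (x - real (Suc j) * \<alpha>)" for j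
  proof -
    have "frac (((\<lambda>x. frac (x - \<alpha>)) ^^ j) x - \<alpha>) = frac (x - real (Suc j) * \<alpha>)"
    proof (induction j)
      case (Suc j)
      have "frac (((\<lambda>x. frac (x - \<alpha>)) ^^ Suc j) x - \<alpha>) = frac (frac (((\<lambda>x. frac (x - \<alpha>)) ^^ j) x - \<alpha>) - \<alpha>)"
        by simp
      also have "\<dots> = frac (frac (x - real (Suc j) * \<alpha>) - \<alpha>)" by (simp only: Suc)
      also have "\<dots> = frac (x - real (Suc (Suc j)) * \<alpha>)" by (simp add: algebra_simps)
      finally show ?case .
    qed simp
    from arg_cong[OF this, of f] show ?thesis by (simp only: f_frac)
  qed
  then show ?thesis by (simp add: orbit_sum_def orbit_point_def)
qed

text \<open>
  This bounds from above the flow time that corresponds to a number of steps of the rotation, in both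
  directions of time.
\<close>

lemma AE_linear_bound: "AE x in circle. \<exists>K::nat. \<forall>fwd n. (\<Sum>j<n. f (orbit_point \<alpha> fwd x j)) \<le> real K * real n"
proof -
  interpret F: measure_preserving circle "\<lambda>x. frac (x + \<alpha>)"
    by unfold_locales (use distr_rotate in auto)
  interpret B: measure_preserving circle "\<lambda>x. frac (x - \<alpha>)"
    by unfold_locales (use distr_rotate[of "- \<alpha>"] measurable_rotate[of "- \<alpha>"] in auto)
  have "AE x in circle. \<exists>K::nat. \<forall>n. orbit_sum (\<lambda>x. frac (x + \<alpha>)) f n x \<le> real K * real n"
    by (rule F.AE_orbit_sum_linear_bound[OF integrable_f]) (simp add: positive less_imp_le)
  moreover have "AE x in circle. \<exists>K::nat. \<forall>n. orbit_sum (\<lambda>x. frac (x - \<alpha>)) (\<lambda>x. f (frac (x - \<alpha>))) n x \<le> real K * real n"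
    by (rule B.AE_orbit_sum_linear_bound[OF B.integrable_compose_T[OF integrable_f]]) (simp add: positive less_imp_le)
  ultimately show ?thesis
  proof eventually_elim
    case (elim x)
    then obtain K1 K2 :: nat where K: "\<And>n. (\<Sum>j<n. f (orbit_point \<alpha> True x j)) \<le> real K1 * real n"
      "\<And>n. (\<Sum>j<n. f (orbit_point \<alpha> False x j)) \<le> real K2 * real n"
      unfolding orbit_sum_forward orbit_sum_backward by blast
    have "(\<Sum>j<n. f (orbit_point \<alpha> fwd x j)) \<le> real (max K1 K2) * real n" for fwd n
    proof -
      have "(\<Sum>j<n. f (orbit_point \<alpha> fwd x j)) \<le> real (if fwd then K1 else K2) * real n"
        using K by (cases fwd) auto
      also have "\<dots> \<le> real (max K1 K2) * real n" by (intro mult_right_mono) auto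
      finally show ?thesis .
    qed
    then show ?case by blast
  qed
qed

lemma orbit_point_sum: "S (if fwd then int n else - int n) x = (if fwd then 1 else - 1) * (\<Sum>j<n. f (orbit_point \<alpha> fwd x j))"
  by (simp add: S_nat S_neg_nat orbit_point_def)

text \<open>
  Replacing \<open>y\<close> by its lift nearest to \<open>x\<close> turns the distance on the circle into one on the line, along
  which mean values can be taken.
\<close>

lemma lift_near:
  assumes "circle_dist x y < \<delta>"
  obtains y' where "\<bar>x - y'\<bar> < \<delta>" "frac y' = frac y"
    "\<And>fwd j. f (orbit_point \<alpha> fwd y' j) = f (orbit_point \<alpha> fwd y j)"
proof -
  obtain n where n: "circle_norm (x - y) = \<bar>x - y - of_int n\<bar>" by (rule circle_norm_attains)
  define y' where "y' = y + of_int n"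
  have fy: "frac y' = frac y" by (simp add: y'_def)
  have "f (orbit_point \<alpha> fwd y' j) = f (orbit_point \<alpha> fwd y j)" for fwd j
  proof -
    have "orbit_point \<alpha> fwd y' j = orbit_point \<alpha> fwd y j + of_int n" by (simp add: orbit_point_def y'_def)
    then show ?thesis by (simp only: periodic_int)
  qed
  then show thesis using that[of y'] fy assms n by (simp add: circle_dist_def y'_def algebra_simps)
qed

text \<open>
  The plateau of the Birkhoff sums at orders \<open>k, \<dots>, k + R div J\<close> corresponds to the flow times
  between \<open>a0\<close> and \<open>b0\<close>. The growth of the Birkhoff sums bounds \<open>b0 - a0\<close> from below by a multiple of \<open>R\<close>,
  and the constant \<open>K\<close> bounds \<open>a0\<close> from above by a multiple of \<open>R\<close>; hence the lower bound on \<open>L / m\<close>.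
  The sign \<open>\<sigma>\<close> treats both directions of time at once.
\<close>

lemma shadowing_times:
  fixes K J R :: nat and fwd :: bool
  defines "\<sigma> \<equiv> (if fwd then 1 else -1 :: real)"
  assumes xs: "(x, s) \<in> X" and ys: "(y, s') \<in> X" and e: "\<bar>s - s'\<bar> \<le> e"
    and var: "(\<Sum>j<3 * R. \<bar>f (orbit_point \<alpha> fwd x j) - f (orbit_point \<alpha> fwd y j)\<bar>) \<le> c2"
    and block: "\<And>n. n \<le> 2 * R \<Longrightarrow> c1 \<le> \<bar>\<Sum>j\<in>{n..<n + R}. f (orbit_point \<alpha> fwd x j) - f (orbit_point \<alpha> fwd y j)\<bar>"
    and J: "c2 < real J * e" "J > 0"
    and K: "\<And>d n. (\<Sum>j<n. f (orbit_point \<alpha> d x j)) \<le> real K * real n" "K \<ge> 1"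
    and t0: "t0 > 0"
    and R: "R \<ge> 1" "real R \<ge> t0" "c * real R / (2 * real J) \<ge> c + \<bar>b\<bar> + 3 * t0" "c * (real R - 1) - \<bar>b\<bar> \<ge> real N * t0"
      "c * real R / (2 * real J) > real N * t0"
  obtains m L :: nat and p where "m > N" "L > N" "real L / real m \<ge> c / (10 * real J * real K)"
    "c1 / 2 \<le> \<bar>p\<bar>" "\<bar>p\<bar> \<le> c2"
    "\<And>n. n \<in> {m..m + L} \<Longrightarrow> flow (\<sigma> * (real n * t0)) (x, s) \<notin> near_boundary e \<Longrightarrow>
      flow_dist circle_dist (flow (\<sigma> * (real n * t0)) (x, s)) (flow (\<sigma> * (real n * t0) + p) (y, s')) \<le> circle_dist x y + 2 * e"
proof -
  define v where "v j = f (orbit_point \<alpha> fwd x j) - f (orbit_point \<alpha> fwd y j)" for j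
  define B where "B n = (\<Sum>j<n. f (orbit_point \<alpha> fwd x j))" for n
  define W where "W = R div J"
  have var': "(\<Sum>j<3 * R. \<bar>v j\<bar>) \<le> c2" using var by (simp add: v_def)
  have block': "c1 \<le> \<bar>\<Sum>j\<in>{n..<n + R}. v j\<bar>" if "n \<le> 2 * R" for n
    using block[OF that] by (simp add: v_def)
  from stable_window[OF var' block' J] obtain k where k: "R \<le> k" "k + W \<le> 3 * R"
    and D: "c1 / 2 \<le> \<bar>\<Sum>j<k. v j\<bar>" "\<bar>\<Sum>j<k. v j\<bar> \<le> c2"
    and st: "\<And>n. n \<in> {k..k + W} \<Longrightarrow> \<bar>(\<Sum>j<n. v j) - (\<Sum>j<k. v j)\<bar> \<le> e"
    unfolding W_def by blast
  have v_sum: "(\<Sum>j<n. v j) = B n - (\<Sum>j<n. f (orbit_point \<alpha> fwd y j))" for n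
    by (simp add: v_def B_def sum_subtractf)
  have x: "x \<in> {0..<1}" and s: "0 \<le> s" "s < f x" using xs by (auto simp: X_iff)
  define p where "p = - \<sigma> * (\<Sum>j<k. v j)"
  have \<sigma>: "\<sigma> * \<sigma> = 1" "\<bar>\<sigma>\<bar> = 1" by (auto simp: \<sigma>_def)
  define sg where "sg n = (if fwd then int n else - int n)" for n
  have Sx: "S (sg n) x = \<sigma> * B n" for n by (simp add: sg_def orbit_point_sum \<sigma>_def B_def)
  have Sxy: "S (sg n) x - S (sg n) y = \<sigma> * (\<Sum>j<n. v j)" for n
    unfolding v_sum by (simp add: sg_def orbit_point_sum \<sigma>_def B_def)
  have close: "\<bar>p + S (sg n) x - S (sg n) y\<bar> \<le> e" if "n \<in> {k..k + W}" for n
  proof -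
    have "p + S (sg n) x - S (sg n) y = \<sigma> * ((\<Sum>j<n. v j) - (\<Sum>j<k. v j))"
      using Sxy[of n] by (simp add: p_def algebra_simps)
    then show ?thesis using st[OF that] \<sigma> by (simp add: abs_mult)
  qed
  have Bpos: "B n \<le> B m" if "n \<le> m" for n m
    unfolding B_def using that positive by (intro sum_mono2) (auto intro: less_imp_le)
  have Bdiff: "B (k + W) - B k \<ge> c * real W - b"
  proof (cases fwd)
    case True
    have "S (int (k + W)) x - S (int k) x \<ge> c * of_int (int (k + W) - int k) - b" by (rule S_diff_ge) simp
    then show ?thesis using True Sx[of "k + W"] Sx[of k] by (simp add: sg_def \<sigma>_def)
  next
    case False
    have "S (- int k) x - S (- int (k + W)) x \<ge> c * of_int (- int k - (- int (k + W))) - b" by (rule S_diff_ge) simp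
    then show ?thesis using False Sx[of "k + W"] Sx[of k] by (simp add: sg_def \<sigma>_def)
  qed
  define a0 where "a0 = B k - \<sigma> * s"
  define b0 where "b0 = B (k + W) - \<sigma> * s"
  have k1: "k \<ge> 1" using k R by simp
  have a0_ge: "a0 \<ge> c * (real k - 1) - b"
  proof (cases fwd)
    case True
    have "S (int k) x - S 1 x \<ge> c * of_int (int k - 1) - b" by (rule S_diff_ge) (use k1 in simp)
    moreover have "S 1 x = f x" using S_Suc[of 0 x] by simp
    ultimately show ?thesis using s True Sx[of k] by (simp add: a0_def sg_def \<sigma>_def)
  next
    case False
    have "S 0 x - S (- int k) x \<ge> c * of_int (0 - (- int k)) - b" by (rule S_diff_ge) simp
    then show ?thesis using s False Sx[of k] c_pos by (simp add: a0_def sg_def \<sigma>_def algebra_simps)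
  qed
  have fxK: "f x \<le> real K" using K(1)[where d=True and n=1] by (simp add: orbit_point_def)
  have a0_le: "a0 \<le> real K * (real k + 1)"
    using K(1)[where d=fwd and n=k] s fxK by (auto simp: a0_def B_def \<sigma>_def algebra_simps)
  have J1: "real J > 0" using J by simp
  have W_ge: "real W \<ge> real R / real J - 1"
  proof -
    have "R = J * W + R mod J" by (simp add: W_def)
    then have "real R = real J * real W + real (R mod J)" by (metis of_nat_add of_nat_mult)
    moreover have "real (R mod J) \<le> real J" using J by (simp add: less_imp_le)
    ultimately have "real R \<le> real J * (real W + 1)" by (simp add: algebra_simps)
    then show ?thesis using J1 by (simp add: field_simps)
  qed
  have len: "b0 - a0 \<ge> c * real R / (2 * real J) + 3 * t0"
  proof -
    have "c * real W \<ge> c * (real R / real J - 1)" using W_ge c_pos by (intro mult_left_mono) auto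
    also have "c * (real R / real J - 1) = c * real R / (2 * real J) + c * real R / (2 * real J) - c"
      using J1 by (simp add: field_simps)
    finally have "c * real W \<ge> c * real R / (2 * real J) + c * real R / (2 * real J) - c" .
    then show ?thesis using Bdiff R(3) unfolding a0_def b0_def by linarith
  qed
  have cRJ: "c * real R / (2 * real J) \<ge> 0" using c_pos J1 by simp
  have a0_R: "a0 \<ge> c * (real R - 1) - \<bar>b\<bar>"
  proof -
    have "c * (real k - 1) \<ge> c * (real R - 1)" using c_pos k by (intro mult_left_mono) auto
    then show ?thesis using a0_ge by linarith
  qed
  have a0_N: "real N * t0 \<le> a0" using a0_R R(4) by linarith
  then have a0_0: "0 \<le> a0" using t0 by (smt (verit) mult_nonneg_nonneg of_nat_0_le_iff)
  have "a0 + 3 * t0 \<le> b0" using len cRJ by linarith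
  from times_in_interval[OF t0 a0_0 this]
  obtain m L :: nat where m: "a0 / t0 < real m" "real m \<le> a0 / t0 + 1" and L: "real L \<ge> (b0 - a0) / t0 - 2"
    and mL: "\<And>n. n \<in> {m..m + L} \<Longrightarrow> a0 < real n * t0 \<and> real n * t0 < b0"
    by blast
  have L_ge: "real L \<ge> c * real R / (2 * real J) / t0"
  proof -
    have "(b0 - a0) / t0 \<ge> (c * real R / (2 * real J) + 3 * t0) / t0" using len t0 by (intro divide_right_mono) auto
    also have "(c * real R / (2 * real J) + 3 * t0) / t0 = c * real R / (2 * real J) / t0 + 3"
      using t0 by (simp add: add_divide_distrib)
    finally show ?thesis using L by linarith
  qed
  have m_pos: "real m > 0" using m a0_0 t0 by (smt (verit) divide_nonneg_pos)
  have m_le: "real m \<le> 5 * real K * real R / t0"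
  proof -
    have "real k + 1 \<le> 4 * real R" using k R(1) by linarith
    then have "real K * (real k + 1) \<le> real K * (4 * real R)" by (intro mult_left_mono) auto
    then have 1: "a0 / t0 \<le> (4 * real K * real R) / t0" using a0_le t0 by (intro divide_right_mono) auto
    have "t0 \<le> real K * real R"
    proof -
      have "1 * real R \<le> real K * real R" using K(2) by (intro mult_right_mono) auto
      then show ?thesis using R(2) by simp
    qed
    then have "1 \<le> real K * real R / t0" using t0 by simp
    moreover have "5 * real K * real R / t0 = (4 * real K * real R) / t0 + real K * real R / t0"
      by (simp add: add_divide_distrib[symmetric])
    ultimately show ?thesis using m(2) 1 by linarith
  qed
  have ratio: "real L / real m \<ge> c / (10 * real J * real K)"
  proof -
    have "c / (10 * real J * real K) * real m \<le> c / (10 * real J * real K) * (5 * real K * real R / t0)"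
      using m_le c_pos by (intro mult_left_mono) auto
    also have "\<dots> = c * real R / (2 * real J) / t0" using J1 K(2) t0 by (simp add: field_simps)
    also have "\<dots> \<le> real L" by (rule L_ge)
    finally show ?thesis using m_pos by (simp add: pos_le_divide_eq)
  qed
  have mN: "m > N"
  proof -
    have "real N \<le> a0 / t0" using a0_N t0 by (simp add: pos_le_divide_eq)
    then show ?thesis using m(1) by linarith
  qed
  have LN: "L > N"
  proof -
    have "real N < c * real R / (2 * real J) / t0" using R(5) unfolding pos_less_divide_eq[OF t0] .
    then show ?thesis using L_ge by linarith
  qed
  define k1 where "k1 = (if fwd then int k else - int (k + W))"
  define k2 where "k2 = (if fwd then int (k + W) else - int k)"
  show thesis
  proof (rule that[of m L p])
    show "c1 / 2 \<le> \<bar>p\<bar>" "\<bar>p\<bar> \<le> c2" using D \<sigma> by (simp_all add: p_def abs_mult)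
    fix n assume n: "n \<in> {m..m + L}" and good: "flow (\<sigma> * (real n * t0)) (x, s) \<notin> near_boundary e"
    show "flow_dist circle_dist (flow (\<sigma> * (real n * t0)) (x, s)) (flow (\<sigma> * (real n * t0) + p) (y, s')) \<le> circle_dist x y + 2 * e"
    proof (rule flows_stay_close[OF xs ys e _ _ _ good])
      fix k' assume k': "k1 \<le> k'" "k' \<le> k2"
      define l where "l = nat \<bar>k'\<bar>"
      have "l \<in> {k..k + W} \<and> sg l = k'" using k' by (auto simp: l_def k1_def k2_def sg_def split: if_splits)
      then show "\<bar>p + S k' x - S k' y\<bar> \<le> e" using close[of l] by simp
    next
      have "a0 < real n * t0" "real n * t0 < b0" using mL[OF n] by auto
      then show "S k1 x \<le> \<sigma> * (real n * t0) + s" "\<sigma> * (real n * t0) + s < S k2 x"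
        using Sx[of k] Sx[of "k + W"] unfolding a0_def b0_def k1_def k2_def sg_def \<sigma>_def
        by (auto split: if_splits)
    qed
  qed (fact mN LN ratio)+
qed

lemma birkhoff_flow:
  assumes "A \<in> sets M"
  obtains g where "g \<in> borel_measurable M" "\<And>z. z \<in> X \<Longrightarrow> 0 \<le> g z"
    "integrable M g" "(\<integral>z. g z \<partial>M) \<le> measure M A"
    "AE z in M. (\<lambda>n. (\<Sum>j<n. indicator A (flow (real j * t) z)) / real n) \<longlonglongrightarrow> g z"
proof -
  interpret prob_space M by (rule prob_space_M)
  interpret T: measure_preserving M "flow t" by unfold_locales (simp_all add: distr_flow)
  obtain g where g: "g \<in> borel_measurable M" "\<And>z. z \<in> space M \<Longrightarrow> 0 \<le> g z \<and> g z \<le> 1"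
    "(\<integral>z. g z \<partial>M) \<le> (\<integral>z. indicator A z \<partial>M)"
    "AE z in M. (\<lambda>n. orbit_sum (flow t) (indicator A) n z / real n) \<longlonglongrightarrow> g z"
    using T.birkhoff_bounded[of "indicator A :: _ \<Rightarrow> real"] assms by (auto simp: indicator_def)
  show thesis
  proof
    show "integrable M g" by (rule integrable_const_bound[of _ 1]) (use g in auto)
    show "(\<integral>z. g z \<partial>M) \<le> measure M A" using g(3) assms by simp
    show "AE z in M. (\<lambda>n. (\<Sum>j<n. indicator A (flow (real j * t) z)) / real n) \<longlonglongrightarrow> g z"
      using g(4) AE_space by eventually_elim (simp add: orbit_sum_def flow_funpow space_M)
  qed (use g in \<open>auto simp: space_M\<close>)
qed

text \<open>
  The limit function of the averages has integral at most \<open>\<gamma>\<^sup>2\<close>, so it exceeds \<open>\<gamma>\<close> only on a set of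
  measure at most \<open>\<gamma>\<close>. By convergence almost everywhere, one \<open>N\<close> serves for all points outside a
  further set of measure \<open>\<gamma>\<close>.
\<close>

lemma frequency_set:
  assumes A: "A \<in> sets M" and \<gamma>: "\<gamma> > 0" "measure M A < \<gamma> * \<gamma>" and \<omega>: "\<omega> > 0"
  obtains Z and N :: nat where "Z \<in> sets M" "measure M Z > 1 - 2 * \<gamma>"
    "\<And>z. z \<in> Z \<Longrightarrow> \<exists>g\<le>\<gamma>. \<forall>n\<ge>N. \<bar>(\<Sum>j<n. indicator A (flow (real j * t) z)) / real n - g\<bar> \<le> \<omega>"
proof -
  interpret prob_space M by (rule prob_space_M)
  obtain g where g[measurable]: "g \<in> borel_measurable M" and g0: "\<And>z. z \<in> X \<Longrightarrow> 0 \<le> g z"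
    and ig: "integrable M g" "(\<integral>z. g z \<partial>M) \<le> measure M A"
    and lim: "AE z in M. (\<lambda>n. (\<Sum>j<n. indicator A (flow (real j * t) z)) / real n) \<longlonglongrightarrow> g z"
    using birkhoff_flow[OF A, of t] by blast
  define a where "a n z = (\<Sum>j<n. indicator A (flow (real j * t) z)) / real n" for n z
  have [measurable]: "a n \<in> borel_measurable M" for n
    unfolding a_def[abs_def]
    by (intro borel_measurable_divide borel_measurable_sum borel_measurable_const
        measurable_compose[OF measurable_flow borel_measurable_indicator[OF A]])
  define Q where "Q N z \<longleftrightarrow> (\<forall>n\<ge>N. \<bar>a n z - g z\<bar> \<le> \<omega>)" for N z
  have "\<exists>N. prob {z\<in>space M. Q N z} > 1 - \<gamma>"
  proof (rule AE_exhaust)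
    show "AE z in M. \<exists>N. Q N z" using lim
    proof eventually_elim
      case (elim z)
      then have "\<forall>\<^sub>F n in sequentially. dist (a n z) (g z) < \<omega>" using \<omega> unfolding a_def by (rule tendstoD)
      then obtain N where "\<And>n. n \<ge> N \<Longrightarrow> dist (a n z) (g z) < \<omega>" by (auto simp: eventually_sequentially)
      then show ?case unfolding Q_def dist_real_def by (meson less_imp_le)
    qed
    show "{z\<in>space M. Q n z} \<in> sets M" for n unfolding Q_def by measurable
    show "Q n z" if "m \<le> n" "Q m z" for m n z using that by (auto simp: Q_def)
  qed (rule \<gamma>)
  then obtain N where N: "prob {z\<in>space M. Q N z} > 1 - \<gamma>" by blast
  define E where "E = {z\<in>space M. g z \<le> \<gamma>}"
  have Es: "E \<in> sets M" unfolding E_def by measurable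
  have "prob {z\<in>space M. g z \<ge> \<gamma>} \<le> (\<integral>z. g z \<partial>M) / \<gamma>"
    by (rule integral_Markov_inequality_measure[where A="space M"])
      (use ig g0 \<gamma> sets.top[of M] in \<open>auto simp: space_M intro!: AE_I2\<close>)
  also have "\<dots> < \<gamma>" using ig \<gamma> by (simp add: pos_divide_less_eq)
  finally have "prob {z\<in>space M. g z \<ge> \<gamma>} < \<gamma>" .
  moreover have "prob (space M - E) \<le> prob {z\<in>space M. g z \<ge> \<gamma>}"
    by (rule finite_measure_mono) (auto simp: E_def)
  ultimately have "prob E > 1 - \<gamma>" using prob_compl[OF Es] by simp
  moreover have "{z\<in>space M. Q N z} \<in> sets M" unfolding Q_def by measurable
  ultimately have "E \<inter> {z\<in>space M. Q N z} \<in> sets M \<and> prob (E \<inter> {z\<in>space M. Q N z}) > 1 - (\<gamma> + \<gamma>)"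
    using N Es by (intro prob_Int_gt) auto
  note EQ = this
  show thesis
  proof (rule that[of "E \<inter> {z\<in>space M. Q N z}" N])
    show "measure M (E \<inter> {z\<in>space M. Q N z}) > 1 - 2 * \<gamma>" using EQ by simp
    fix z assume "z \<in> E \<inter> {z\<in>space M. Q N z}"
    then have "g z \<le> \<gamma>" "Q N z" by (simp_all add: E_def)
    then show "\<exists>g\<le>\<gamma>. \<forall>n\<ge>N. \<bar>(\<Sum>j<n. indicator A (flow (real j * t) z)) / real n - g\<bar> \<le> \<omega>"
      unfolding Q_def a_def by (intro exI[of _ "g z"] conjI)
  qed (use EQ in blast)
qed

text \<open>
  The constants are chosen in this order: \<open>e\<close> (distance to the ends of the fibres), \<open>J\<close> (number of
  windows), \<open>K\<close> (growth of the Birkhoff sums off a small set), then \<open>\<kappa>\<close>, and only then the precision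
  \<open>\<omega>\<close> of the ergodic averages, which has to beat \<open>1 / \<kappa>\<close>. All of them depend on \<open>\<epsilon>\<close> only; \<open>N\<close>
  influences only \<open>\<delta>\<close>, through a lower bound on the time scale \<open>R\<close>.
\<close>

theorem switchable_R_criterion:
  fixes G :: "nat \<Rightarrow> real set"
  assumes G_sets: "\<And>n. G n \<in> sets borel" and G_mono: "\<And>m n. m \<le> n \<Longrightarrow> G m \<subseteq> G n"
    and G_AE: "AE x in circle. \<exists>n. x \<in> G n"
    and base: "\<And>n N. \<exists>\<delta>>0. \<forall>x\<in>G n. \<forall>y. x \<noteq> y \<and> \<bar>x - y\<bar> < \<delta> \<longrightarrow> (\<exists>R\<ge>N. \<exists>fwd.
        (\<Sum>j<3 * R. \<bar>f (orbit_point \<alpha> fwd x j) - f (orbit_point \<alpha> fwd y j)\<bar>) \<le> c2 \<and>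
        (\<forall>n\<le>2 * R. c1 \<le> \<bar>\<Sum>j\<in>{n..<n + R}. f (orbit_point \<alpha> fwd x j) - f (orbit_point \<alpha> fwd y j)\<bar>))"
    and t0: "t0 > 0"
  shows "switchable_R M (flow_dist circle_dist) flow t0 {p. c1 / 2 \<le> \<bar>p\<bar> \<and> \<bar>p\<bar> \<le> c2}"
  unfolding switchable_R_def
proof (intro allI impI)
  interpret prob_space M by (rule prob_space_M)
  fix \<epsilon> :: real assume \<epsilon>: "\<epsilon> > 0"
  define \<gamma> where "\<gamma> = min 1 (\<epsilon> / 8)"
  have \<gamma>: "0 < \<gamma>" "\<gamma> \<le> 1" "8 * \<gamma> \<le> \<epsilon>" using \<epsilon> by (auto simp: \<gamma>_def)
  define e where "e = min (\<epsilon> / 8) (\<gamma> * \<gamma> * mean_f / 8)"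
  have e: "e > 0" "8 * e \<le> \<epsilon>" "8 * e \<le> \<gamma> * \<gamma> * mean_f"
    using \<epsilon> \<gamma> mean_f_pos by (auto simp: e_def min_def field_simps)
  define A where "A = near_boundary e"
  have A: "A \<in> sets M" by (simp add: A_def)
  have mA: "measure M A < \<gamma> * \<gamma>"
  proof -
    have "measure M A \<le> 4 * e / mean_f" unfolding A_def by (rule measure_near_boundary[OF e(1)])
    also have "\<dots> < \<gamma> * \<gamma>" using e mean_f_pos \<gamma> by (simp add: pos_divide_less_eq)
    finally show ?thesis .
  qed
  obtain J :: nat where J: "J > 0" "c2 < real J * e"
  proof -
    obtain J :: nat where J: "c2 / e < real J" using reals_Archimedean2 by blast
    have "c2 < real (max J 1) * e"
    proof -
      have "c2 < real J * e" using J e by (simp add: pos_divide_less_eq)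
      also have "\<dots> \<le> real (max J 1) * e" using e by (intro mult_right_mono) auto
      finally show ?thesis .
    qed
    then show thesis by (intro that[of "max J 1"]) auto
  qed
  have "\<exists>K. prob {z\<in>space M. \<forall>fwd n. (\<Sum>j<n. f (orbit_point \<alpha> fwd (fst z) j)) \<le> real K * real n} > 1 - \<gamma>"
  proof (rule AE_exhaust)
    show "AE z in M. \<exists>K. \<forall>fwd n. (\<Sum>j<n. f (orbit_point \<alpha> fwd (fst z) j)) \<le> real K * real n"
      by (rule AE_fst[OF AE_linear_bound])
    show "{z\<in>space M. \<forall>fwd n. (\<Sum>j<n. f (orbit_point \<alpha> fwd (fst z) j)) \<le> real K * real n} \<in> sets M" for K
      unfolding orbit_point_def by measurable
    show "\<forall>fwd n. (\<Sum>j<n. f (orbit_point \<alpha> fwd (fst z) j)) \<le> real K' * real n"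
      if "K \<le> K'" "\<forall>fwd n. (\<Sum>j<n. f (orbit_point \<alpha> fwd (fst z) j)) \<le> real K * real n" for K K' z
      using that by (meson mult_right_mono of_nat_0_le_iff of_nat_mono order_trans)
  qed (rule \<gamma>)
  then obtain K0 where K0: "prob {z\<in>space M. \<forall>fwd n. (\<Sum>j<n. f (orbit_point \<alpha> fwd (fst z) j)) \<le> real K0 * real n} > 1 - \<gamma>"
    by blast
  define Z0 where "Z0 = {z\<in>space M. \<forall>fwd n. (\<Sum>j<n. f (orbit_point \<alpha> fwd (fst z) j)) \<le> real K0 * real n}"
  have Z0: "Z0 \<in> sets M" "prob Z0 > 1 - \<gamma>" using K0 unfolding Z0_def orbit_point_def by measurable
  define K where "K = max K0 1"
  define \<kappa> where "\<kappa> = c / (10 * real J * real K)"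
  have \<kappa>: "\<kappa> > 0" using c_pos J by (simp add: \<kappa>_def K_def)
  define \<omega> where "\<omega> = \<gamma> / (2 / \<kappa> + 2)"
  have den: "2 / \<kappa> + 2 > 0" using \<kappa> by (simp add: add_pos_pos)
  have \<omega>: "\<omega> > 0" "\<omega> * (2 / \<kappa> + 2) = \<gamma>" using \<gamma> den by (auto simp: \<omega>_def)
  obtain Z1 N1 where Z1: "Z1 \<in> sets M" "measure M Z1 > 1 - 2 * \<gamma>"
    "\<And>z. z \<in> Z1 \<Longrightarrow> \<exists>g\<le>\<gamma>. \<forall>n\<ge>N1. \<bar>(\<Sum>j<n. indicator A (flow (real j * t0) z)) / real n - g\<bar> \<le> \<omega>"
    using frequency_set[OF A \<gamma>(1) mA \<omega>(1), of t0] by metis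
  obtain Z2 N2 where Z2: "Z2 \<in> sets M" "measure M Z2 > 1 - 2 * \<gamma>"
    "\<And>z. z \<in> Z2 \<Longrightarrow> \<exists>g\<le>\<gamma>. \<forall>n\<ge>N2. \<bar>(\<Sum>j<n. indicator A (flow (real j * - t0) z)) / real n - g\<bar> \<le> \<omega>"
    using frequency_set[OF A \<gamma>(1) mA \<omega>(1), of "- t0"] by metis
  have "\<exists>n. prob {z\<in>space M. fst z \<in> G n} > 1 - \<gamma>"
  proof (rule AE_exhaust)
    show "AE z in M. \<exists>n. fst z \<in> G n" by (rule AE_fst[OF G_AE])
    show "{z\<in>space M. fst z \<in> G n} \<in> sets M" for n
    proof -
      have [measurable]: "G n \<in> sets borel" by (rule G_sets)
      show ?thesis by measurable
    qed
  qed (use \<gamma> G_mono in auto)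
  then obtain n0 where n0: "prob {z\<in>space M. fst z \<in> G n0} > 1 - \<gamma>" by blast
  define Z3 where "Z3 = {z\<in>space M. fst z \<in> G n0}"
  have Z3: "Z3 \<in> sets M" "prob Z3 > 1 - \<gamma>"
  proof -
    have [measurable]: "G n0 \<in> sets borel" by (rule G_sets)
    show "Z3 \<in> sets M" unfolding Z3_def by measurable
  qed (use n0 Z3_def in simp)
  define Z where "Z = (Z0 \<inter> Z1) \<inter> (Z2 \<inter> Z3)"
  have Z: "Z \<in> sets M" "prob Z > 1 - \<epsilon>"
  proof -
    have 1: "Z0 \<inter> Z1 \<in> sets M \<and> prob (Z0 \<inter> Z1) > 1 - (\<gamma> + 2 * \<gamma>)" using Z0 Z1 by (intro prob_Int_gt) auto
    have 2: "Z2 \<inter> Z3 \<in> sets M \<and> prob (Z2 \<inter> Z3) > 1 - (2 * \<gamma> + \<gamma>)" using Z2 Z3 by (intro prob_Int_gt) auto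
    have "Z \<in> sets M \<and> prob Z > 1 - ((\<gamma> + 2 * \<gamma>) + (2 * \<gamma> + \<gamma>))"
      unfolding Z_def using 1 2 by (intro prob_Int_gt) auto
    then show "Z \<in> sets M" "prob Z > 1 - \<epsilon>" using \<gamma> by auto
  qed
  let ?P = "{p. c1 / 2 \<le> \<bar>p\<bar> \<and> \<bar>p\<bar> \<le> c2}"
  let ?freq = "\<lambda>m L (\<tau> :: nat \<Rightarrow> real) p x y. 1 / real L * real (card {n\<in>{m..m+L}.
    flow_dist circle_dist (flow (\<tau> n) x) (flow (\<tau> n + p) y) < \<epsilon>}) > 1 - \<epsilon>"
  let ?shadows = "\<lambda>\<kappa> N x y. \<exists>m L::nat. m > N \<and> L > N \<and> real L / real m \<ge> \<kappa> \<and>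
    (\<exists>p\<in>?P. ?freq m L (\<lambda>n. real n * t0) p x y \<or> ?freq m L (\<lambda>n. - (real n * t0)) p x y)"
  show "\<exists>\<kappa>>0. \<forall>N::nat. \<exists>\<delta>>0. \<exists>Z\<in>sets M. measure M Z > 1 - \<epsilon> \<and>
    (\<forall>x\<in>Z. \<forall>y\<in>Z. flow_dist circle_dist x y < \<delta> \<and> x \<notin> range (\<lambda>t. flow t y) \<longrightarrow> ?shadows \<kappa> N x y)"
  proof (rule exI[of _ \<kappa>], intro conjI allI \<kappa>)
    fix N :: nat
    define N' where "N' = max N (max N1 N2)"
    \<comment> \<open>from the time scale \<open>r\<close> on, the window starts after time \<open>N\<close>, is longer than \<open>N\<close>, and has the required ratio of length to starting time\<close>
    define r where "r = max (max 1 t0) (max ((c + \<bar>b\<bar> + 3 * t0) * (2 * real J) / c)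
        (max ((real N' * t0 + \<bar>b\<bar>) / c + 1) (real N' * t0 * (2 * real J) / c + 1)))"
    obtain R0 :: nat where R0: "r \<le> real R0" using real_arch_simple by blast
    obtain \<delta>' where \<delta>': "\<delta>' > 0" "\<And>x y. x \<in> G n0 \<Longrightarrow> x \<noteq> y \<Longrightarrow> \<bar>x - y\<bar> < \<delta>' \<Longrightarrow> \<exists>R\<ge>R0. \<exists>fwd.
        (\<Sum>j<3 * R. \<bar>f (orbit_point \<alpha> fwd x j) - f (orbit_point \<alpha> fwd y j)\<bar>) \<le> c2 \<and>
        (\<forall>n\<le>2 * R. c1 \<le> \<bar>\<Sum>j\<in>{n..<n + R}. f (orbit_point \<alpha> fwd x j) - f (orbit_point \<alpha> fwd y j)\<bar>)"
      using base[of n0 R0] by blast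
    define \<delta> where "\<delta> = min \<delta>' e"
    have \<delta>: "\<delta> > 0" "\<delta> \<le> \<delta>'" "\<delta> \<le> e" using \<delta>' e by (auto simp: \<delta>_def)
    show "\<exists>\<delta>>0. \<exists>Z\<in>sets M. measure M Z > 1 - \<epsilon> \<and>
      (\<forall>x\<in>Z. \<forall>y\<in>Z. flow_dist circle_dist x y < \<delta> \<and> x \<notin> range (\<lambda>t. flow t y) \<longrightarrow> ?shadows \<kappa> N x y)"
    proof (intro exI[of _ \<delta>] conjI bexI[of _ Z] Z \<delta>(1) ballI impI)
      fix z w assume zw: "z \<in> Z" "w \<in> Z"
      assume *: "flow_dist circle_dist z w < \<delta> \<and> z \<notin> range (\<lambda>t. flow t w)"
      obtain x s where z: "z = (x, s)" by force
      obtain y s' where w: "w = (y, s')" by force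
      have "Z \<subseteq> X" using Z(1) by (simp only: sets_M)
      then have xs: "(x, s) \<in> X" and ys: "(y, s') \<in> X" using zw by (auto simp: z w)
      have d: "circle_dist x y + \<bar>s - s'\<bar> < \<delta>" using * by (simp add: z w flow_dist_def)
      have d0: "circle_dist x y \<ge> 0" by (simp add: circle_dist_def circle_norm_nonneg)
      have ne: "x \<noteq> y"
      proof
        assume "x = y"
        then have "z = flow (s - s') w" unfolding z w using same_fibre_same_orbit xs ys by simp
        then show False using * by blast
      qed
      have dxy: "circle_dist x y < \<delta>" using d by linarith
      obtain y' where y': "\<bar>x - y'\<bar> < \<delta>" "frac y' = frac y"
        "\<And>fwd j. f (orbit_point \<alpha> fwd y' j) = f (orbit_point \<alpha> fwd y j)"
        by (rule lift_near[OF dxy]) (rule that; assumption)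
      have "x \<noteq> y'" using y'(2) ne xs ys by (auto simp: X_iff frac_eq)
      moreover have "x \<in> G n0" using zw by (simp add: Z_def Z3_def z)
      ultimately obtain R fwd where R: "R \<ge> R0"
        and var: "(\<Sum>j<3 * R. \<bar>f (orbit_point \<alpha> fwd x j) - f (orbit_point \<alpha> fwd y j)\<bar>) \<le> c2"
        and block: "\<And>n. n \<le> 2 * R \<Longrightarrow> c1 \<le> \<bar>\<Sum>j\<in>{n..<n + R}. f (orbit_point \<alpha> fwd x j) - f (orbit_point \<alpha> fwd y j)\<bar>"
        using \<delta>'(2)[of x y'] y'(1) \<delta>(2) unfolding y'(3) by fastforce
      have K: "(\<Sum>j<n. f (orbit_point \<alpha> d x j)) \<le> real K * real n" for d n
      proof -
        have "(\<Sum>j<n. f (orbit_point \<alpha> d x j)) \<le> real K0 * real n" using zw by (simp add: Z_def Z0_def z)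
        also have "\<dots> \<le> real K * real n" unfolding K_def by (intro mult_right_mono) auto
        finally show ?thesis .
      qed
      have rR: "r \<le> real R" using R R0 by simp
      have R1: "R \<ge> 1" "real R \<ge> t0" using rR by (auto simp: r_def)
      have R2: "c * real R / (2 * real J) \<ge> c + \<bar>b\<bar> + 3 * t0"
      proof -
        have "(c + \<bar>b\<bar> + 3 * t0) * (2 * real J) / c \<le> real R" using rR by (simp add: r_def)
        then show ?thesis using c_pos J by (simp add: pos_divide_le_eq pos_le_divide_eq mult.commute)
      qed
      have R3: "c * (real R - 1) - \<bar>b\<bar> \<ge> real N' * t0"
      proof -
        have "(real N' * t0 + \<bar>b\<bar>) / c \<le> real R - 1" using rR by (simp add: r_def)
        then show ?thesis using c_pos by (simp add: pos_divide_le_eq mult.commute)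
      qed
      have R4: "c * real R / (2 * real J) > real N' * t0"
      proof -
        have "real N' * t0 * (2 * real J) / c < real R" using rR by (simp add: r_def)
        then show ?thesis using c_pos J by (simp add: pos_divide_less_eq pos_less_divide_eq mult.commute)
      qed
      define \<sigma> where "\<sigma> = (if fwd then 1 else - 1 :: real)"
      have ss: "\<bar>s - s'\<bar> \<le> e" using d d0 \<delta> by linarith
      have K1: "K \<ge> 1" by (simp add: K_def)
      obtain m L p where mL: "m > N'" "L > N'" "real L / real m \<ge> \<kappa>"
        and p: "c1 / 2 \<le> \<bar>p\<bar>" "\<bar>p\<bar> \<le> c2"
        and shadow: "\<And>n. n \<in> {m..m + L} \<Longrightarrow> flow (\<sigma> * (real n * t0)) (x, s) \<notin> A \<Longrightarrow>
          flow_dist circle_dist (flow (\<sigma> * (real n * t0)) (x, s)) (flow (\<sigma> * (real n * t0) + p) (y, s')) \<le> circle_dist x y + 2 * e"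
        using shadowing_times[OF xs ys ss var block J(2,1) K K1 t0 R1 R2 R3 R4] unfolding \<kappa>_def \<sigma>_def A_def by blast
      define Nf where "Nf = (if fwd then N1 else N2)"
      have st: "\<sigma> * (real j * t0) = real j * (if fwd then t0 else - t0)" for j by (simp add: \<sigma>_def)
      obtain g where g: "g \<le> \<gamma>" "\<And>n. n \<ge> Nf \<Longrightarrow> \<bar>(\<Sum>j<n. indicator A (flow (\<sigma> * (real j * t0)) (x, s))) / real n - g\<bar> \<le> \<omega>"
        using Z1(3)[of z] Z2(3)[of z] zw unfolding st Nf_def Z_def z by (cases fwd) auto
      have L0: "0 < L" "0 < m" "Nf \<le> m" using mL by (auto simp: N'_def Nf_def)
      have "real (card {n\<in>{m..m + L}. flow (\<sigma> * (real n * t0)) (x, s) \<notin> A}) > (1 - \<epsilon>) * real L"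
        by (rule count_good_times[where w="\<lambda>n. flow (\<sigma> * (real n * t0)) (x, s)" and N=Nf and g=g and \<gamma>=\<gamma> and \<kappa>=\<kappa> and \<omega>=\<omega>])
          (use g \<gamma> L0 \<kappa> mL \<omega> \<epsilon> in auto)
      moreover have "card {n\<in>{m..m + L}. flow (\<sigma> * (real n * t0)) (x, s) \<notin> A} \<le>
          card {n\<in>{m..m+L}. flow_dist circle_dist (flow (\<sigma> * (real n * t0)) z) (flow (\<sigma> * (real n * t0) + p) w) < \<epsilon>}"
      proof (rule card_mono)
        have "circle_dist x y + 2 * e < \<epsilon>" using d d0 \<delta> e by linarith
        then show "{n\<in>{m..m + L}. flow (\<sigma> * (real n * t0)) (x, s) \<notin> A} \<subseteq>
          {n\<in>{m..m+L}. flow_dist circle_dist (flow (\<sigma> * (real n * t0)) z) (flow (\<sigma> * (real n * t0) + p) w) < \<epsilon>}"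
          using shadow unfolding z w by fastforce
      qed simp
      ultimately have "(1 - \<epsilon>) * real L <
          real (card {n\<in>{m..m+L}. flow_dist circle_dist (flow (\<sigma> * (real n * t0)) z) (flow (\<sigma> * (real n * t0) + p) w) < \<epsilon>})"
        by linarith
      then have fin: "?freq m L (\<lambda>n. \<sigma> * (real n * t0)) p z w"
        using L0 by (simp add: pos_less_divide_eq)
      have D: "?freq m L (\<lambda>n. real n * t0) p z w \<or> ?freq m L (\<lambda>n. - (real n * t0)) p z w"
      proof (cases fwd)
        case True
        then show ?thesis using fin unfolding \<sigma>_def by (intro disjI1) simp
      next
        case False
        then show ?thesis using fin unfolding \<sigma>_def by (intro disjI2) simp
      qed
      have "N < m" "N < L" "p \<in> ?P" using mL p by (auto simp: N'_def)
      with D mL(3) show "?shadows \<kappa> N z w"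
        by blast
    qed
  qed
qed

end

section \<open>Denominators of best approximations\<close>

lemma circle_norm_nonzero_mult:
  assumes "\<alpha> \<notin> \<rat>" "n > 0"
  shows "real n * \<alpha> - of_int p \<noteq> 0"
proof
  assume "real n * \<alpha> - of_int p = 0"
  then have "\<alpha> = of_int p / of_nat n" using assms by (simp add: field_simps)
  then have "\<alpha> \<in> \<rat>" by simp
  then show False using assms by simp
qed

locale denominator_sequence =
  fixes \<alpha> :: real and q :: "nat \<Rightarrow> nat"
  assumes irrational: "\<alpha> \<notin> \<rat>" and denom: "denominators \<alpha> q"
begin

lemma strict_mono_q: "strict_mono q" and q_0: "q 0 = 1"
  and best: "1 \<le> k \<Longrightarrow> k < q (Suc s) \<Longrightarrow> k \<noteq> q s \<Longrightarrow> circle_norm (real (q s) * \<alpha>) < circle_norm (real k * \<alpha>)"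
  using denom unfolding denominators_def by auto

lemma q_mono: "m \<le> n \<Longrightarrow> q m \<le> q n"
  using strict_mono_q by (simp add: strict_mono_less_eq)

lemma q_Suc_less: "q s < q (Suc s)"
  using strict_mono_q by (simp add: strict_mono_def)

lemma q_pos: "q s > 0"
  using q_mono[of 0 s] q_0 by simp

lemma q_ge: "q s \<ge> Suc s"
  by (induction s) (use q_0 q_Suc_less in \<open>auto simp: Suc_le_eq intro: le_less_trans\<close>)

definition p :: "nat \<Rightarrow> int" where
  "p s = (SOME n. circle_norm (real (q s) * \<alpha>) = \<bar>real (q s) * \<alpha> - of_int n\<bar>)"

lemma norm_q: "circle_norm (real (q s) * \<alpha>) = \<bar>real (q s) * \<alpha> - of_int (p s)\<bar>"
  unfolding p_def by (rule someI_ex) (metis circle_norm_attains)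

lemma norm_q_decreasing: "circle_norm (real (q (Suc s)) * \<alpha>) < circle_norm (real (q s) * \<alpha>)"
  using best[of "q s" "Suc s"] q_pos[of s] q_Suc_less[of s] q_Suc_less[of "Suc s"] by simp

lemma norm_q_strict_antimono: "i < j \<Longrightarrow> circle_norm (real (q j) * \<alpha>) < circle_norm (real (q i) * \<alpha>)"
proof (induction j)
  case (Suc j)
  then show ?case using norm_q_decreasing[of j] by (cases "i = j") auto
qed simp

lemma norm_q_less: "circle_norm (real (q s) * \<alpha>) < 1 / (real (q (Suc s)) - 1)"
proof -
  \<comment> \<open>Dirichlet's theorem with \<open>N\<close> yields a good approximation with denominator less than \<open>q (s + 1)\<close>\<close>
  define N where "N = q (Suc s) - 1"
  have q1: "q (Suc s) \<ge> 2" using q_ge[of "Suc s"] by simp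
  then have N: "N > 0" "real N = real (q (Suc s)) - 1" by (auto simp: N_def of_nat_diff)
  obtain h k where k: "0 < k" "k \<le> int N" "\<bar>of_int k * \<alpha> - of_int h\<bar> < 1 / real N"
    using Dirichlet_approx[OF N(1), of \<alpha>] by blast
  define m where "m = nat k"
  have m: "1 \<le> m" "m < q (Suc s)" "real m = of_int k" using k q1 by (auto simp: m_def N_def)
  have "circle_norm (real m * \<alpha>) < 1 / real N"
    using circle_norm_le[of "real m * \<alpha>" h] k(3) m(3) by simp
  moreover have "circle_norm (real (q s) * \<alpha>) \<le> circle_norm (real m * \<alpha>)"
    using best[of m s] m by (cases "m = q s") auto
  ultimately show ?thesis using N by simp
qed

lemma norm_q_le: "\<bar>real (q s) * \<alpha> - of_int (p s)\<bar> \<le> 1 / real (q s)" "\<bar>real (q s) * \<alpha> - of_int (p s)\<bar> \<le> 2 / real (q (Suc s))"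
proof -
  have q1: "real (q (Suc s)) \<ge> 2" using q_ge[of "Suc s"] by simp
  have q2: "real (q s) \<le> real (q (Suc s)) - 1" using q_Suc_less[of s] by simp
  have "1 / (real (q (Suc s)) - 1) \<le> 1 / real (q s)" using q2 q_pos[of s] by (intro divide_left_mono) auto
  moreover have "1 / (real (q (Suc s)) - 1) \<le> 2 / real (q (Suc s))" using q1 by (simp add: field_simps)
  ultimately show "\<bar>real (q s) * \<alpha> - of_int (p s)\<bar> \<le> 1 / real (q s)" "\<bar>real (q s) * \<alpha> - of_int (p s)\<bar> \<le> 2 / real (q (Suc s))"
    using norm_q_less[of s] norm_q[of s] by linarith+
qed

text \<open>
  Cancelling a common factor would give a smaller denominator with an approximation at least as good.
\<close>

lemma coprime_p_q: "coprime (p s) (int (q s))"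
proof (rule ccontr)
  assume nc: "\<not> coprime (p s) (int (q s))"
  define g where "g = gcd (p s) (int (q s))"
  have g0: "g > 0" using q_pos[of s] by (simp add: g_def)
  have "g \<noteq> 1" using nc by (simp add: g_def coprime_iff_gcd_eq_1)
  then have g: "g \<ge> 2" using g0 by simp
  obtain a where a: "p s = g * a" unfolding g_def by (metis dvd_def gcd_dvd1)
  obtain b where b: "int (q s) = g * b" unfolding g_def by (metis dvd_def gcd_dvd2)
  have b0: "b > 0" using b g0 q_pos[of s] by (metis of_nat_0_less_iff zero_less_mult_pos)
  define k where "k = nat b"
  have k: "real k = of_int b" "1 \<le> k" using b0 by (auto simp: k_def)
  have "int k < int (q s)" using b b0 g by (simp add: k_def)
  then have kq: "k < q s" by simp
  have "real (q s) = of_int g * of_int b" using b by (metis of_int_mult of_int_of_nat_eq)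
  then have "real (q s) * \<alpha> - of_int (p s) = of_int g * (real k * \<alpha> - of_int a)"
    using a k by (simp add: algebra_simps)
  then have "circle_norm (real (q s) * \<alpha>) = of_int g * \<bar>real k * \<alpha> - of_int a\<bar>"
    using g0 by (simp add: norm_q abs_mult)
  moreover have "1 * \<bar>real k * \<alpha> - of_int a\<bar> \<le> of_int g * \<bar>real k * \<alpha> - of_int a\<bar>"
    using g by (intro mult_right_mono) auto
  ultimately have "circle_norm (real k * \<alpha>) \<le> circle_norm (real (q s) * \<alpha>)"
    using circle_norm_le[of "real k * \<alpha>" a] by (simp only: mult_1_left)
  then show False using best[of k s] k kq q_Suc_less[of s] by simp
qed

text \<open>
  If both approximations err on the same side, the denominator \<open>q j - q i\<close> approximates better than
  \<open>q i\<close>; it would be too small for that if \<open>q j < 2 q i\<close>.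
\<close>

lemma same_side_gap:
  assumes "i < j" and sgn: "0 < (real (q i) * \<alpha> - of_int (p i)) * (real (q j) * \<alpha> - of_int (p j))"
  shows "2 * q i \<le> q j"
proof (rule ccontr)
  assume "\<not> 2 * q i \<le> q j"
  have qij: "q i < q j" using strict_mono_q assms by (simp add: strict_mono_def)
  define e where "e n = real (q n) * \<alpha> - of_int (p n)" for n
  define k where "k = q j - q i"
  have k: "1 \<le> k" "k < q i" using qij \<open>\<not> _\<close> by (auto simp: k_def)
  have "\<bar>e j\<bar> < \<bar>e i\<bar>"
    using norm_q_strict_antimono[OF assms(1)]
    by (simp add: norm_q e_def)
  moreover have "e j \<noteq> 0" unfolding e_def by (rule circle_norm_nonzero_mult[OF irrational q_pos])
  ultimately have "\<bar>e j - e i\<bar> < \<bar>e i\<bar>" using sgn unfolding e_def[symmetric]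
    by (auto simp: zero_less_mult_iff abs_if)
  moreover have "real k * \<alpha> - of_int (p j - p i) = e j - e i"
    using qij by (simp add: k_def e_def of_nat_diff algebra_simps)
  ultimately have "circle_norm (real k * \<alpha>) < circle_norm (real (q i) * \<alpha>)"
    using circle_norm_le[of "real k * \<alpha>" "p j - p i"] by (simp add: norm_q e_def[symmetric])
  then show False using best[of k i] k q_Suc_less[of i] by simp
qed

text \<open>
  Among three consecutive approximations two err on the same side.
\<close>

lemma q_double: "2 * q s \<le> q (Suc (Suc s))"
proof -
  define e where "e n = real (q n) * \<alpha> - of_int (p n)" for n
  have ne: "e n \<noteq> 0" for n unfolding e_def by (rule circle_norm_nonzero_mult[OF irrational q_pos])
  have *: "0 < e i * e j \<Longrightarrow> i < j \<Longrightarrow> 2 * q i \<le> q j" for i j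
    using same_side_gap[of i j] by (simp add: e_def)
  consider "0 < e s * e (Suc s)" | "0 < e s * e (Suc (Suc s))" | "0 < e (Suc s) * e (Suc (Suc s))"
    using ne[of s] ne[of "Suc s"] ne[of "Suc (Suc s)"] by (auto simp: zero_less_mult_iff linorder_neq_iff)
  then show ?thesis
    using *[of s "Suc s"] *[of s "Suc (Suc s)"] *[of "Suc s" "Suc (Suc s)"] q_mono[of "Suc s" "Suc (Suc s)"]
      q_mono[of s "Suc s"] by cases auto
qed

lemma q_pow2: "2 ^ n * q s \<le> q (s + 2 * n)"
proof (induction n)
  case (Suc n)
  then show ?case using q_double[of "s + 2 * n"] by simp
qed simp

end

section \<open>Sums of a monotone function along a block\<close>

text \<open>
  The points \<open>\<theta> + i \<beta>\<close> for \<open>i < q\<close> are perturbations by at most \<open>2 / q\<close> of the points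
  \<open>(c + i p) / q\<close>, which are all fractions with denominator \<open>q\<close> because \<open>p\<close> and \<open>q\<close> are coprime. The
  first and the last index are excluded, since there the perturbation may pass through an integer.
\<close>

lemma block_order:
  fixes \<beta> \<theta> :: real and q :: nat and p :: int
  assumes q: "q > 0" and cop: "coprime p (int q)" and approx: "\<bar>real q * \<beta> - of_int p\<bar> \<le> 1 / real q"
  obtains J :: "nat \<Rightarrow> nat" where "bij_betw J {..<q} {..<q}"
    "\<And>i. i < q \<Longrightarrow> 1 \<le> J i \<Longrightarrow> J i + 2 \<le> q \<Longrightarrow>
      (real (J i) - 1) / real q \<le> frac (\<theta> + real i * \<beta>) \<and> frac (\<theta> + real i * \<beta>) \<le> (real (J i) + 2) / real q"
proof -
  define c where "c = \<lfloor>real q * \<theta>\<rfloor>"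
  define J where "J i = nat ((c + int i * p) mod int q)" for i
  have J_int: "int (J i) = (c + int i * p) mod int q" for i using q by (simp add: J_def)
  have J_less: "J i < q" for i
  proof -
    have "int (J i) < int q" unfolding J_int using q by simp
    then show ?thesis by simp
  qed
  have "inj_on J {..<q}"
  proof (rule inj_onI)
    fix i j assume ij: "i \<in> {..<q}" "j \<in> {..<q}" "J i = J j"
    then have "int q dvd (c + int i * p) - (c + int j * p)"
      unfolding mod_eq_dvd_iff[symmetric] using J_int[of i] J_int[of j] ij(3) by simp
    then have "int q dvd (int i - int j) * p" by (simp add: algebra_simps)
    then have dvd: "int q dvd int i - int j"
      using cop by (simp add: coprime_dvd_mult_left_iff coprime_commute)
    have "\<bar>int i - int j\<bar> < int q" using ij by auto
    then show "i = j" using dvd_imp_le_int[OF _ dvd] by fastforce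
  qed
  moreover have "J ` {..<q} = {..<q}"
    using \<open>inj_on J {..<q}\<close> J_less by (intro card_subset_eq) (auto simp: card_image)
  ultimately have bij: "bij_betw J {..<q} {..<q}" by (simp add: bij_betw_def)
  show thesis
  proof (rule that[OF bij])
    fix i assume i: "i < q" "1 \<le> J i" "J i + 2 \<le> q"
    define m where "m = (c + int i * p) div int q"
    have cm: "c + int i * p = m * int q + int (J i)" unfolding m_def J_int by simp
    define r where "r = (real q * \<theta> - of_int c) / real q + real i * (real q * \<beta> - of_int p) / real q"
    have r: "- 1 / real q \<le> r" "r < 2 / real q"
    proof -
      have 1: "0 \<le> real q * \<theta> - of_int c" "real q * \<theta> - of_int c < 1" unfolding c_def by linarith+
      have "\<bar>real i * (real q * \<beta> - of_int p)\<bar> \<le> real q * (1 / real q)"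
        unfolding abs_mult using i approx by (intro mult_mono) auto
      then have 2: "\<bar>real i * (real q * \<beta> - of_int p)\<bar> \<le> 1" using q by simp
      have "r = (real q * \<theta> - of_int c + real i * (real q * \<beta> - of_int p)) / real q"
        by (simp add: r_def add_divide_distrib)
      moreover have "- 1 \<le> real q * \<theta> - of_int c + real i * (real q * \<beta> - of_int p)"
        "real q * \<theta> - of_int c + real i * (real q * \<beta> - of_int p) < 2" using 1 2 by linarith+
      ultimately show "- 1 / real q \<le> r" "r < 2 / real q"
        using q by (simp_all only: divide_right_mono divide_strict_right_mono of_nat_0_less_iff of_nat_0_le_iff)
    qed
    have "real q * (\<theta> + real i * \<beta>) = of_int (c + int i * p) + real q * r"
      using q by (simp add: r_def field_simps)
    also have "\<dots> = real q * (of_int m + real (J i) / real q + r)"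
      unfolding cm using q by (simp add: field_simps)
    finally have eq: "\<theta> + real i * \<beta> = of_int m + real (J i) / real q + r" using q by simp
    define z where "z = real (J i) / real q + r"
    have z: "(real (J i) - 1) / real q \<le> z" "z < (real (J i) + 2) / real q"
      using r by (auto simp: z_def add_divide_distrib diff_divide_distrib)
    have J1: "real (J i) \<ge> 1" "real (J i) + 2 \<le> real q" using i by auto
    have z0: "0 \<le> z" using z(1) J1 by (smt (verit) divide_nonneg_nonneg of_nat_0_le_iff)
    have z1: "z < 1" using z(2) J1 q by (smt (verit) divide_le_eq_1 of_nat_0_less_iff)
    have "frac (\<theta> + real i * \<beta>) = z" using z0 z1 eq by (auto simp: frac_unique_iff z_def)
    then show "(real (J i) - 1) / real q \<le> frac (\<theta> + real i * \<beta>) \<and> frac (\<theta> + real i * \<beta>) \<le> (real (J i) + 2) / real q"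
      using z by simp
  qed
qed

locale singularity =
  fixes h :: "real \<Rightarrow> real"
  assumes singularity: "singularity_type h"
begin

text \<open>
  The derivative \<open>h'\<close> with its sign reversed; it is nonnegative and decreasing.
\<close>

definition u :: "real \<Rightarrow> real" where "u x = - deriv h x"

lemma h_deriv: "0 < x \<Longrightarrow> x < 1 \<Longrightarrow> (h has_real_derivative - u x) (at x)"
  using singularity unfolding singularity_type_def C2_on_def u_def
  by (auto simp: DERIV_deriv_iff_real_differentiable)

lemma h_pos: "0 < x \<Longrightarrow> x < 1 \<Longrightarrow> h x > 0"
  using singularity unfolding singularity_type_def by auto

lemma h_antimono: "0 < x \<Longrightarrow> x \<le> y \<Longrightarrow> y < 1 \<Longrightarrow> h y \<le> h x"
  using singularity unfolding singularity_type_def by (auto simp: monotone_on_def)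

lemma u_antimono: "0 < x \<Longrightarrow> x \<le> y \<Longrightarrow> y < 1 \<Longrightarrow> u y \<le> u x"
  using singularity unfolding singularity_type_def u_def by (auto simp: monotone_on_def)

lemma u_nonneg:
  assumes "0 < x" "x < 1"
  shows "u x \<ge> 0"
proof (rule ccontr)
  assume "\<not> u x \<ge> 0"
  then have "0 < - u x" by simp
  from DERIV_pos_inc_right[OF h_deriv[OF assms] this]
  obtain d where d: "d > 0" "\<And>e. e > 0 \<Longrightarrow> e < d \<Longrightarrow> h x < h (x + e)" by blast
  define e where "e = min (d / 2) ((1 - x) / 2)"
  have e: "e > 0" "e < d" "x + e < 1" using d assms by (auto simp: e_def min_def field_simps)
  show False using d(2)[OF e(1,2)] h_antimono[of x "x + e"] e assms by simp
qed

lemma h_mvt: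
  assumes "0 < a" "a < b" "b < 1"
  shows "(b - a) * u b \<le> h a - h b" "h a - h b \<le> (b - a) * u a"
proof -
  have "\<exists>z>a. z < b \<and> h b - h a = (b - a) * (- u z)"
    by (rule MVT2[OF assms(2)]) (use assms in \<open>auto intro: h_deriv\<close>)
  then obtain z where z: "a < z" "z < b" "h b - h a = (b - a) * (- u z)" by blast
  have "(b - a) * u b \<le> (b - a) * u z" "(b - a) * u z \<le> (b - a) * u a"
    using z assms by (auto intro!: mult_left_mono u_antimono)
  then show "(b - a) * u b \<le> h a - h b" "h a - h b \<le> (b - a) * u a" using z by (auto simp: algebra_simps)
qed

lemma h_large:
  obtains \<delta> where "0 < \<delta>" "\<delta> < 1" "\<And>x. 0 < x \<Longrightarrow> x < \<delta> \<Longrightarrow> h x > K"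
proof -
  have "\<forall>\<^sub>F x in at_right 0. h x > K"
    using singularity unfolding singularity_type_def filterlim_at_top_dense by blast
  then obtain b where b: "b > 0" "\<And>x. x > 0 \<Longrightarrow> x < b \<Longrightarrow> h x > K"
    unfolding eventually_at_right_field by blast
  show thesis by (rule that[of "min b (1/2)"]) (use b in auto)
qed

lemma u_pos_near_0:
  obtains \<delta> where "0 < \<delta>" "\<delta> < 1" "\<And>x. 0 < x \<Longrightarrow> x < \<delta> \<Longrightarrow> u x > 0"
proof -
  obtain \<delta> where \<delta>: "0 < \<delta>" "\<delta> < 1" "\<And>x. 0 < x \<Longrightarrow> x < \<delta> \<Longrightarrow> h x > h (1/2)"
    using h_large[of "h (1/2)"] by blast
  show thesis
  proof (rule that[of "min \<delta> (1/2)"])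
    fix x assume x: "0 < x" "x < min \<delta> (1/2)"
    have "h (1/2) < h x" using \<delta>(3) x by simp
    also have "h x \<le> (1/2 - x) * u x + h (1/2)" using h_mvt(2)[of x "1/2"] x by simp
    finally have "0 < (1/2 - x) * u x" by simp
    then show "u x > 0" using x by (simp add: zero_less_mult_iff)
  qed (use \<delta> in auto)
qed

text \<open>
  The sum is compared, point by point, with the values of \<open>u\<close> at the fractions with denominator \<open>q\<close>, and
  these with increments of \<open>h\<close>, whose sum telescopes. Only the few points nearest to the ends of the
  interval are estimated by \<open>u \<tau>\<close>. The same bound \<open>u \<tau>\<close> controls \<open>h(1 / (2 q)) - h(3 / q)\<close>, because
  \<open>\<tau> \<le> 1 / (2 q)\<close> and \<open>u\<close> is decreasing.
\<close>

lemma block_sum_u: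
  fixes \<beta> \<theta> \<tau> :: real and q :: nat and p :: int
  assumes q: "q \<ge> 6" and cop: "coprime p (int q)" and approx: "\<bar>real q * \<beta> - of_int p\<bar> \<le> 1 / real q"
    and \<tau>: "0 < \<tau>" "\<tau> \<le> 1 / (2 * real q)" and far: "\<And>i. i < q \<Longrightarrow> \<tau> \<le> frac (\<theta> + real i * \<beta>)"
  shows "\<bar>(\<Sum>i<q. u (frac (\<theta> + real i * \<beta>))) - real q * h (1 / (2 * real q))\<bar> \<le> 4 * u \<tau> + real q * h (1 / 2)"
proof -
  define Q where "Q = real q"
  have Q: "Q \<ge> 6" using q by (simp add: Q_def)
  have "1 / (2 * Q) \<le> 1 / 12" using Q by (intro divide_left_mono) auto
  then have \<tau>1: "\<tau> < 1" using \<tau> by (simp add: Q_def[symmetric])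
  define z where "z i = frac (\<theta> + real i * \<beta>)" for i
  have z01: "0 < z i" "z i < 1" "\<tau> \<le> z i" if "i < q" for i
    using far[OF that] \<tau> frac_lt_1[of "\<theta> + real i * \<beta>"] unfolding z_def by linarith+
  have q0: "q > 0" using q by simp
  obtain J where J: "bij_betw J {..<q} {..<q}"
    and Jz': "\<And>i. i < q \<Longrightarrow> 1 \<le> J i \<Longrightarrow> J i + 2 \<le> q \<Longrightarrow>
      (real (J i) - 1) / real q \<le> frac (\<theta> + real i * \<beta>) \<and> frac (\<theta> + real i * \<beta>) \<le> (real (J i) + 2) / real q"
    by (rule block_order[OF q0 cop approx, of \<theta>]) (rule that; assumption)
  note Jz = Jz'[folded z_def Q_def]
  have J_less: "J i < q" if "i < q" for i using J that by (auto simp: bij_betw_def)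
  have reindex: "(\<Sum>i<q. w (J i)) = (\<Sum>j<q. w j)" for w :: "nat \<Rightarrow> real"
    using sum.reindex_bij_betw[OF J, of w] .
  have u\<tau>: "0 \<le> u \<tau>" using u_nonneg \<tau> \<tau>1 by simp
  define H where "H l = Q * h (real l / Q)" for l
  have step: "H l - H (Suc l) \<le> u (real l / Q)" "u (real (Suc l) / Q) \<le> H l - H (Suc l)" if "1 \<le> l" "Suc l < q" for l
  proof -
    have "0 < real l / Q" "real l / Q < real (Suc l) / Q" "real (Suc l) / Q < 1"
      using that Q by (auto simp: Q_def divide_strict_right_mono)
    from h_mvt[OF this] have "(real (Suc l) / Q - real l / Q) * u (real (Suc l) / Q) \<le> h (real l / Q) - h (real (Suc l) / Q)"
      "h (real l / Q) - h (real (Suc l) / Q) \<le> (real (Suc l) / Q - real l / Q) * u (real l / Q)" by auto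
    moreover have "real (Suc l) / Q - real l / Q = 1 / Q" by (simp add: diff_divide_distrib[symmetric])
    ultimately have "u (real (Suc l) / Q) / Q \<le> h (real l / Q) - h (real (Suc l) / Q)"
      "h (real l / Q) - h (real (Suc l) / Q) \<le> u (real l / Q) / Q" by simp_all
    then show "H l - H (Suc l) \<le> u (real l / Q)" "u (real (Suc l) / Q) \<le> H l - H (Suc l)"
      using Q by (simp_all add: H_def field_simps)
  qed
  have split: "{..<q} = {..<3} \<union> {3..<q - 1} \<union> {q - 1}" using q by auto
  have upper: "(\<Sum>i<q. u (z i)) \<le> 4 * u \<tau> + Q * h (1 / (2 * Q))"
  proof -
    \<comment> \<open>at these indices the point, or the increment of \<open>h\<close> that would bound its value, may reach an end of the interval\<close>
    define w where "w j = (if j < 3 \<or> j = q - 1 then u \<tau> else H (j - 2) - H (j - 1))" for j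
    have "u (z i) \<le> w (J i)" if i: "i < q" for i
    proof (cases "J i < 3 \<or> J i = q - 1")
      case True
      then show ?thesis using z01[OF i] \<tau> by (auto simp: w_def intro: u_antimono)
    next
      case False
      then have J3: "3 \<le> J i" "J i + 2 \<le> q" using J_less[OF i] by auto
      have "u (z i) \<le> u (real (J i - 1) / Q)"
      proof (rule u_antimono)
        have "1 \<le> J i" using J3 by simp
        from Jz[OF i this J3(2)] show "real (J i - 1) / Q \<le> z i" using J3 by (simp add: of_nat_diff)
        show "0 < real (J i - 1) / Q" using J3 Q by simp
      qed (rule z01[OF i])
      also have "\<dots> \<le> H (J i - 2) - H (J i - 1)"
      proof -
        have "Suc (J i - 2) = J i - 1" using J3 by simp
        then show ?thesis using step(2)[of "J i - 2"] J3 by simp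
      qed
      finally show ?thesis using False by (simp add: w_def)
    qed
    then have "(\<Sum>i<q. u (z i)) \<le> (\<Sum>i<q. w (J i))" by (intro sum_mono) simp
    also have "\<dots> = (\<Sum>j<q. w j)" by (rule reindex)
    also have "\<dots> = (\<Sum>j<3. w j) + (\<Sum>j\<in>{3..<q - 1}. w j) + w (q - 1)"
      unfolding split by (subst sum.union_disjoint, simp, simp, use q in force)+ simp
    also have "(\<Sum>j<3. w j) = 3 * u \<tau>" by (simp add: w_def)
    also have "w (q - 1) = u \<tau>" by (simp add: w_def)
    also have "(\<Sum>j\<in>{3..<q - 1}. w j) = (\<Sum>j\<in>{1..<q - 3}. H j - H (Suc j))"
    proof -
      have "1 + 2 = (3::nat)" "q - 3 + 2 = q - 1" using q by auto
      then have "(\<Sum>j\<in>{3..<q - 1}. w j) = (\<Sum>j\<in>{1..<q - 3}. w (j + 2))"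
        using sum.shift_bounds_nat_ivl[of w 1 2 "q - 3"] by (simp only:)
      also have "\<dots> = (\<Sum>j\<in>{1..<q - 3}. H j - H (Suc j))"
        by (intro sum.cong) (auto simp: w_def)
      finally show ?thesis .
    qed
    also have "\<dots> = H 1 - H (q - 3)"
      using sum_Suc_diff'[of 1 "q - 3" "\<lambda>j. - H j"] q by (simp add: algebra_simps)
    also have "\<dots> \<le> Q * h (1 / (2 * Q))"
    proof -
      have "0 \<le> H (q - 3)" unfolding H_def using q Q by (intro mult_nonneg_nonneg less_imp_le[OF h_pos]) (auto simp: Q_def)
      moreover have "H 1 \<le> Q * h (1 / (2 * Q))"
        unfolding H_def using Q by (intro mult_left_mono h_antimono) (auto simp: field_simps)
      ultimately show ?thesis by simp
    qed
    finally show ?thesis by simp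
  qed
  have lower: "Q * h (1 / (2 * Q)) - 3 * u \<tau> - Q * h (1 / 2) \<le> (\<Sum>i<q. u (z i))"
  proof -
    define w where "w j = (if 1 \<le> j \<and> j < q - 4 then H (j + 2) - H (Suc (j + 2)) else 0)" for j
    have "w (J i) \<le> u (z i)" if i: "i < q" for i
    proof (cases "1 \<le> J i \<and> J i < q - 4")
      case True
      have "w (J i) = H (J i + 2) - H (Suc (J i + 2))" using True by (simp add: w_def)
      also have "\<dots> \<le> u (real (J i + 2) / Q)" using True by (intro step) auto
      also have "\<dots> \<le> u (z i)"
      proof (rule u_antimono)
        have "1 \<le> J i" "J i + 2 \<le> q" using True by auto
        from Jz[OF i this] show "z i \<le> real (J i + 2) / Q" by (simp add: add.commute)
        have "real (J i + 2) < real q" unfolding of_nat_less_iff using True by auto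
        then show "real (J i + 2) / Q < 1" using q0 unfolding Q_def by (simp only: divide_less_eq_1_pos of_nat_0_less_iff)
      qed (rule z01[OF i])
      finally show ?thesis .
    next
      case False
      then show ?thesis using u_nonneg z01[OF i] by (auto simp: w_def)
    qed
    then have "(\<Sum>i<q. w (J i)) \<le> (\<Sum>i<q. u (z i))" by (intro sum_mono) simp
    moreover have "(\<Sum>i<q. w (J i)) = (\<Sum>j<q. w j)" by (rule reindex)
    moreover have "(\<Sum>j<q. w j) = (\<Sum>j\<in>{1..<q - 4}. H (j + 2) - H (Suc (j + 2)))"
      by (rule sum.mono_neutral_cong_right) (auto simp: w_def)
    moreover have "(\<Sum>j\<in>{1..<q - 4}. H (j + 2) - H (Suc (j + 2))) = H 3 - H (q - 2)"
    proof -
      have "q - 4 + 2 = q - 2" using q by simp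
      then show ?thesis
        using sum_Suc_diff'[of 1 "q - 4" "\<lambda>j. - H (j + 2)"] q by (simp add: eval_nat_numeral)
    qed
    moreover have "H (q - 2) \<le> Q * h (1 / 2)"
      unfolding H_def using q Q by (intro mult_left_mono h_antimono) (auto simp: Q_def of_nat_diff field_simps)
    moreover have "Q * h (1 / (2 * Q)) - 3 * u \<tau> \<le> H 3"
    proof -
      have "h (1 / (2 * Q)) - h (3 / Q) \<le> (3 / Q - 1 / (2 * Q)) * u (1 / (2 * Q))"
        using Q by (intro h_mvt) (auto simp: field_simps)
      also have "\<dots> \<le> (3 / Q - 1 / (2 * Q)) * u \<tau>"
        using Q \<tau> by (intro mult_left_mono u_antimono) (auto simp: field_simps Q_def[symmetric])
      also have "\<dots> \<le> 3 / Q * u \<tau>"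
      proof (rule mult_right_mono[OF _ u\<tau>])
        have "0 \<le> 1 / (2 * Q)" using Q by simp
        then show "3 / Q - 1 / (2 * Q) \<le> 3 / Q" by linarith
      qed
      finally have "h (1 / (2 * Q)) - h (3 / Q) \<le> 3 / Q * u \<tau>" .
      then have "Q * (h (1 / (2 * Q)) - h (3 / Q)) \<le> Q * (3 / Q * u \<tau>)" using Q by (intro mult_left_mono) auto
      then show ?thesis using Q by (simp add: H_def algebra_simps)
    qed
    ultimately show ?thesis by linarith
  qed
  have "0 \<le> Q * h (1 / 2)" using Q h_pos[of "1/2"] by (intro mult_nonneg_nonneg) auto
  then show ?thesis using upper lower u\<tau> unfolding Q_def[symmetric] z_def[symmetric] by (intro abs_leI) linarith+
qed

end

section \<open>The derivative near the singularities\<close>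

locale singular_function = singularity h for h :: "real \<Rightarrow> real" +
  fixes f :: "real \<Rightarrow> real" and k :: nat and a A B :: "nat \<Rightarrow> real"
  assumes periodic: "circle_function f" and sing: "has_singularities h f k a A B"
    and a_circle: "a ` {1..k} \<subseteq> {0..<1}" and inj_a: "inj_on a {1..k}"
begin

definition regular :: "real \<Rightarrow> bool" where "regular x \<longleftrightarrow> (\<forall>i\<in>{1..k}. x - a i \<notin> \<int>)"

lemma a_range: "i \<in> {1..k} \<Longrightarrow> 0 \<le> a i \<and> a i < 1"
  using a_circle by (meson atLeastLessThan_iff image_subset_iff)

lemma regular_iff: "regular x \<longleftrightarrow> frac x \<notin> a ` {1..k}"
proof -
  have "x - a i \<in> \<int> \<longleftrightarrow> frac x = a i" if "i \<in> {1..k}" for i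
    using a_range[OF that] by (simp add: frac_unique_iff)
  then show ?thesis unfolding regular_def by (metis (no_types, lifting) image_iff)
qed

lemma regular_frac: "regular x \<longleftrightarrow> regular (frac x)"
  by (simp add: regular_iff)

lemma f_has_deriv: "regular x \<Longrightarrow> (f has_real_derivative deriv f x) (at x)"
  using sing unfolding has_singularities_def C2_on_def regular_iff
  by (auto simp: DERIV_deriv_iff_real_differentiable)

lemma deriv_f_cont: "regular x \<Longrightarrow> isCont (deriv f) x"
  using sing unfolding has_singularities_def C2_on_def regular_iff
  by (auto intro: differentiable_imp_continuous_within)

lemma deriv_f_periodic1: "deriv f (x + 1) = deriv f x"
proof -
  have "(\<lambda>y. f (y + 1)) = f" using periodic by (auto simp: circle_function_def)
  then have "DERIV f (x + 1) :> D \<longleftrightarrow> DERIV f x :> D" for D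
    using DERIV_shift[of f D x 1] by simp
  then show ?thesis by (simp add: deriv_def)
qed

lemma deriv_f_periodic: "deriv f (x + of_int n) = deriv f x"
proof -
  have nat: "deriv f (x + real m) = deriv f x" for m x
  proof (induction m)
    case (Suc m)
    have "x + real (Suc m) = x + real m + 1" by simp
    then show ?case using Suc deriv_f_periodic1[of "x + real m"] by (simp only:)
  qed simp
  show ?thesis
  proof (cases "n \<ge> 0")
    case True then show ?thesis using nat[of x "nat n"] by simp
  next
    case False then show ?thesis using nat[of "x + of_int n" "nat (- n)"] by simp
  qed
qed

lemma deriv_f_frac: "deriv f (frac x) = deriv f x"
  using deriv_f_periodic[of x "- \<lfloor>x\<rfloor>"] by (simp add: frac_def)

text \<open>
  The error terms are measured in units of \<open>U\<close>. The signs in the leading part of \<open>f'\<close> differ on the two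
  sides of a singularity, because \<open>f'\<close> behaves like \<open>A h'(z - a)\<close> on the right and like
  \<open>- B h'(a - z)\<close> on the left.
\<close>

definition U :: "real \<Rightarrow> real" where
  "U z = (\<Sum>i\<in>{1..k}. u (frac (z - a i)) + u (frac (a i - z)))"

definition leading :: "real \<Rightarrow> real" where
  "leading z = (\<Sum>i\<in>{1..k}. B i * u (frac (a i - z)) - A i * u (frac (z - a i)))"

lemma frac_regular:
  assumes "regular z" "i \<in> {1..k}"
  shows "0 < frac (z - a i)" "frac (z - a i) < 1" "0 < frac (a i - z)" "frac (a i - z) < 1"
proof -
  have 1: "z - a i \<notin> \<int>" using assms by (simp add: regular_def)
  then have "a i - z \<notin> \<int>" using Ints_minus[of "a i - z"] by auto
  then show "0 < frac (z - a i)" "frac (z - a i) < 1" "0 < frac (a i - z)" "frac (a i - z) < 1"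
    using 1 by (simp_all add: frac_lt_1 frac_gt_0_iff)
qed

lemma AB_nonneg: "i \<in> {1..k} \<Longrightarrow> 0 \<le> A i" "i \<in> {1..k} \<Longrightarrow> 0 \<le> B i"
  using sing by (auto simp: has_singularities_def)

lemma u_bounded_off_singularity:
  assumes c: "c - b \<notin> \<int>"
  obtains \<delta> K where "\<delta> > 0" "K \<ge> 0" "\<And>z. \<bar>z - c\<bar> < \<delta> \<Longrightarrow>
    z - b \<notin> \<int> \<and> 0 \<le> u (frac (z - b)) \<and> u (frac (z - b)) \<le> K \<and> 0 \<le> u (frac (b - z)) \<and> u (frac (b - z)) \<le> K"
proof -
  define r where "r = frac (c - b)"
  have r: "0 < r" "r < 1" using c by (auto simp: r_def frac_lt_1)
  define \<delta> where "\<delta> = min r (1 - r) / 2"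
  have \<delta>: "0 < \<delta>" "2 * \<delta> \<le> r" "2 * \<delta> \<le> 1 - r" "\<delta> < 1" using r by (auto simp: \<delta>_def)
  show thesis
  proof (rule that[of \<delta> "u \<delta>"])
    fix z assume z: "\<bar>z - c\<bar> < \<delta>"
    define w where "w = r + (z - c)"
    have w: "\<delta> \<le> w" "w \<le> 1 - \<delta>" using z \<delta> by (auto simp: w_def)
    have eq: "z - b = w + of_int \<lfloor>c - b\<rfloor>" by (simp add: w_def r_def frac_def)
    have f1: "frac (z - b) = w" unfolding eq using w \<delta> by (simp add: frac_eq)
    have nI: "z - b \<notin> \<int>" using f1 w \<delta> by (metis frac_eq_0_iff not_less order_less_le_trans less_irrefl)
    have f2: "frac (b - z) = 1 - w"
      using frac_neg[of "z - b"] nI f1 by simp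
    show "z - b \<notin> \<int> \<and> 0 \<le> u (frac (z - b)) \<and> u (frac (z - b)) \<le> u \<delta> \<and> 0 \<le> u (frac (b - z)) \<and> u (frac (b - z)) \<le> u \<delta>"
      unfolding f1 f2 using w \<delta> nI by (auto intro!: u_nonneg u_antimono)
  qed (use \<delta> in \<open>auto intro: u_nonneg\<close>)
qed

definition locally_close :: "real \<Rightarrow> real \<Rightarrow> bool" where
  "locally_close \<epsilon> c \<longleftrightarrow> (\<exists>\<delta>>0. \<exists>K\<ge>0. \<forall>z. \<bar>z - c\<bar> < \<delta> \<and> regular z \<longrightarrow> \<bar>deriv f z - leading z\<bar> \<le> K + \<epsilon> * U z)"

lemma locally_closeI:
  "0 < \<delta> \<Longrightarrow> 0 \<le> K \<Longrightarrow> (\<And>z. \<bar>z - c\<bar> < \<delta> \<and> regular z \<Longrightarrow> \<bar>deriv f z - leading z\<bar> \<le> K + \<epsilon> * U z) \<Longrightarrow> locally_close \<epsilon> c"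
  unfolding locally_close_def by blast

lemma U_ge:
  assumes "regular z" "i \<in> {1..k}"
  shows "u (frac (z - a i)) \<le> U z" "u (frac (a i - z)) \<le> U z" "0 \<le> U z"
proof -
  have nn: "0 \<le> u (frac (z - a j))" "0 \<le> u (frac (a j - z))" if "j \<in> {1..k}" for j
    using frac_regular[OF assms(1) that] by (auto intro: u_nonneg)
  have "u (frac (z - a i)) + u (frac (a i - z)) \<le> U z"
    unfolding U_def using assms(2) nn by (intro member_le_sum) (auto intro: add_nonneg_nonneg)
  then show "u (frac (z - a i)) \<le> U z" "u (frac (a i - z)) \<le> U z" "0 \<le> U z" using nn[OF assms(2)] by linarith+
qed

lemma U_nonneg: "regular z \<Longrightarrow> 0 \<le> U z"
  unfolding U_def using frac_regular by (intro sum_nonneg add_nonneg_nonneg u_nonneg)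

lemma far_part_bounded:
  assumes "I \<subseteq> {1..k}" "\<And>i. i \<in> I \<Longrightarrow> c - a i \<notin> \<int>"
  obtains \<delta> K where "\<delta> > 0" "K \<ge> 0" "\<And>z. \<bar>z - c\<bar> < \<delta> \<Longrightarrow>
    \<bar>\<Sum>i\<in>I. B i * u (frac (a i - z)) - A i * u (frac (z - a i))\<bar> \<le> K"
proof -
  have "\<forall>i\<in>I. \<exists>\<delta>>0. \<exists>K\<ge>0. \<forall>z. \<bar>z - c\<bar> < \<delta> \<longrightarrow> 
    0 \<le> u (frac (z - a i)) \<and> u (frac (z - a i)) \<le> K \<and> 0 \<le> u (frac (a i - z)) \<and> u (frac (a i - z)) \<le> K"
  proof
    fix i assume "i \<in> I"
    from u_bounded_off_singularity[OF assms(2)[OF this]] 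
    show "\<exists>\<delta>>0. \<exists>K\<ge>0. \<forall>z. \<bar>z - c\<bar> < \<delta> \<longrightarrow> 
      0 \<le> u (frac (z - a i)) \<and> u (frac (z - a i)) \<le> K \<and> 0 \<le> u (frac (a i - z)) \<and> u (frac (a i - z)) \<le> K"
      by metis
  qed
  then obtain d K where dK: "\<And>i. i \<in> I \<Longrightarrow> d i > 0 \<and> K i \<ge> 0 \<and> (\<forall>z. \<bar>z - c\<bar> < d i \<longrightarrow> 
    0 \<le> u (frac (z - a i)) \<and> u (frac (z - a i)) \<le> K i \<and> 0 \<le> u (frac (a i - z)) \<and> u (frac (a i - z)) \<le> K i)"
    by metis
  have fin: "finite I" using assms(1) finite_subset by blast
  define \<delta> where "\<delta> = Min (insert 1 (d ` I))"
  have \<delta>: "\<delta> > 0" "\<And>i. i \<in> I \<Longrightarrow> \<delta> \<le> d i" using fin dK by (auto simp: \<delta>_def)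
  show thesis
  proof (rule that[of \<delta> "\<Sum>i\<in>I. (B i + A i) * K i"])
    show "0 \<le> (\<Sum>i\<in>I. (B i + A i) * K i)" using dK AB_nonneg assms(1) by (intro sum_nonneg mult_nonneg_nonneg add_nonneg_nonneg) auto
    fix z assume z: "\<bar>z - c\<bar> < \<delta>"
    have "\<bar>B i * u (frac (a i - z)) - A i * u (frac (z - a i))\<bar> \<le> (B i + A i) * K i" if i: "i \<in> I" for i
    proof -
      have *: "0 \<le> u (frac (z - a i)) \<and> u (frac (z - a i)) \<le> K i \<and> 0 \<le> u (frac (a i - z)) \<and> u (frac (a i - z)) \<le> K i"
        using dK[OF i] z \<delta>(2)[OF i] by auto
      have AB: "0 \<le> A i" "0 \<le> B i" using AB_nonneg assms(1) i by auto
      have "0 \<le> B i * u (frac (a i - z))" "B i * u (frac (a i - z)) \<le> B i * K i"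
        "0 \<le> A i * u (frac (z - a i))" "A i * u (frac (z - a i)) \<le> A i * K i"
        using * AB by (auto intro: mult_left_mono)
      then show ?thesis by (simp add: abs_le_iff algebra_simps)
    qed
    then show "\<bar>\<Sum>i\<in>I. B i * u (frac (a i - z)) - A i * u (frac (z - a i))\<bar> \<le> (\<Sum>i\<in>I. (B i + A i) * K i)"
      by (intro order.trans[OF sum_abs] sum_mono)
  qed (use \<delta> in auto)
qed

lemma locally_close_regular:
  assumes "regular c" "\<epsilon> > 0"
  shows "locally_close \<epsilon> c"
proof -
  obtain d1 K1 where 1: "d1 > 0" "K1 \<ge> 0" "\<And>z. \<bar>z - c\<bar> < d1 \<Longrightarrow> \<bar>leading z\<bar> \<le> K1"
    unfolding leading_def using far_part_bounded[of "{1..k}" c] assms by (auto simp: regular_def)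
  obtain d2 where 2: "d2 > 0" "\<And>z. \<bar>z - c\<bar> < d2 \<Longrightarrow> \<bar>deriv f z - deriv f c\<bar> < 1"
    using deriv_f_cont[OF assms(1)] unfolding continuous_at_eps_delta dist_real_def
    by (metis zero_less_one)
  show ?thesis
  proof (rule locally_closeI[of "min d1 d2" "\<bar>deriv f c\<bar> + 1 + K1"])
    fix z assume z: "\<bar>z - c\<bar> < min d1 d2 \<and> regular z"
    then have "\<bar>leading z\<bar> \<le> K1" "\<bar>deriv f z - deriv f c\<bar> < 1" "0 \<le> \<epsilon> * U z"
      using 1 2 U_nonneg[of z] assms by auto
    then show "\<bar>deriv f z - leading z\<bar> \<le> \<bar>deriv f c\<bar> + 1 + K1 + \<epsilon> * U z" by linarith
  qed (use 1 2 in auto)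
qed

lemma close_near_singularity:
  assumes i: "i \<in> {1..k}" and \<epsilon>: "\<epsilon> > 0"
  obtains \<delta> where "0 < \<delta>" "\<delta> < 1 / 2"
    "\<And>x. a i < x \<Longrightarrow> x < a i + \<delta> \<Longrightarrow> \<bar>deriv f x + A i * u (x - a i)\<bar> \<le> \<epsilon> * u (x - a i)"
    "\<And>x. a i - \<delta> < x \<Longrightarrow> x < a i \<Longrightarrow> \<bar>deriv f x - B i * u (a i - x)\<bar> \<le> \<epsilon> * u (a i - x)"
proof -
  have r: "((\<lambda>x. deriv f x / deriv h (x - a i)) \<longlongrightarrow> A i) (at_right (a i))"
    and l: "((\<lambda>x. deriv f x / deriv h (a i - x)) \<longlongrightarrow> - B i) (at_left (a i))"
    using sing i by (auto simp: has_singularities_def)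
  obtain d0 where d0: "0 < d0" "d0 < 1" "\<And>x. 0 < x \<Longrightarrow> x < d0 \<Longrightarrow> u x > 0" by (rule u_pos_near_0) blast
  have "\<forall>\<^sub>F x in at_right (a i). dist (deriv f x / deriv h (x - a i)) (A i) < \<epsilon>" using r \<epsilon> by (rule tendstoD)
  then obtain b1 where b1: "b1 > a i" "\<And>x. a i < x \<Longrightarrow> x < b1 \<Longrightarrow> \<bar>deriv f x / deriv h (x - a i) - A i\<bar> < \<epsilon>"
    unfolding eventually_at_right_field dist_real_def by blast
  have "\<forall>\<^sub>F x in at_left (a i). dist (deriv f x / deriv h (a i - x)) (- B i) < \<epsilon>" using l \<epsilon> by (rule tendstoD)
  then obtain b2 where b2: "b2 < a i" "\<And>x. b2 < x \<Longrightarrow> x < a i \<Longrightarrow> \<bar>deriv f x / deriv h (a i - x) + B i\<bar> < \<epsilon>"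
    unfolding eventually_at_left_field dist_real_def by auto
  define \<delta> where "\<delta> = min (1/4) (min d0 (min (b1 - a i) (a i - b2)))"
  have quot: "\<bar>y + C * v\<bar> \<le> \<epsilon> * v" if "\<bar>y / (- v) - C\<bar> < \<epsilon>" "v > 0" for y C v :: real
  proof -
    have "y + C * v = - v * (y / (- v) - C)" using that by (simp add: field_simps)
    then have "\<bar>y + C * v\<bar> = v * \<bar>y / (- v) - C\<bar>" using that by (simp add: abs_mult)
    also have "\<dots> \<le> v * \<epsilon>" using that by (intro mult_left_mono) auto
    finally show ?thesis by (simp add: mult.commute)
  qed
  show thesis
  proof (rule that[of \<delta>])
    have "\<delta> \<le> 1 / 4" unfolding \<delta>_def by (rule min.cobounded1)
    then show "0 < \<delta>" "\<delta> < 1 / 2" using d0 b1 b2 by (auto simp: \<delta>_def)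
    show "\<bar>deriv f x + A i * u (x - a i)\<bar> \<le> \<epsilon> * u (x - a i)" if "a i < x" "x < a i + \<delta>" for x
      using that b1(2)[of x] d0(3)[of "x - a i"] by (intro quot) (auto simp: \<delta>_def u_def)
    show "\<bar>deriv f x - B i * u (a i - x)\<bar> \<le> \<epsilon> * u (a i - x)" if "a i - \<delta> < x" "x < a i" for x
      using that b2(2)[of x] d0(3)[of "a i - x"] quot[of "deriv f x" "u (a i - x)" "- B i"]
      by (auto simp: \<delta>_def u_def)
  qed
qed

text \<open>
  Near \<open>a i\<close> only the \<open>i\<close>-th terms of the leading part are unbounded, and of these only the one that
  belongs to the side of \<open>z\<close>; it is compared with \<open>f'\<close> by the definition of \<open>A i\<close> and \<open>B i\<close>.
\<close>

lemma locally_close_singular: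
  assumes i: "i \<in> {1..k}" and \<epsilon>: "\<epsilon> > 0"
  shows "locally_close \<epsilon> (a i)"
proof -
  have others: "a i - a j \<notin> \<int>" if "j \<in> {1..k} - {i}" for j
  proof
    assume "a i - a j \<in> \<int>"
    then obtain n where n: "a i - a j = of_int n" by (auto elim: Ints_cases)
    have "0 \<le> a i \<and> a i < 1" "0 \<le> a j \<and> a j < 1" using a_range i that by auto
    then have "-1 < real_of_int n" "real_of_int n < 1" using n by auto
    then have "n = 0" by linarith
    then have "a i = a j" using n by simp
    then have "i = j" using inj_onD[OF inj_a] i that by blast
    then show False using that by blast
  qed
  obtain d1 K1 where 1: "d1 > 0" "K1 \<ge> 0"
    "\<And>z. \<bar>z - a i\<bar> < d1 \<Longrightarrow> \<bar>\<Sum>j\<in>{1..k} - {i}. B j * u (frac (a j - z)) - A j * u (frac (z - a j))\<bar> \<le> K1"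
    using far_part_bounded[of "{1..k} - {i}" "a i"] others by auto
  obtain d2 where d2: "0 < d2" "d2 < 1 / 2"
    "\<And>x. a i < x \<Longrightarrow> x < a i + d2 \<Longrightarrow> \<bar>deriv f x + A i * u (x - a i)\<bar> \<le> \<epsilon> * u (x - a i)"
    "\<And>x. a i - d2 < x \<Longrightarrow> x < a i \<Longrightarrow> \<bar>deriv f x - B i * u (a i - x)\<bar> \<le> \<epsilon> * u (a i - x)"
    using close_near_singularity[OF i \<epsilon>] by blast
  have AB: "0 \<le> A i" "0 \<le> B i" using AB_nonneg i by auto
  define K where "K = K1 + (A i + B i) * u (1/2)"
  show ?thesis
  proof (rule locally_closeI[of "min d1 d2" K])
    show "K \<ge> 0" unfolding K_def using 1 AB u_nonneg[of "1/2"] by (intro add_nonneg_nonneg mult_nonneg_nonneg) auto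
    fix z assume z: "\<bar>z - a i\<bar> < min d1 d2 \<and> regular z"
    then have "z - a i \<notin> \<int>" using i unfolding regular_def by blast
    then have ne: "z \<noteq> a i" by auto
    define rest where "rest = (\<Sum>j\<in>{1..k} - {i}. B j * u (frac (a j - z)) - A j * u (frac (z - a j)))"
    have lead: "leading z = B i * u (frac (a i - z)) - A i * u (frac (z - a i)) + rest"
      unfolding leading_def rest_def using i by (subst sum.remove[of _ i]) auto
    have rest: "\<bar>rest\<bar> \<le> K1" unfolding rest_def using 1(3) z by auto
    consider "a i < z" "z < a i + d2" | "a i - d2 < z" "z < a i" using z ne by (auto simp: abs_less_iff) linarith
    then show "\<bar>deriv f z - leading z\<bar> \<le> K + \<epsilon> * U z"
    proof cases
      case 1
      have f1: "frac (z - a i) = z - a i" using 1 d2 by (simp add: frac_eq)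
      have f2: "frac (a i - z) = 1 - (z - a i)" using 1 d2 by (auto simp: frac_unique_iff)
      have "u (frac (a i - z)) \<le> u (1/2)" "0 \<le> u (frac (a i - z))"
        unfolding f2 using 1 d2 by (auto intro!: u_antimono u_nonneg)
      then have b: "0 \<le> B i * u (frac (a i - z))" "B i * u (frac (a i - z)) \<le> B i * u (1/2)" "0 \<le> A i * u (1/2)"
        using AB u_nonneg[of "1/2"] by (auto intro: mult_left_mono)
      have "\<epsilon> * u (frac (z - a i)) \<le> \<epsilon> * U z" using U_ge[of z i] z i \<epsilon> by (intro mult_left_mono) auto
      then show ?thesis using d2(3)[OF 1] rest b unfolding lead K_def f1 by (simp add: algebra_simps abs_le_iff)
    next
      case 2
      have f1: "frac (a i - z) = a i - z" using 2 d2 by (simp add: frac_eq)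
      have f2: "frac (z - a i) = 1 - (a i - z)" using 2 d2 by (auto simp: frac_unique_iff)
      have "u (frac (z - a i)) \<le> u (1/2)" "0 \<le> u (frac (z - a i))"
        unfolding f2 using 2 d2 by (auto intro!: u_antimono u_nonneg)
      then have b: "0 \<le> A i * u (frac (z - a i))" "A i * u (frac (z - a i)) \<le> A i * u (1/2)" "0 \<le> B i * u (1/2)"
        using AB u_nonneg[of "1/2"] by (auto intro: mult_left_mono)
      have "\<epsilon> * u (frac (a i - z)) \<le> \<epsilon> * U z" using U_ge[of z i] z i \<epsilon> by (intro mult_left_mono) auto
      then show ?thesis using d2(4)[OF 2] rest b unfolding lead K_def f1 by (simp add: algebra_simps abs_le_iff)
    qed
  qed (use 1 d2 in auto)
qed

lemma leading_frac: "leading (frac z) = leading z" and U_frac: "U (frac z) = U z"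
proof -
  have "frac (b - frac z) = frac (b - z)" for b
  proof -
    have "b - frac z = b - z + of_int \<lfloor>z\<rfloor>" by (simp add: frac_def)
    then have "frac (b - frac z) = frac (b - z + of_int \<lfloor>z\<rfloor>)" by (simp only:)
    then show ?thesis by simp
  qed
  then show "leading (frac z) = leading z" "U (frac z) = U z" by (simp_all add: leading_def U_def)
qed

lemma locally_close_shift:
  assumes "locally_close \<epsilon> c"
  shows "locally_close \<epsilon> (c + of_int n)"
proof -
  obtain \<delta> K where 1: "\<delta> > 0" "K \<ge> 0" "\<And>z. \<bar>z - c\<bar> < \<delta> \<Longrightarrow> regular z \<Longrightarrow> \<bar>deriv f z - leading z\<bar> \<le> K + \<epsilon> * U z"
    using assms unfolding locally_close_def by blast
  show ?thesis
  proof (rule locally_closeI[OF 1(1,2)])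
    fix z assume z: "\<bar>z - (c + of_int n)\<bar> < \<delta> \<and> regular z"
    define w where "w = z - of_int n"
    have fw: "frac w = frac z" by (simp add: w_def frac_def)
    have "regular w" using z regular_frac[of w] regular_frac[of z] fw by simp
    moreover have "\<bar>w - c\<bar> < \<delta>" using z by (simp add: w_def algebra_simps)
    ultimately have "\<bar>deriv f w - leading w\<bar> \<le> K + \<epsilon> * U w" using 1 by blast
    then show "\<bar>deriv f z - leading z\<bar> \<le> K + \<epsilon> * U z"
      using fw deriv_f_frac[of w] deriv_f_frac[of z] leading_frac[of w] leading_frac[of z] U_frac[of w] U_frac[of z] by simp
  qed
qed

text \<open>
  A compactness argument: finitely many of the neighbourhoods on which the local estimates hold cover a
  period.
\<close>

lemma deriv_f_asymptotic:
  assumes \<epsilon>: "\<epsilon> > 0"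
  obtains K where "K \<ge> 0" "\<And>z. regular z \<Longrightarrow> \<bar>deriv f z - leading z\<bar> \<le> K + \<epsilon> * U z"
proof -
  have loc: "locally_close \<epsilon> c" for c
  proof (cases "regular c")
    case False
    then obtain i where i: "i \<in> {1..k}" "frac c = a i" by (auto simp: regular_iff)
    then have "c = a i + of_int \<lfloor>c\<rfloor>" by (simp add: frac_def algebra_simps)
    then show ?thesis using locally_close_shift[OF locally_close_singular[OF i(1) \<epsilon>]] by metis
  qed (use locally_close_regular \<epsilon> in blast)
  then obtain d K where dK: "\<And>c. d c > 0 \<and> K c \<ge> 0 \<and> (\<forall>z. \<bar>z - c\<bar> < d c \<and> regular z \<longrightarrow> \<bar>deriv f z - leading z\<bar> \<le> K c + \<epsilon> * U z)"
    unfolding locally_close_def by metis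
  have "{0..1::real} \<subseteq> (\<Union>c\<in>{0..1}. ball c (d c))" using dK by (auto intro: centre_in_ball[THEN iffD2])
  then obtain C where C: "C \<subseteq> {0..1}" "finite C" "{0..1} \<subseteq> (\<Union>c\<in>C. ball c (d c))"
    using compactE_image[of "{0..1::real}" "{0..1}" "\<lambda>c. ball c (d c)"] by auto
  show thesis
  proof (rule that[of "\<Sum>c\<in>C. K c"])
    show "0 \<le> (\<Sum>c\<in>C. K c)" using dK by (intro sum_nonneg) auto
    fix z assume z: "regular z"
    have "frac z \<in> {0..1}" by (simp add: frac_lt_1 less_imp_le)
    then have "frac z \<in> (\<Union>c\<in>C. ball c (d c))" using C(3) by blast
    then obtain c where c: "c \<in> C" "\<bar>frac z - c\<bar> < d c" by (auto simp: dist_real_def abs_minus_commute)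
    then have "\<bar>deriv f (frac z) - leading (frac z)\<bar> \<le> K c + \<epsilon> * U (frac z)"
      using dK z regular_frac[of z] by blast
    moreover have "K c \<le> (\<Sum>c\<in>C. K c)" using c C dK by (intro member_le_sum) auto
    ultimately show "\<bar>deriv f z - leading z\<bar> \<le> (\<Sum>c\<in>C. K c) + \<epsilon> * U z"
      by (simp add: deriv_f_frac leading_frac U_frac)
  qed
qed

text \<open>
  The estimates for the sum of \<open>f'\<close> over a block of length \<open>q\<close> in the form in which they are used below:
  the block keeps distance \<open>\<tau>\<close> from all singularities on both sides, and \<open>u \<tau>\<close> is small compared with
  \<open>q h(1 / (2 q))\<close>.
\<close>

definition block_estimate :: "real \<Rightarrow> real \<Rightarrow> real \<Rightarrow> nat \<Rightarrow> real \<Rightarrow> bool" where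
  "block_estimate c0 V0 \<omega> q0 \<sigma> \<longleftrightarrow> (\<forall>q p \<beta> \<tau> \<theta>. q \<ge> q0 \<longrightarrow> coprime p (int q) \<longrightarrow> \<bar>real q * \<beta> - of_int p\<bar> \<le> 1 / real q
     \<longrightarrow> 0 < \<tau> \<longrightarrow> \<tau> \<le> 1 / (2 * real q) \<longrightarrow> u \<tau> \<le> \<omega> * (real q * h (1 / (2 * real q)))
     \<longrightarrow> (\<forall>i\<in>{1..k}. \<forall>j<q. \<tau> \<le> frac (\<theta> + real j * \<beta> - a i) \<and> \<tau> \<le> frac (a i - (\<theta> + real j * \<beta>)))
     \<longrightarrow> c0 * (real q * h (1 / (2 * real q))) \<le> \<sigma> * (\<Sum>j<q. deriv f (\<theta> + real j * \<beta>))
        \<and> (\<Sum>j<q. \<bar>deriv f (\<theta> + real j * \<beta>)\<bar>) \<le> V0 * (real q * h (1 / (2 * real q))))"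

text \<open>
  Replace \<open>f'\<close> by its leading part and sum \<open>u\<close> along the block with \<open>block_sum_u\<close>, for the rotation by
  \<open>\<alpha>\<close> on the right of the singularities and by \<open>- \<alpha>\<close> on the left. With \<open>H = q h(1 / (2 q))\<close>, the sum
  of \<open>f'\<close> is \<open>(SB - SA) H\<close> up to an error that is at most half of its modulus \<open>D H\<close>.
\<close>

lemma block_derivative:
  assumes AB: "(\<Sum>i\<in>{1..k}. A i) \<noteq> (\<Sum>i\<in>{1..k}. B i)"
  obtains c0 V0 \<omega> q0 \<sigma> where "c0 > 0" "\<omega> > 0" "\<sigma> \<in> {1, -1}" "block_estimate c0 V0 \<omega> q0 \<sigma>"
proof -
  define SA where "SA = (\<Sum>i\<in>{1..k}. A i)"
  define SB where "SB = (\<Sum>i\<in>{1..k}. B i)"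
  have SAB: "0 \<le> SA" "0 \<le> SB" unfolding SA_def SB_def using AB_nonneg by (auto intro: sum_nonneg)
  define D where "D = \<bar>SB - SA\<bar>"
  have D: "D > 0" using AB by (simp add: D_def SA_def SB_def)
  define \<sigma> :: real where "\<sigma> = (if SB > SA then 1 else -1)"
  have \<sigma>: "\<sigma> \<in> {1, -1}" "\<sigma> * (SB - SA) = D" "\<bar>\<sigma>\<bar> = 1" using AB by (auto simp: \<sigma>_def D_def)
  \<comment> \<open>the constants make both parts of the error at most \<open>D H / 4\<close>\<close>
  define \<epsilon> where "\<epsilon> = D / (16 * (real k + 1))"
  have \<epsilon>: "\<epsilon> > 0" "4 * real k * \<epsilon> \<le> D / 4" using D by (auto simp: \<epsilon>_def field_simps)
  obtain K where K: "K \<ge> 0" "\<And>z. regular z \<Longrightarrow> \<bar>deriv f z - leading z\<bar> \<le> K + \<epsilon> * U z"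
    using deriv_f_asymptotic[OF \<epsilon>(1)] by blast
  define \<omega> where "\<omega> = min (1 / 5) (D / (4 * (5 * (SA + SB) + 1)))"
  have den: "5 * (SA + SB) + 1 > 0" using SAB by simp
  have \<omega>: "\<omega> > 0" "5 * \<omega> \<le> 1" using den D by (auto simp: \<omega>_def)
  have \<omega>D: "\<omega> * (5 * (SA + SB) + 1) \<le> D / 4"
  proof -
    have "\<omega> \<le> D / (4 * (5 * (SA + SB) + 1))" unfolding \<omega>_def by (rule min.cobounded2)
    then show ?thesis using den by (simp add: field_simps)
  qed
  obtain \<delta> where \<delta>: "0 < \<delta>" "\<delta> < 1" "\<And>x. 0 < x \<Longrightarrow> x < \<delta> \<Longrightarrow> h x > (K + h (1/2)) / \<omega>"
    by (rule h_large) blast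
  obtain N :: nat where N: "1 / \<delta> < real N" using reals_Archimedean2 by blast
  define q0 where "q0 = max 6 N"
  show thesis
  proof (rule that[of "D / 2" \<omega> \<sigma> "2 * (SA + SB) + D / 2" q0])
    show "block_estimate (D / 2) (2 * (SA + SB) + D / 2) \<omega> q0 \<sigma>"
      unfolding block_estimate_def
    proof (intro allI impI)
      fix q :: nat and p :: int and \<alpha> \<tau> \<theta> :: real
      assume q: "q \<ge> q0" and cop: "coprime p (int q)" and ap: "\<bar>real q * \<alpha> - of_int p\<bar> \<le> 1 / real q"
        and \<tau>: "0 < \<tau>" "\<tau> \<le> 1 / (2 * real q)" and u\<tau>: "u \<tau> \<le> \<omega> * (real q * h (1 / (2 * real q)))"
        and far': "\<forall>i\<in>{1..k}. \<forall>j<q. \<tau> \<le> frac (\<theta> + real j * \<alpha> - a i) \<and> \<tau> \<le> frac (a i - (\<theta> + real j * \<alpha>))"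
      have far: "\<tau> \<le> frac (\<theta> + real j * \<alpha> - a i) \<and> \<tau> \<le> frac (a i - (\<theta> + real j * \<alpha>))"
        if "i \<in> {1..k}" "j < q" for i j using far' that by blast
      define H where "H = real q * h (1 / (2 * real q))"
      have q6: "q \<ge> 6" "real N \<le> real q" using q by (auto simp: q0_def)
      have hK: "K + h (1/2) \<le> \<omega> * h (1 / (2 * real q))"
      proof -
        have "1 / \<delta> < 2 * real q" using N q6 by simp
        then have "1 / (2 * real q) < \<delta>" using \<delta>(1) q6 by (simp add: field_simps)
        then have "h (1 / (2 * real q)) > (K + h (1/2)) / \<omega>" using q6 by (intro \<delta>) auto
        then show ?thesis using \<omega> by (simp add: field_simps)
      qed
      have H0: "0 \<le> H" unfolding H_def using q6 by (intro mult_nonneg_nonneg less_imp_le[OF h_pos]) (auto simp: field_simps)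
      have qK: "real q * K + real q * h (1/2) \<le> \<omega> * H"
      proof -
        have "real q * (K + h (1/2)) \<le> real q * (\<omega> * h (1 / (2 * real q)))" using hK by (intro mult_left_mono) auto
        then show ?thesis by (simp add: H_def algebra_simps)
      qed
      define E where "E = 4 * u \<tau> + real q * h (1/2)"
      have E: "E \<le> 5 * \<omega> * H" and qKH: "real q * K \<le> \<omega> * H"
      proof -
        have nn: "0 \<le> real q * K" "0 \<le> real q * h (1/2)" using K(1) h_pos[of "1/2"] by auto
        have "u \<tau> \<le> \<omega> * H" using u\<tau> unfolding H_def .
        moreover have "5 * \<omega> * H = 5 * (\<omega> * H)" by simp
        ultimately show "E \<le> 5 * \<omega> * H" "real q * K \<le> \<omega> * H" using qK nn unfolding E_def by linarith+
      qed
      have EH: "E \<le> H" using E \<omega>(2) H0 mult_right_mono[of "5 * \<omega>" 1 H] by simp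
      define z where "z j = \<theta> + real j * \<alpha>" for j
      define Sp where "Sp i = (\<Sum>j<q. u (frac (z j - a i)))" for i
      define Sm where "Sm i = (\<Sum>j<q. u (frac (a i - z j)))" for i
      have Sp: "\<bar>Sp i - H\<bar> \<le> E" if i: "i \<in> {1..k}" for i
      proof -
        have "\<bar>(\<Sum>j<q. u (frac ((\<theta> - a i) + real j * \<alpha>))) - real q * h (1 / (2 * real q))\<bar> \<le> 4 * u \<tau> + real q * h (1 / 2)"
        proof (rule block_sum_u[OF q6(1) cop ap \<tau>])
          show "\<tau> \<le> frac (\<theta> - a i + real j * \<alpha>)" if "j < q" for j
            using far[OF i that] by (simp add: algebra_simps)
        qed
        then show ?thesis by (simp add: Sp_def H_def E_def z_def algebra_simps)
      qed
      have Sm: "\<bar>Sm i - H\<bar> \<le> E" if i: "i \<in> {1..k}" for i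
      proof -
        have cop': "coprime (- p) (int q)" using cop by simp
        have ap': "\<bar>real q * (- \<alpha>) - of_int (- p)\<bar> \<le> 1 / real q" using ap by (simp add: abs_minus_commute)
        have eq: "a i - \<theta> + real j * (- \<alpha>) = a i - z j" for j by (simp add: z_def)
        have "\<bar>(\<Sum>j<q. u (frac ((a i - \<theta>) + real j * (- \<alpha>)))) - real q * h (1 / (2 * real q))\<bar> \<le> 4 * u \<tau> + real q * h (1 / 2)"
        proof (rule block_sum_u[OF q6(1) cop' ap' \<tau>])
          show "\<tau> \<le> frac (a i - \<theta> + real j * (- \<alpha>))" if "j < q" for j
            unfolding eq using far[OF i that] by (simp add: z_def)
        qed
        then show ?thesis unfolding eq by (simp add: Sm_def H_def E_def)
      qed
      have reg: "regular (z j)" if "j < q" for j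
        unfolding regular_def
      proof
        fix i assume "i \<in> {1..k}"
        then have "\<tau> \<le> frac (z j - a i)" using far[OF _ that, of i] unfolding z_def by blast
        then have "frac (z j - a i) \<noteq> 0" using \<tau> by linarith
        then show "z j - a i \<notin> \<int>" by (simp only: frac_eq_0_iff not_False_eq_True)
      qed
      have sumU: "(\<Sum>j<q. U (z j)) \<le> 4 * real k * H"
      proof -
        have "(\<Sum>j<q. U (z j)) = (\<Sum>i\<in>{1..k}. Sp i + Sm i)"
          unfolding U_def Sp_def Sm_def sum.distrib[symmetric] by (rule sum.swap)
        also have "\<dots> \<le> (\<Sum>i\<in>{1..k}. 4 * H)" using Sp Sm EH by (intro sum_mono) (force simp: abs_le_iff)
        finally show ?thesis by simp
      qed
      have sumG: "(\<Sum>j<q. leading (z j)) = (\<Sum>i\<in>{1..k}. B i * Sm i - A i * Sp i)"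
        unfolding leading_def Sp_def Sm_def sum_distrib_left sum_subtractf[symmetric] by (rule sum.swap)
      have err: "(\<Sum>j<q. \<bar>deriv f (z j) - leading (z j)\<bar>) \<le> \<omega> * H + D / 4 * H"
      proof -
        have "(\<Sum>j<q. \<bar>deriv f (z j) - leading (z j)\<bar>) \<le> (\<Sum>j<q. K + \<epsilon> * U (z j))"
          by (intro sum_mono K(2) reg) simp
        also have "\<dots> = real q * K + \<epsilon> * (\<Sum>j<q. U (z j))" by (simp add: sum.distrib sum_distrib_left)
        also have "\<dots> \<le> \<omega> * H + \<epsilon> * (4 * real k * H)" using \<epsilon> sumU qKH by (intro add_mono mult_left_mono) auto
        also have "\<epsilon> * (4 * real k * H) \<le> D / 4 * H" using \<epsilon>(2) H0 mult_right_mono[OF \<epsilon>(2) H0] by (simp add: algebra_simps)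
        finally show ?thesis by simp
      qed
      have main: "\<bar>(\<Sum>j<q. leading (z j)) - (SB - SA) * H\<bar> \<le> (SA + SB) * (5 * \<omega> * H)"
      proof -
        have "(\<Sum>j<q. leading (z j)) - (SB - SA) * H = (\<Sum>i\<in>{1..k}. B i * (Sm i - H) - A i * (Sp i - H))"
          unfolding sumG SA_def SB_def by (simp add: sum_subtractf algebra_simps sum.distrib flip: sum_distrib_left)
        also have "\<bar>\<dots>\<bar> \<le> (\<Sum>i\<in>{1..k}. (A i + B i) * E)"
        proof (intro order.trans[OF sum_abs] sum_mono)
          fix i assume i: "i \<in> {1..k}"
          have "\<bar>B i * (Sm i - H)\<bar> \<le> B i * E" "\<bar>A i * (Sp i - H)\<bar> \<le> A i * E"
            using Sm[OF i] Sp[OF i] AB_nonneg[OF i] by (auto simp: abs_mult intro: mult_left_mono)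
          then show "\<bar>B i * (Sm i - H) - A i * (Sp i - H)\<bar> \<le> (A i + B i) * E"
            by (simp add: algebra_simps)
        qed
        also have "\<dots> = (SA + SB) * E" by (simp add: SA_def SB_def sum.distrib algebra_simps flip: sum_distrib_left)
        also have "\<dots> \<le> (SA + SB) * (5 * \<omega> * H)" using E SAB by (intro mult_left_mono) auto
        finally show ?thesis .
      qed
      have total: "(SA + SB) * (5 * \<omega> * H) + (\<omega> * H + D / 4 * H) \<le> D / 2 * H"
        using mult_right_mono[OF \<omega>D H0] by (simp add: algebra_simps)
      have dev: "\<bar>(\<Sum>j<q. deriv f (z j)) - (SB - SA) * H\<bar> \<le> D / 2 * H"
      proof -
        have "\<bar>(\<Sum>j<q. deriv f (z j)) - (\<Sum>j<q. leading (z j))\<bar> \<le> (\<Sum>j<q. \<bar>deriv f (z j) - leading (z j)\<bar>)"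
          unfolding sum_subtractf[symmetric] by (rule sum_abs)
        then show ?thesis using err main total by linarith
      qed
      have low: "D / 2 * H \<le> \<sigma> * (\<Sum>j<q. deriv f (z j))"
      proof -
        have "\<bar>\<sigma> * (\<Sum>j<q. deriv f (z j)) - D * H\<bar> = \<bar>\<sigma> * ((\<Sum>j<q. deriv f (z j)) - (SB - SA) * H)\<bar>"
          unfolding \<sigma>(2)[symmetric] by (simp add: algebra_simps)
        also have "\<dots> \<le> D / 2 * H" using dev \<sigma>(3) by (simp only: abs_mult mult_1_left)
        finally have "D * H - \<sigma> * (\<Sum>j<q. deriv f (z j)) \<le> D / 2 * H" by linarith
        moreover have "D * H = D / 2 * H + D / 2 * H" by simp
        ultimately show ?thesis by linarith
      qed
      have up: "(\<Sum>j<q. \<bar>deriv f (z j)\<bar>) \<le> (2 * (SA + SB) + D / 2) * H"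
      proof -
        have "(\<Sum>j<q. \<bar>deriv f (z j)\<bar>) \<le> (\<Sum>j<q. \<bar>deriv f (z j) - leading (z j)\<bar> + \<bar>leading (z j)\<bar>)"
          by (intro sum_mono) linarith
        also have "\<dots> \<le> (\<omega> * H + D / 4 * H) + (\<Sum>j<q. \<bar>leading (z j)\<bar>)" using err by (simp add: sum.distrib)
        also have "(\<Sum>j<q. \<bar>leading (z j)\<bar>) \<le> (\<Sum>j<q. \<Sum>i\<in>{1..k}. B i * u (frac (a i - z j)) + A i * u (frac (z j - a i)))"
          unfolding leading_def
        proof (intro sum_mono order.trans[OF sum_abs])
          fix i j assume j: "j \<in> {..<q}" and i: "i \<in> {1..k}"
          have "0 \<le> B i * u (frac (a i - z j))" "0 \<le> A i * u (frac (z j - a i))"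
            using frac_regular[OF reg i, of j] j AB_nonneg[OF i] by (auto intro!: mult_nonneg_nonneg u_nonneg)
          then show "\<bar>B i * u (frac (a i - z j)) - A i * u (frac (z j - a i))\<bar> \<le> B i * u (frac (a i - z j)) + A i * u (frac (z j - a i))"
            by linarith
        qed
        also have "(\<Sum>j<q. \<Sum>i\<in>{1..k}. B i * u (frac (a i - z j)) + A i * u (frac (z j - a i))) = (\<Sum>i\<in>{1..k}. B i * Sm i + A i * Sp i)"
          unfolding Sp_def Sm_def sum_distrib_left sum.distrib[symmetric] by (rule sum.swap)
        also have "\<dots> \<le> (\<Sum>i\<in>{1..k}. B i * (2 * H) + A i * (2 * H))"
        proof (intro sum_mono add_mono mult_left_mono)
          fix i assume i: "i \<in> {1..k}"
          show "Sm i \<le> 2 * H" "Sp i \<le> 2 * H" using Sm[OF i] Sp[OF i] EH by linarith+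
          show "0 \<le> A i" "0 \<le> B i" using AB_nonneg[OF i] by auto
        qed
        also have "\<dots> = (SA + SB) * (2 * H)"
          unfolding SA_def SB_def sum.distrib sum_distrib_right[symmetric] by (simp only: distrib_right add.commute)
        finally have "(\<Sum>j<q. \<bar>deriv f (z j)\<bar>) \<le> (\<omega> * H + D / 4 * H) + (SA + SB) * (2 * H)" by simp
        moreover have "0 \<le> (SA + SB) * (5 * \<omega> * H)" using SAB \<omega> H0 by (intro mult_nonneg_nonneg) auto
        ultimately have "(\<Sum>j<q. \<bar>deriv f (z j)\<bar>) \<le> D / 2 * H + (SA + SB) * (2 * H)" using total by linarith
        also have "\<dots> = (2 * (SA + SB) + D / 2) * H" by (simp add: algebra_simps)
        finally show ?thesis .
      qed
      show "D / 2 * (real q * h (1 / (2 * real q))) \<le> \<sigma> * (\<Sum>j<q. deriv f (\<theta> + real j * \<alpha>))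
          \<and> (\<Sum>j<q. \<bar>deriv f (\<theta> + real j * \<alpha>)\<bar>) \<le> (2 * (SA + SB) + D / 2) * (real q * h (1 / (2 * real q)))"
        using low up unfolding H_def z_def by blast
    qed
  qed (use D \<omega> \<sigma> in auto)
qed

end

section \<open>Avoiding the singularities\<close>

lemma circle_norm_small: "\<bar>x\<bar> \<le> 1 / 2 \<Longrightarrow> circle_norm x = \<bar>x\<bar>"
proof -
  assume x: "\<bar>x\<bar> \<le> 1 / 2"
  obtain n where n: "circle_norm x = \<bar>x - of_int n\<bar>" by (rule circle_norm_attains)
  have "\<bar>x\<bar> \<le> \<bar>x - of_int n\<bar>"
  proof (cases "n = 0")
    case False
    then have "\<bar>real_of_int n\<bar> \<ge> 1" by linarith
    then show ?thesis using x by linarith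
  qed simp
  then show ?thesis using n circle_norm_le_abs[of x] by simp
qed

lemma circle_norm_le_frac: "circle_norm x \<le> frac x"
  using circle_norm_le[of x "\<lfloor>x\<rfloor>"] by (simp add: frac_def)

lemma circle_norm_frac: "circle_norm (frac x + y) = circle_norm (x + y)"
proof -
  have "frac x + y = x + y + of_int (- \<lfloor>x\<rfloor>)" by (simp add: frac_def)
  then show ?thesis by (simp only: circle_norm_add_int)
qed

lemma borel_measurable_circle_norm [measurable]: "circle_norm \<in> borel_measurable borel"
  unfolding circle_norm_def[abs_def] by (intro borel_measurable_continuous_onI continuous_intros)

lemma measure_circle_norm_le:
  assumes "\<rho> \<ge> 0"
  shows "measure circle {y\<in>{0..<1}. circle_norm (y + b) \<le> \<rho>} \<le> 2 * \<rho>"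
proof -
  define S where "S = {z. circle_norm z \<le> \<rho>}"
  have S: "S \<in> sets borel" unfolding S_def by measurable
  have "{y\<in>{0..<1}. circle_norm (y + b) \<le> \<rho>} = {y\<in>{0..<1}. frac (y + b) \<in> S}"
    using circle_norm_frac[of _ 0] by (auto simp: S_def)
  then have "measure circle {y\<in>{0..<1}. circle_norm (y + b) \<le> \<rho>} = measure circle (S \<inter> {0..<1})"
    using measure_rotate[OF S] by simp
  also have "\<dots> \<le> 2 * \<rho>"
  proof (cases "\<rho> < 1 / 2")
    case False
    have "measure circle (S \<inter> {0..<1}) \<le> 1" by (rule circle.prob_le_1)
    then show ?thesis using False by linarith
  next
    case True
    have sub: "S \<inter> {0..<1} \<subseteq> {0..\<rho>} \<union> {1 - \<rho>..<1}"
    proof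
      fix z assume z: "z \<in> S \<inter> {0..<1}"
      obtain n where n: "circle_norm z = \<bar>z - of_int n\<bar>" by (rule circle_norm_attains)
      have "\<bar>z - of_int n\<bar> \<le> \<rho>" using z n by (simp add: S_def)
      then have "-1 < real_of_int n" "real_of_int n < 2" using z True by (auto simp: abs_le_iff)
      then have "n = 0 \<or> n = 1" by linarith
      then show "z \<in> {0..\<rho>} \<union> {1 - \<rho>..<1}" using \<open>\<bar>z - of_int n\<bar> \<le> \<rho>\<close> z by auto
    qed
    have s1: "{0..\<rho>} \<subseteq> {0..<1}" and s2: "{1 - \<rho>..<1} \<subseteq> {0..<1}" using True assms by (auto intro: subsetI)
    have c: "{0..\<rho>} \<in> sets circle" "{1 - \<rho>..<1} \<in> sets circle" using s1 s2 by (simp_all only: sets_circle) auto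
    have "measure circle (S \<inter> {0..<1}) \<le> measure circle ({0..\<rho>} \<union> {1 - \<rho>..<1})"
      using c by (intro circle.finite_measure_mono sub) auto
    also have "\<dots> \<le> measure circle {0..\<rho>} + measure circle {1 - \<rho>..<1}" by (rule measure_Un_le[OF c])
    also have "measure circle {0..\<rho>} = \<rho>"
      unfolding measure_def using assms by (subst emeasure_circle[OF _ s1]) auto
    also have "measure circle {1 - \<rho>..<1} = \<rho>" using True assms by (subst measure_circle_interval) auto
    finally show ?thesis by simp
  qed
  finally show ?thesis .
qed

locale ratner_setting = denominator_sequence \<alpha> q + singular_function h f k a A B
  for \<alpha> :: real and q :: "nat \<Rightarrow> nat" and h f :: "real \<Rightarrow> real" and k :: nat and a A B :: "nat \<Rightarrow> real" +
  fixes C m0 :: real and x :: "nat \<Rightarrow> real"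
  assumes f_pos: "f y > 0"
    and bad_approx: "badly_approximable \<alpha> q C (a ` {1..k})"
    and AB: "(\<Sum>i=1..k. A i) \<noteq> (\<Sum>i=1..k. B i)"
    and m0: "m0 > 0"
    and x_pos: "0 < x s" and x_less: "x s < 1 / real (q s)"
    and cond_u: "(\<lambda>s. deriv h (x s / (4 * C)) / (real (q s) * h (1 / (2 * real (q s))))) \<longlonglongrightarrow> 0"
    and cond_x: "filterlim (\<lambda>s. x s * real (q s) * h (1 / (2 * real (q s)))) at_top sequentially"
    and cond_sum: "(\<lambda>i. real (q i) * x i) summable_on (- {s. real (q (Suc s)) < 1 / x s})"
    and cond_m: "h (1 / (2 * real (q s))) / h (1 / (2 * real (q (Suc s)))) > m0"
begin

lemma C_gt_1: "C > 1"
  using bad_approx by (simp add: badly_approximable_def)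

text \<open>
  Bad approximability in terms of distances on the circle, from an arbitrary real starting point.
\<close>

lemma visit_unique:
  assumes "i < q s" "j < q s" "l \<in> {1..k}" "l' \<in> {1..k}"
    and "circle_norm (y + real i * \<alpha> - a l) \<le> 1 / (2 * C * real (q s))"
    and "circle_norm (y + real j * \<alpha> - a l') \<le> 1 / (2 * C * real (q s))"
  shows "i = j"
proof -
  let ?r = "1 / (2 * C * real (q s))"
  have rot: "(rotation \<alpha> ^^ n) (frac y) = frac (y + real n * \<alpha>)" for n
    by (induction n) (auto simp: rotation_def algebra_simps)
  have mem: "(rotation \<alpha> ^^ n) (frac y) \<in> frac ` (\<Union>b\<in>a ` {1..k}. {b - ?r..b + ?r})"
    if l: "l \<in> {1..k}" and "circle_norm (y + real n * \<alpha> - a l) \<le> ?r" for n l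
  proof -
    obtain m where m: "circle_norm (y + real n * \<alpha> - a l) = \<bar>y + real n * \<alpha> - a l - of_int m\<bar>"
      by (rule circle_norm_attains)
    define w where "w = y + real n * \<alpha> - of_int m"
    have "w \<in> {a l - ?r..a l + ?r}" using m that(2) by (auto simp: w_def abs_le_iff)
    then have "frac w \<in> frac ` (\<Union>b\<in>a ` {1..k}. {b - ?r..b + ?r})" using l by blast
    moreover have "frac w = frac (y + real n * \<alpha>)" by (simp add: w_def frac_def)
    ultimately show ?thesis by (simp add: rot)
  qed
  have "\<exists>\<^sub>\<le>\<^sub>1 i. i \<in> {0..<q s} \<and> (rotation \<alpha> ^^ i) (frac y) \<in> frac ` (\<Union>b\<in>a ` {1..k}. {b - ?r..b + ?r})"
    using bad_approx frac_in_circle[of y] unfolding badly_approximable_def space_circle by blast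
  moreover have "i \<in> {0..<q s}" "j \<in> {0..<q s}" using assms(1,2) by simp_all
  ultimately show ?thesis
    by (elim Uniq_D[where P="\<lambda>i. i \<in> {0..<q s} \<and> (rotation \<alpha> ^^ i) (frac y) \<in> frac ` (\<Union>b\<in>a ` {1..k}. {b - ?r..b + ?r})"])
      (intro conjI mem[OF assms(3,5)] mem[OF assms(4,6)]; assumption)+
qed

text \<open>
  A visit is a passage at distance \<open>x s / (3 C)\<close> from a singularity. The factor \<open>1 / (3 C)\<close> is between
  \<open>1 / (4 C)\<close>, the distance at which the derivative is controlled, and \<open>1 / (2 C)\<close>, the distance in the
  definition of bad approximability; both gaps are used.
\<close>

definition visits :: "nat \<Rightarrow> real \<Rightarrow> bool" where
  "visits s y \<longleftrightarrow> (\<exists>l\<in>{1..k}. circle_norm (y - a l) \<le> x s / (3 * C))"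

text \<open>
  The complement of \<open>K\<^sub>\<alpha>\<close>: the gap from \<open>q s\<close> to \<open>q (s + 1)\<close> is long.
\<close>

definition long :: "nat set" where "long = - {s. real (q (Suc s)) < 1 / x s}"

definition good :: "nat \<Rightarrow> real set" where
  "good n = {y. \<forall>s\<ge>n. s \<in> long \<longrightarrow> (\<forall>i<q s. \<not> visits s (y + real i * \<alpha>))}"

lemma good_mono: "m \<le> n \<Longrightarrow> good m \<subseteq> good n"
  by (auto simp: good_def)

lemma visits_sets: "{y. visits s (y + b)} \<in> sets borel"
proof -
  have "{y. visits s (y + b)} = (\<Union>l\<in>{1..k}. {y\<in>space borel. circle_norm (y + b - a l) \<le> x s / (3 * C)})"
    by (auto simp: visits_def)
  also have "\<dots> \<in> sets borel" by measurable
  finally show ?thesis .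
qed

lemma good_sets: "good n \<in> sets borel"
proof -
  have "good n = (\<Inter>s\<in>{s. s \<ge> n \<and> s \<in> long}. \<Inter>i\<in>{i. i < q s}. - {y. visits s (y + real i * \<alpha>)})"
    by (auto simp: good_def)
  also have "\<dots> \<in> sets borel"
  proof -
    have inner: "(\<Inter>i\<in>{i. i < q s}. - {y. visits s (y + real i * \<alpha>)}) \<in> sets borel" for s
      using visits_sets q_pos[of s] by (intro sets.countable_INT'') (auto intro: borel_comp)
    show ?thesis
      by (rule sets.countable_INT'') (simp, simp, rule inner)
  qed
  finally show ?thesis .
qed

text \<open>
  The points that are excluded at the index \<open>s\<close> have measure at most a multiple of \<open>q s * x s\<close>, and these
  numbers are summable over the long gaps.
\<close>

lemma AE_good: "AE y in circle. \<exists>n. y \<in> good n"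
proof -
  define Bad where "Bad s = (if s \<in> long then {y\<in>{0..<1}. \<exists>i<q s. visits s (y + real i * \<alpha>)} else {})" for s
  define r where "r s = (if s \<in> long then real (q s) * x s else 0)" for s
  have "summable r"
  proof -
    have "(\<lambda>s. real (q s) * x s) summable_on long" using cond_sum by (simp add: long_def)
    then have "r summable_on UNIV"
      by (subst summable_on_cong_neutral[where g="\<lambda>s. real (q s) * x s" and T=long]) (auto simp: r_def)
    then show ?thesis
      using summable_on_UNIV_nonneg_real_iff[of r] x_pos by (auto simp: r_def less_imp_le)
  qed
  have Bad_eq: "Bad s = (\<Union>i\<in>{..<q s}. \<Union>l\<in>{1..k}. {y\<in>{0..<1}. circle_norm (y + (real i * \<alpha> - a l)) \<le> x s / (3 * C)})"
    if "s \<in> long" for s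
    using that by (auto simp: Bad_def visits_def algebra_simps)
  have piece: "{y\<in>{0..<1}. circle_norm (y + b) \<le> e} \<in> sets circle" for b e
  proof -
    have "{y\<in>space borel. circle_norm (y + b) \<le> e} \<in> sets borel" by measurable
    then have "{0..<1} \<inter> {y. circle_norm (y + b) \<le> e} \<in> sets borel" by (intro sets.Int) auto
    moreover have "{y\<in>{0..<1}. circle_norm (y + b) \<le> e} = {0..<1} \<inter> {y. circle_norm (y + b) \<le> e}" by auto
    ultimately show ?thesis unfolding sets_circle by auto
  qed
  have Bad_sets: "Bad s \<in> sets circle" for s
  proof (cases "s \<in> long")
    case True
    then show ?thesis unfolding Bad_eq[OF True] using piece by (intro sets.finite_UN) auto
  qed (simp add: Bad_def)
  have Bad_measure: "measure circle (Bad s) \<le> real k * r s" for s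
  proof (cases "s \<in> long")
    case True
    have "measure circle (Bad s) \<le> (\<Sum>i<q s. measure circle (\<Union>l\<in>{1..k}. {y\<in>{0..<1}. circle_norm (y + (real i * \<alpha> - a l)) \<le> x s / (3 * C)}))"
      unfolding Bad_eq[OF True] using piece by (intro measure_UNION_le sets.finite_UN) auto
    also have "\<dots> \<le> (\<Sum>i<q s. \<Sum>l\<in>{1..k}. measure circle {y\<in>{0..<1}. circle_norm (y + (real i * \<alpha> - a l)) \<le> x s / (3 * C)})"
      using piece by (intro sum_mono measure_UNION_le) auto
    also have "\<dots> \<le> (\<Sum>i<q s. \<Sum>l\<in>{1..k}. 2 * (x s / (3 * C)))"
      using x_pos[of s] C_gt_1 by (intro sum_mono measure_circle_norm_le) auto
    also have "\<dots> = real k * r s * (2 / (3 * C))" using True by (simp add: r_def)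
    also have "\<dots> \<le> real k * r s * 1"
      using C_gt_1 x_pos[of s] by (intro mult_left_mono) (auto simp: r_def)
    finally show ?thesis by simp
  qed (simp add: Bad_def r_def)
  have "AE y in circle. eventually (\<lambda>s. y \<in> space circle - Bad s) sequentially"
  proof (rule borel_cantelli_AE1)
    show "summable (\<lambda>s. measure circle (Bad s))"
      by (rule summable_comparison_test[OF _ summable_mult[OF \<open>summable r\<close>, of "real k"]]) (use Bad_measure in auto)
  qed (use Bad_sets in \<open>auto simp: circle.emeasure_eq_measure\<close>)
  then show ?thesis using AE_space
  proof eventually_elim
    case (elim y)
    then obtain n where n: "\<And>s. s \<ge> n \<Longrightarrow> y \<notin> Bad s" by (auto simp: eventually_sequentially)
    have "y \<in> good n" unfolding good_def
    proof (intro CollectI allI impI notI)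
      fix s i assume "n \<le> s" "s \<in> long" "i < q s" "visits s (y + real i * \<alpha>)"
      then have "y \<in> Bad s" using elim(2) unfolding Bad_def by auto
      then show False using n[OF \<open>n \<le> s\<close>] by blast
    qed
    then show ?case by blast
  qed
qed

lemma separation:
  obtains s0 where "\<And>s l l'. s \<ge> s0 \<Longrightarrow> l \<in> {1..k} \<Longrightarrow> l' \<in> {1..k} \<Longrightarrow> circle_norm (a l - a l') \<le> 1 / real (q s) \<Longrightarrow> l = l'"
proof -
  define T where "T = (\<lambda>(l, l'). circle_norm (a l - a l')) ` {(l, l'). l \<in> {1..k} \<and> l' \<in> {1..k} \<and> l \<noteq> l'}"
  have pos: "circle_norm (a l - a l') > 0" if "l \<in> {1..k}" "l' \<in> {1..k}" "l \<noteq> l'" for l l'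
  proof -
    have ar: "a l \<in> {0..<1}" "a l' \<in> {0..<1}" using a_range that by auto
    have "a l \<noteq> a l'" using inj_onD[OF inj_a] that by blast
    then have "circle_dist (a l) (a l') \<noteq> 0" using Metric_space.zero[OF Metric_space_circle ar] by simp
    then show ?thesis using circle_norm_nonneg[of "a l - a l'"] unfolding circle_dist_def by linarith
  qed
  have fin: "finite T"
  proof -
    have "{(l, l'). l \<in> {1..k} \<and> l' \<in> {1..k} \<and> l \<noteq> l'} \<subseteq> {1..k} \<times> {1..k}" by auto
    then show ?thesis unfolding T_def by (intro finite_imageI) (rule finite_subset, auto)
  qed
  define \<mu> where "\<mu> = Min (insert 1 T)"
  have \<mu>: "\<mu> > 0" using fin pos by (auto simp: \<mu>_def T_def)
  obtain s0 :: nat where s0: "1 / \<mu> < real s0" using reals_Archimedean2 by blast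
  show thesis
  proof (rule that[of s0], rule ccontr)
    fix s l l' assume s: "s \<ge> s0" and l: "l \<in> {1..k}" "l' \<in> {1..k}" and c: "circle_norm (a l - a l') \<le> 1 / real (q s)" and "l \<noteq> l'"
    then have "circle_norm (a l - a l') \<in> T" by (auto simp: T_def)
    then have "\<mu> \<le> circle_norm (a l - a l')" unfolding \<mu>_def using fin by (intro Min_le) auto
    then have "\<mu> \<le> 1 / real (q s)" using c by simp
    moreover have "1 / \<mu> < real (q s)" using s0 s q_ge[of s] by linarith
    ultimately show False using \<mu> q_pos[of s] by (simp add: field_simps)
  qed
qed

text \<open>
  Suppose that there is a visit at a time \<open>- (i + 1) < 0\<close> and another at a time \<open>j \<ge> 0\<close>, and let \<open>N\<close> be the
  time between them. For a gap that is not long, \<open>N < q (s + 1)\<close> contradicts bad approximability at the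
  index \<open>s + 1\<close>. For a long gap, write \<open>N = m q s + r\<close>. During \<open>m\<close> steps of length \<open>q s\<close> the orbit drifts by
  at most \<open>1 / (6 C q s)\<close>, so bad approximability at the index \<open>s\<close> forces \<open>r = 0\<close>, and both visits are
  to the same singularity. The drift is monotone, so all the times between them in the arithmetic
  progression with step \<open>q s\<close> are visits too. One of these times lies in \<open>[0, q s)\<close>, contrary to
  goodness.
\<close>

lemma switching:
  fixes D :: nat
  assumes D: "real D \<ge> 24 * C"
  obtains s0 where "\<And>s n y. s \<ge> s0 \<Longrightarrow> n \<le> s \<Longrightarrow> y \<in> good n \<Longrightarrow>
    \<exists>fwd. \<forall>j. Suc j * D \<le> q (Suc s) \<longrightarrow> \<not> visits s (orbit_point \<alpha> fwd y j)"
proof -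
  obtain s0 where s0: "\<And>s l l'. s \<ge> s0 \<Longrightarrow> l \<in> {1..k} \<Longrightarrow> l' \<in> {1..k} \<Longrightarrow> circle_norm (a l - a l') \<le> 1 / real (q s) \<Longrightarrow> l = l'"
    by (rule separation) (rule that; assumption)
  show thesis
  proof (rule that[of s0], rule ccontr)
    fix s n y
    assume s: "s \<ge> s0" "n \<le> s" and y: "y \<in> good n"
      and contra: "\<nexists>fwd. \<forall>j. Suc j * D \<le> q (Suc s) \<longrightarrow> \<not> visits s (orbit_point \<alpha> fwd y j)"
    define \<rho> where "\<rho> = x s / (3 * C)"
    have D24: "D \<ge> 24" using D C_gt_1 by linarith
    have Q: "real (q s) > 0" "real (q (Suc s)) > 0" using q_pos by auto
    from contra obtain j where j: "Suc j * D \<le> q (Suc s)" "visits s (y + real j * \<alpha>)"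
      unfolding orbit_point_def by (metis (full_types))
    from contra obtain i where i: "Suc i * D \<le> q (Suc s)" "visits s (y - real (Suc i) * \<alpha>)"
      unfolding orbit_point_def by (metis (full_types))
    obtain l l' where l: "l \<in> {1..k}" "circle_norm (y + real j * \<alpha> - a l) \<le> \<rho>"
      and l': "l' \<in> {1..k}" "circle_norm (y - real (Suc i) * \<alpha> - a l') \<le> \<rho>"
      using i(2) j(2) by (auto simp: visits_def \<rho>_def)
    define w where "w = y - real (Suc i) * \<alpha>"
    define N where "N = j + Suc i"
    have wN: "w + real N * \<alpha> = y + real j * \<alpha>" by (simp add: w_def N_def algebra_simps)
    have ND: "N * D \<le> 2 * q (Suc s)"
    proof -
      have "N * D \<le> Suc j * D + Suc i * D" by (simp add: N_def algebra_simps)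
      then show ?thesis using i j by simp
    qed
    show False
    proof (cases "s \<in> long")
      case False
      then have "real (q (Suc s)) < 1 / x s" by (simp add: long_def)
      then have "x s < 1 / real (q (Suc s))" using x_pos[of s] Q by (simp add: field_simps)
      then have \<rho>: "\<rho> \<le> 1 / (2 * C * real (q (Suc s)))"
      proof -
        have "\<rho> \<le> 1 / real (q (Suc s)) / (3 * C)"
          unfolding \<rho>_def using \<open>x s < _\<close> C_gt_1 by (intro divide_right_mono) auto
        also have "\<dots> \<le> 1 / (2 * C * real (q (Suc s)))" using C_gt_1 Q by (simp add: field_simps)
        finally show ?thesis .
      qed
      have "N * 3 \<le> N * D" using D24 by (intro mult_left_mono) auto
      then have "N < q (Suc s)" using ND q_pos[of "Suc s"] by linarith
      then have "N = 0"
        using visit_unique[of N "Suc s" 0 l l' w] l l' \<rho> q_pos[of "Suc s"] by (simp add: wN) (simp add: w_def)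
      then show False by (simp add: N_def)
    next
      case True
      have \<rho>: "0 \<le> \<rho>" "\<rho> \<le> 1 / (3 * C * real (q s))"
      proof -
        have "\<rho> \<le> 1 / real (q s) / (3 * C)"
          unfolding \<rho>_def using x_less[of s] C_gt_1 by (intro divide_right_mono) auto
        then show "0 \<le> \<rho>" "\<rho> \<le> 1 / (3 * C * real (q s))" using x_pos[of s] C_gt_1 by (auto simp: \<rho>_def mult.commute)
      qed
      define e where "e = real (q s) * \<alpha> - of_int (p s)"
      define m where "m = N div q s"
      define r where "r = N mod q s"
      have N: "real N = real m * real (q s) + real r" "N = m * q s + r"
        by (simp_all add: m_def r_def flip: of_nat_mult of_nat_add)
      have rq: "r < q s" using q_pos by (simp add: r_def)
      have drift: "real m * \<bar>e\<bar> \<le> 1 / (6 * C * real (q s))"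
      proof -
        have "m * q s * D \<le> N * D" unfolding N(2) by (intro mult_right_mono) auto
        from this ND have "m * q s * D \<le> 2 * q (Suc s)" by (rule order_trans)
        then have 1: "real m * real (q s) * real D \<le> 2 * real (q (Suc s))" by (metis of_nat_le_iff of_nat_mult of_nat_numeral)
        have "real m * real (q s) * (24 * C) \<le> real m * real (q s) * real D" using D by (intro mult_left_mono) auto
        from this 1 have 2: "real m * real (q s) * (24 * C) \<le> 2 * real (q (Suc s))" by (rule order_trans)
        have "real m * \<bar>e\<bar> \<le> real m * (2 / real (q (Suc s)))"
          unfolding e_def using norm_q_le(2)[of s] by (intro mult_left_mono) auto
        also have "\<dots> \<le> 1 / (6 * C * real (q s))" using 2 Q C_gt_1 by (simp add: field_simps)
        finally show ?thesis .
      qed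
      have sum: "1 / (3 * C * real (q s)) + 1 / (6 * C * real (q s)) = 1 / (2 * C * real (q s))"
        using Q C_gt_1 by (simp add: field_simps)
      have half: "1 / (2 * C * real (q s)) \<le> 1 / 2"
      proof -
        have "1 \<le> C * real (q s)" using C_gt_1 Q mult_mono[of 1 C 1 "real (q s)"] by simp
        then show ?thesis by (simp add: field_simps)
      qed
      have shift: "w + real r * \<alpha> - a l = (y + real j * \<alpha> - a l) - real m * e + of_int (- (int m * p s))"
        unfolding wN[symmetric] N(1) e_def by (simp add: algebra_simps)
      have "circle_norm (w + real r * \<alpha> - a l) \<le> circle_norm (y + real j * \<alpha> - a l) + circle_norm (- (real m * e))"
        unfolding shift circle_norm_add_int using circle_norm_triangle[of "y + real j * \<alpha> - a l" "- (real m * e)"] by simp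
      also have "circle_norm (- (real m * e)) \<le> real m * \<bar>e\<bar>"
        using circle_norm_le_abs[of "- (real m * e)"] by (simp add: abs_mult)
      finally have near: "circle_norm (w + real r * \<alpha> - a l) \<le> \<rho> + real m * \<bar>e\<bar>" using l(2) by linarith
      then have "circle_norm (w + real r * \<alpha> - a l) \<le> 1 / (2 * C * real (q s))" using \<rho> drift sum by linarith
      moreover have "circle_norm (w + real 0 * \<alpha> - a l') \<le> 1 / (2 * C * real (q s))"
      proof -
        have "0 \<le> 1 / (6 * C * real (q s))" using Q C_gt_1 by simp
        then show ?thesis using l'(2) \<rho> sum by (simp add: w_def)
      qed
      ultimately have r0: "r = 0"
        using visit_unique[of r s 0 l l' w] rq q_pos[of s] l(1) l'(1) by blast
      have "circle_norm (a l - a l') \<le> 1 / real (q s)"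
      proof -
        have "circle_norm (a l - a l') = circle_norm ((w - a l') + - (w - a l))" by simp
        also have "\<dots> \<le> circle_norm (w - a l') + circle_norm (- (w - a l))" by (rule circle_norm_triangle)
        also have "circle_norm (- (w - a l)) = circle_norm (w - a l)" by (rule circle_norm_minus)
        also have "circle_norm (w - a l') + circle_norm (w - a l) \<le> 1 / (2 * C * real (q s)) + 1 / (2 * C * real (q s))"
          using near r0 \<rho> drift sum l'(2) by (simp add: w_def)
        also have "\<dots> = 1 / (C * real (q s))" using Q C_gt_1 by (simp add: field_simps)
        also have "\<dots> \<le> 1 / real (q s)" using Q C_gt_1 by (simp add: field_simps)
        finally show ?thesis .
      qed
      then have ll: "l = l'" using s0[OF s(1) l(1) l'(1)] by simp
      obtain n0 where n0: "circle_norm (w - a l) = \<bar>w - a l - of_int n0\<bar>" by (rule circle_norm_attains)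
      define \<zeta> where "\<zeta> = w - a l - of_int n0"
      have \<zeta>: "\<bar>\<zeta>\<bar> \<le> \<rho>" using n0 l'(2) ll by (simp add: \<zeta>_def w_def)
      have at: "circle_norm (w + real (t * q s) * \<alpha> - a l) = circle_norm (\<zeta> + real t * e)" for t
      proof -
        have "w + real (t * q s) * \<alpha> - a l = \<zeta> + real t * e + of_int (n0 + int t * p s)"
          by (simp add: \<zeta>_def e_def algebra_simps)
        then show ?thesis by (simp only: circle_norm_add_int)
      qed
      have at_end: "\<bar>\<zeta> + real m * e\<bar> \<le> \<rho>"
      proof -
        have "\<bar>real m * e\<bar> = real m * \<bar>e\<bar>" by (simp add: abs_mult)
        then have "\<bar>\<zeta> + real m * e\<bar> \<le> 1 / 2" using \<zeta> \<rho> drift sum half by linarith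
        then have "\<bar>\<zeta> + real m * e\<bar> = circle_norm (w + real (m * q s) * \<alpha> - a l)" unfolding at by (simp add: circle_norm_small)
        also have "w + real (m * q s) * \<alpha> = y + real j * \<alpha>" using N r0 wN by simp
        finally show ?thesis using l(2) by simp
      qed
      \<comment> \<open>the number of steps after which the progression has just passed time \<open>0\<close>\<close>
      define t where "t = (Suc i + q s - 1) div q s"
      have t: "Suc i \<le> t * q s" "t * q s < Suc i + q s"
      proof -
        have "t * q s + (Suc i + q s - 1) mod q s = Suc i + q s - 1" unfolding t_def by (rule div_mult_mod_eq)
        moreover have "(Suc i + q s - 1) mod q s < q s" using q_pos by simp
        ultimately show "Suc i \<le> t * q s" "t * q s < Suc i + q s" by linarith+
      qed
      have tm: "t \<le> m"
      proof -
        have "t * q s < Suc m * q s" using t(2) N(2) r0 by (simp add: N_def)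
        then have "t < Suc m" unfolding mult_less_cancel2 by blast
        then show ?thesis by simp
      qed
      have mid: "\<bar>\<zeta> + real t * e\<bar> \<le> \<rho>"
      proof (cases "e \<ge> 0")
        case True
        then have "0 \<le> real t * e" "real t * e \<le> real m * e" using tm by (auto intro: mult_right_mono)
        then show ?thesis using \<zeta> at_end by linarith
      next
        case False
        then have "real m * e \<le> real t * e" "real t * e \<le> 0" using tm by (auto intro: mult_right_mono_neg mult_nonneg_nonpos)
        then show ?thesis using \<zeta> at_end by linarith
      qed
      define i' where "i' = t * q s - Suc i"
      have i': "i' < q s" using t by (simp add: i'_def)
      have "y + real i' * \<alpha> = w + real (t * q s) * \<alpha>" using t by (simp add: i'_def w_def of_nat_diff algebra_simps)
      then have "circle_norm (y + real i' * \<alpha> - a l) \<le> \<rho>" using at[of t] mid circle_norm_le_abs[of "\<zeta> + real t * e"] by simp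
      then have "visits s (y + real i' * \<alpha>)" using l(1) by (auto simp: visits_def \<rho>_def)
      then show False using y True s i' by (auto simp: good_def)
    qed
  qed
qed

section \<open>Choosing the time scale\<close>

text \<open>
  The sum of \<open>f'\<close> over a block of length \<open>q s\<close> has order \<open>H s\<close>.
\<close>

definition hq :: "nat \<Rightarrow> real" where "hq s = h (1 / (2 * real (q s)))"
definition H :: "nat \<Rightarrow> real" where "H s = real (q s) * hq s"

lemma q_real: "real (q s) \<ge> 1"
  using q_pos[of s] by simp

lemma hq_pos: "0 < hq s"
  unfolding hq_def using q_real[of s] by (intro h_pos) (auto simp: field_simps)

lemma hq_mono: "s \<le> t \<Longrightarrow> hq s \<le> hq t"
  unfolding hq_def using q_real[of s] q_real[of t] q_mono[of s t]
  by (intro h_antimono) (auto simp: field_simps)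

lemma H_pos: "0 < H s"
  unfolding H_def using hq_pos q_real[of s] by (intro mult_pos_pos) auto

lemma H_mono: "s \<le> t \<Longrightarrow> H s \<le> H t"
  unfolding H_def using hq_mono[of s t] q_mono[of s t] hq_pos[of s] by (intro mult_mono) (auto intro: less_imp_le)

lemma H_ge: "real (Suc s) * hq 0 \<le> H s"
  unfolding H_def using hq_mono[of 0 s] q_ge[of s] hq_pos by (intro mult_mono) (auto intro: less_imp_le)

lemma hq_ratio: "hq (t + n) \<le> (1 / min m0 1) ^ n * hq t"
proof (induction n)
  case (Suc n)
  define \<mu> where "\<mu> = min m0 1"
  have \<mu>: "0 < \<mu>" "\<mu> \<le> m0" using m0 by (auto simp: \<mu>_def)
  have "m0 < hq (t + n) / hq (Suc (t + n))" using cond_m[of "t + n"] by (simp add: hq_def)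
  then have "\<mu> < hq (t + n) / hq (Suc (t + n))" using \<mu> by linarith
  then have "\<mu> * hq (Suc (t + n)) < hq (t + n)" using hq_pos[of "Suc (t + n)"] by (simp add: pos_less_divide_eq)
  then have "hq (Suc (t + n)) \<le> 1 / \<mu> * hq (t + n)" using \<mu> by (simp add: field_simps)
  also have "\<dots> \<le> 1 / \<mu> * ((1 / \<mu>) ^ n * hq t)" using Suc \<mu> unfolding \<mu>_def[symmetric] by (intro mult_left_mono) auto
  finally show ?case unfolding \<mu>_def[symmetric] by simp
qed simp

lemma hq_ratio_le:
  assumes "t \<le> s" "s \<le> t + n"
  shows "hq s \<le> (1 / min m0 1) ^ n * hq t"
  using hq_mono[OF assms(2)] hq_ratio[of t n] by linarith

text \<open>
  For a distance \<open>d\<close>, let \<open>S\<close> be the last index with \<open>d H S \<le> 1\<close>. Blocks of length \<open>q S\<close> may not fit, with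
  the safety factor \<open>3 D\<close>, into the time \<open>q (S + 1)\<close>; so take the last index \<open>t\<close> for which blocks of length
  \<open>q t\<close> fit. As denominators double in two steps, \<open>t\<close> is only boundedly many indices before \<open>S\<close>, and
  condition 3 bounds the loss in \<open>h\<close>.
  
  If \<open>q (t + 1) / q t\<close> is large, a suitable number \<open>m\<close> of blocks of length \<open>q t\<close> has the right order and
  fits before \<open>q (t + 1)\<close>: take \<open>s = t\<close>. If not, the denominators from \<open>q t\<close> to \<open>q (S + 1)\<close> are all
  comparable: take a single block and \<open>s = S\<close>.
\<close>

lemma select_scales:
  fixes D L T0 :: nat
  assumes D: "D \<ge> 1" and L: "3 * D \<le> 2 ^ L"
  defines "Mh \<equiv> (1 / min m0 1) ^ (2 * L)"
  obtains \<delta> where "\<delta> > 0" "\<And>d. 0 < d \<Longrightarrow> d < \<delta> \<Longrightarrow> \<exists>t s m. T0 \<le> t \<and> t \<le> s \<and> s \<le> t + 2 * L \<and> 1 \<le> m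
    \<and> 3 * (m * q t) * D \<le> q (Suc s) \<and> q s \<le> 9 * D * D * q t \<and> d * (real m * H t) \<le> 1
    \<and> 1 / (18 * real D * real D * Mh) \<le> d * (real m * H t)"
proof -
  define b where "b = 3 * D * q (Suc T0)"
  show thesis
  proof (rule that[of "1 / H b"])
    show "0 < 1 / H b" using H_pos by simp
    fix d assume d: "0 < d" "d < 1 / H b"
    have D1: "real D \<ge> 1" using D by simp
    have m1: "0 < min m0 1" "min m0 1 \<le> 1" using m0 by auto
    have Mh: "Mh \<ge> 1" unfolding Mh_def using m1 by (intro one_le_power) (simp only: pos_le_divide_eq mult_1_left)
    have b1: "d * H b < 1" using d H_pos[of b] by (simp add: pos_less_divide_eq)
    have ex: "\<exists>n. 1 < d * H n"
    proof -
      obtain n :: nat where n: "1 / (d * hq 0) < real n" using reals_Archimedean2 by blast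
      have "1 < real n * (d * hq 0)" using n d hq_pos[of 0] by (simp add: pos_divide_less_eq)
      also have "\<dots> \<le> d * H n"
      proof -
        have "real n * hq 0 \<le> real (Suc n) * hq 0" using hq_pos[of 0] by simp
        then have "real n * hq 0 \<le> H n" using H_ge[of n] by linarith
        then have "d * (real n * hq 0) \<le> d * H n" using d by (intro mult_left_mono) auto
        then show ?thesis by (simp add: algebra_simps)
      qed
      finally show ?thesis by blast
    qed
    define S1 where "S1 = (LEAST n. 1 < d * H n)"
    have S1: "1 < d * H S1" unfolding S1_def by (rule LeastI_ex[OF ex])
    have S1b: "b < S1"
    proof (rule ccontr)
      assume "\<not> b < S1"
      then have "d * H S1 \<le> d * H b" using d H_mono by (intro mult_left_mono) auto
      then show False using S1 b1 by simp
    qed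
    define S where "S = S1 - 1"
    have S: "S1 = Suc S" "b \<le> S" using S1b by (auto simp: S_def)
    have S_lo: "d * H S \<le> 1"
      using not_less_Least[of S "\<lambda>n. 1 < d * H n"] S by (simp add: S1_def[symmetric])
    have S_hi: "1 < d * H (Suc S)" using S1 S by simp
    have ext: "\<exists>n. q (Suc S) < 3 * D * q n"
    proof
      have "1 * q (Suc S) < 3 * D * q (Suc S)" using D q_pos[of "Suc S"] by (intro mult_strict_right_mono) auto
      then show "q (Suc S) < 3 * D * q (Suc S)" by simp
    qed
    define t1 where "t1 = (LEAST n. q (Suc S) < 3 * D * q n)"
    have t1: "q (Suc S) < 3 * D * q t1" unfolding t1_def by (rule LeastI_ex[OF ext])
    have bS: "3 * D * q (Suc T0) < q (Suc S)" using q_ge[of "Suc S"] S(2) by (simp add: b_def)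
    have t1T: "Suc T0 < t1"
    proof (rule ccontr)
      assume "\<not> Suc T0 < t1"
      then have "3 * D * q t1 \<le> 3 * D * q (Suc T0)" using q_mono by (intro mult_left_mono) auto
      then show False using t1 bS by linarith
    qed
    define t where "t = t1 - 1"
    have t: "t1 = Suc t" "T0 \<le> t" using t1T by (auto simp: t_def)
    have t_lo: "3 * D * q t \<le> q (Suc S)"
    proof -
      have "t < (LEAST n. q (Suc S) < 3 * D * q n)" unfolding t1_def[symmetric] using t by simp
      then have "\<not> q (Suc S) < 3 * D * q t" by (rule not_less_Least)
      then show ?thesis by simp
    qed
    have t_hi: "q (Suc S) < 3 * D * q (Suc t)" using t1 t by simp
    have tS: "t \<le> S"
    proof (rule ccontr)
      assume "\<not> t \<le> S"
      then have "q (Suc S) \<le> q t" using q_mono by simp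
      moreover have "1 * q t < 3 * D * q t" using D q_pos[of t] by (intro mult_strict_right_mono) auto
      ultimately show False using t_lo by linarith
    qed
    have SL: "S < t + 2 * L"
    proof (rule ccontr)
      assume "\<not> S < t + 2 * L"
      then have "q (Suc t + 2 * L) \<le> q (Suc S)" by (intro q_mono) simp
      moreover have "2 ^ L * q (Suc t) \<le> q (Suc t + 2 * L)" by (rule q_pow2)
      moreover have "3 * D * q (Suc t) \<le> 2 ^ L * q (Suc t)" using L by (intro mult_right_mono) auto
      ultimately show False using t_hi by linarith
    qed
    have hr: "hq (Suc S) \<le> Mh * hq t" unfolding Mh_def using tS SL by (intro hq_ratio_le) auto
    have Ht: "d * H t \<le> 1"
    proof -
      have "d * H t \<le> d * H S" using d H_mono[OF tS] by (intro mult_left_mono) auto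
      then show ?thesis using S_lo by simp
    qed
    \<comment> \<open>\<open>q (t + 1)\<close> is at least \<open>q (S + 1) / (3 D)\<close>, and \<open>d H (S + 1) > 1\<close>\<close>
    have low: "1 / (18 * real D * real D * Mh) \<le> d * (real (q (Suc t)) * hq t / (6 * real D))"
    proof -
      have "real (q (Suc S)) \<le> 3 * real D * real (q (Suc t))"
        using t_hi by (metis less_imp_le of_nat_le_iff of_nat_mult of_nat_numeral)
      then have "H (Suc S) \<le> (3 * real D * real (q (Suc t))) * (Mh * hq t)"
        unfolding H_def using hr hq_pos[of "Suc S"] by (intro mult_mono) auto
      then have "d * H (Suc S) \<le> d * ((3 * real D * real (q (Suc t))) * (Mh * hq t))" using d by (intro mult_left_mono) auto
      then have "1 \<le> d * ((3 * real D * real (q (Suc t))) * (Mh * hq t))" using S_hi by linarith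
      also have "\<dots> = (18 * real D * real D * Mh) * (d * (real (q (Suc t)) * hq t / (6 * real D)))"
        using D1 by (simp add: field_simps)
      finally have one: "1 \<le> (18 * real D * real D * Mh) * (d * (real (q (Suc t)) * hq t / (6 * real D)))" .
      have "0 < 18 * real D * real D * Mh" using D1 Mh by (intro mult_pos_pos) auto
      then show ?thesis using one by (simp only: pos_divide_le_eq mult.commute)
    qed
    show "\<exists>t s m. T0 \<le> t \<and> t \<le> s \<and> s \<le> t + 2 * L \<and> 1 \<le> m
      \<and> 3 * (m * q t) * D \<le> q (Suc s) \<and> q s \<le> 9 * D * D * q t \<and> d * (real m * H t) \<le> 1
      \<and> 1 / (18 * real D * real D * Mh) \<le> d * (real m * H t)"
    proof (cases "3 * D * q t \<le> q (Suc t)")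
      case True
      define y where "y = 1 / (d * H t)"
      have y: "1 \<le> y" unfolding y_def using Ht d H_pos[of t] by (simp add: pos_le_divide_eq)
      define m where "m = min (nat \<lfloor>y\<rfloor>) (q (Suc t) div (3 * D * q t))"
      have dq: "3 * D * q t > 0" using D q_pos by simp
      have div1: "1 \<le> q (Suc t) div (3 * D * q t)" using True dq by (simp add: Suc_le_eq div_greater_zero_iff)
      have m_1: "1 \<le> m" unfolding m_def using y div1 by (auto simp: le_nat_iff)
      have m_y: "real m \<le> y"
      proof -
        have "real m \<le> real (nat \<lfloor>y\<rfloor>)" unfolding m_def by simp
        also have "\<dots> \<le> y" using y by (simp add: of_nat_floor)
        finally show ?thesis .
      qed
      have m_q: "3 * (m * q t) * D \<le> q (Suc t)"
      proof -
        have "m * (3 * D * q t) \<le> q (Suc t) div (3 * D * q t) * (3 * D * q t)" unfolding m_def by (intro mult_right_mono) auto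
        also have "\<dots> \<le> q (Suc t)" by simp
        finally show ?thesis by (simp add: algebra_simps)
      qed
      have up: "d * (real m * H t) \<le> 1"
      proof -
        have "real m * (d * H t) \<le> y * (d * H t)" using m_y d H_pos[of t] by (intro mult_right_mono) auto
        also have "\<dots> = 1" unfolding y_def using d H_pos[of t] by simp
        finally show ?thesis by (simp add: algebra_simps)
      qed
      have lo: "1 / (18 * real D * real D * Mh) \<le> d * (real m * H t)"
      proof (cases "nat \<lfloor>y\<rfloor> \<le> q (Suc t) div (3 * D * q t)")
        case True
        then have "m = nat \<lfloor>y\<rfloor>" by (simp add: m_def)
        moreover have "1 \<le> \<lfloor>y\<rfloor>" using y by simp
        ultimately have "real m = of_int \<lfloor>y\<rfloor>" "1 \<le> (of_int \<lfloor>y\<rfloor> :: real)" by simp_all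
        then have "y / 2 \<le> real m" using floor_correct[of y] by linarith
        then have "y / 2 * (d * H t) \<le> real m * (d * H t)" using d H_pos[of t] by (intro mult_right_mono) auto
        moreover have "y / 2 * (d * H t) = 1 / 2" unfolding y_def using d H_pos[of t] by simp
        ultimately have "1 / 2 \<le> d * (real m * H t)" by (simp add: algebra_simps)
        moreover have "1 / (18 * real D * real D * Mh) \<le> 1 / 2"
        proof -
          have "1 * 1 \<le> real D * real D" using D1 by (intro mult_mono) auto
          then have "1 * 1 \<le> (real D * real D) * Mh" using Mh by (intro mult_mono) auto
          then have "2 \<le> 18 * real D * real D * Mh" by (simp add: algebra_simps)
          then show ?thesis by (intro divide_left_mono) auto
        qed
        ultimately show ?thesis by linarith
      next
        case False
        define w where "w = q (Suc t) div (3 * D * q t)"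
        have mw: "m = w" using False by (simp add: m_def w_def)
        have "q (Suc t) < (w + 1) * (3 * D * q t)"
          unfolding w_def using dq by (metis Suc_eq_plus1 dividend_less_div_times mult.commute mult_Suc_right add.commute)
        also have "\<dots> \<le> (2 * w) * (3 * D * q t)" using div1 by (intro mult_right_mono) (auto simp: w_def)
        finally have "q (Suc t) \<le> 6 * D * q t * m" by (simp add: mw algebra_simps)
        then have "real (q (Suc t)) \<le> 6 * real D * real (q t) * real m"
          by (metis of_nat_le_iff of_nat_mult of_nat_numeral)
        then have "real (q (Suc t)) / (6 * real D) \<le> real m * real (q t)"
          using D1 by (simp add: divide_le_eq algebra_simps)
        then have "real (q (Suc t)) / (6 * real D) * hq t \<le> real m * real (q t) * hq t" using hq_pos[of t] by (intro mult_right_mono) auto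
        then have "d * (real (q (Suc t)) * hq t / (6 * real D)) \<le> d * (real m * H t)"
          unfolding H_def using d by (intro mult_left_mono) (auto simp: algebra_simps)
        then show ?thesis using low by linarith
      qed
      have "q t \<le> 9 * D * D * q t"
      proof -
        have "1 * q t \<le> 9 * D * D * q t" using D by (intro mult_right_mono) (auto simp: Suc_le_eq)
        then show ?thesis by simp
      qed
      then show ?thesis using t(2) m_1 m_q up lo by (intro exI[of _ t] conjI exI[of _ m]) auto
    next
      case False
      then have F: "q (Suc t) < 3 * D * q t" by simp
      have "q S \<le> 9 * D * D * q t"
      proof -
        have "q S \<le> 3 * D * q (Suc t)" using t_hi q_Suc_less[of S] by linarith
        also have "\<dots> \<le> 3 * D * (3 * D * q t)" using F by (intro mult_left_mono) auto
        finally show ?thesis by (simp add: algebra_simps)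
      qed
      moreover have "1 / (18 * real D * real D * Mh) \<le> d * (real 1 * H t)"
      proof -
        have "real (q (Suc t)) \<le> 3 * real D * real (q t)" using F by (metis less_imp_le of_nat_le_iff of_nat_mult of_nat_numeral)
        also have "\<dots> \<le> 6 * real D * real (q t)" by (intro mult_right_mono) auto
        finally have "real (q (Suc t)) / (6 * real D) \<le> real (q t)"
          using D1 by (simp add: divide_le_eq algebra_simps)
        then have "real (q (Suc t)) / (6 * real D) * hq t \<le> real (q t) * hq t" using hq_pos[of t] by (intro mult_right_mono) auto
        then have "d * (real (q (Suc t)) * hq t / (6 * real D)) \<le> d * (real 1 * H t)"
          unfolding H_def using d by (intro mult_left_mono) (auto simp: algebra_simps)
        then show ?thesis using low by linarith
      qed
      moreover have "3 * (1 * q t) * D \<le> q (Suc S)" using t_lo by (simp add: algebra_simps)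
      ultimately show ?thesis using t(2) tS SL Ht
        by (intro exI[of _ t] exI[of _ S] exI[of _ "1::nat"]) auto
    qed
  qed
qed

section \<open>Divergence of the Birkhoff sums of nearby points\<close>

text \<open>
  The function \<open>f\<close> is bounded below by a positive constant on some interval, and every block whose
  length is a large denominator has a point in this interval.
\<close>

lemma f_growth:
  obtains c b where "c > 0" "\<And>n z. c * real n - b \<le> (\<Sum>j<n. f (z + real j * \<alpha>))"
proof -
  obtain w where w: "0 < w" "w < 1" "regular w"
  proof -
    have "infinite ({0<..<1::real} - a ` {1..k})" by (rule Diff_infinite_finite) auto
    then have "{0<..<1::real} - a ` {1..k} \<noteq> {}" by (metis finite.emptyI)
    then obtain w where "w \<in> {0<..<1} - a ` {1..k}" by blast
    then show thesis using that[of w] by (auto simp: regular_iff frac_eq[of w])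
  qed
  define c1 where "c1 = f w / 2"
  have c1: "c1 > 0" using f_pos[of w] by (simp add: c1_def)
  have "isCont f w" using f_has_deriv[OF w(3)] by (rule DERIV_isCont)
  then obtain r where r: "r > 0" "\<And>z. \<bar>z - w\<bar> < r \<Longrightarrow> \<bar>f z - f w\<bar> < c1"
    using c1 unfolding continuous_at_eps_delta dist_real_def by metis
  have f_w: "f z \<ge> c1" if "\<bar>z - w\<bar> < r" for z using r(2)[OF that] unfolding c1_def by linarith
  define g where "g = min r (min w (1 - w))"
  have g: "g > 0" "g \<le> r" "g \<le> w" "g \<le> 1 - w" using r w by (auto simp: g_def)
  obtain s :: nat where s: "3 / g < real s" using reals_Archimedean2 by blast
  define Q where "Q = real (q s)"
  have Q: "3 / g < Q" "Q > 0" using s q_ge[of s] q_pos[of s] by (auto simp: Q_def)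
  have gQ: "3 < g * Q" using Q g by (simp add: pos_divide_less_eq mult.commute)
  have f_frac: "f (frac z) = f z" for z
  proof -
    have per: "f (y + real m) = f y" for y m
    proof (induction m)
      case (Suc m)
      have "y + real (Suc m) = y + real m + 1" by simp
      then show ?case using Suc periodic unfolding circle_function_def by (simp only:)
    qed simp
    show ?thesis
    proof (cases "\<lfloor>z\<rfloor> \<ge> 0")
      case True
      then show ?thesis using per[of "frac z" "nat \<lfloor>z\<rfloor>"] by (simp add: frac_def)
    next
      case False
      then show ?thesis using per[of z "nat (- \<lfloor>z\<rfloor>)"] by (simp add: frac_def)
    qed
  qed
  have block: "c1 \<le> (\<Sum>j<q s. f (z + real j * \<alpha>))" for z
  proof -
    obtain J where J: "bij_betw J {..<q s} {..<q s}"
      and Jz: "\<And>i. i < q s \<Longrightarrow> 1 \<le> J i \<Longrightarrow> J i + 2 \<le> q s \<Longrightarrow>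
        (real (J i) - 1) / real (q s) \<le> frac (z + real i * \<alpha>) \<and> frac (z + real i * \<alpha>) \<le> (real (J i) + 2) / real (q s)"
      by (rule block_order[OF q_pos coprime_p_q norm_q_le(1), of s z]) (rule that; assumption)
    \<comment> \<open>the orbit point of the block that belongs to the fraction \<open>l / q s\<close> is close to \<open>w\<close>\<close>
    define l where "l = nat \<lfloor>Q * w\<rfloor>"
    have Qw: "3 \<le> Q * w"
    proof -
      have "g * Q \<le> w * Q" using g(3) Q by (intro mult_right_mono) auto
      then have "3 \<le> w * Q" using gQ by linarith
      then show ?thesis by (simp only: mult.commute)
    qed
    have Qw1: "Q * w + 3 \<le> Q"
    proof -
      have "g * Q \<le> (1 - w) * Q" using g(4) Q by (intro mult_right_mono) auto
      then have "3 \<le> (1 - w) * Q" using gQ by linarith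
      then show ?thesis by (simp add: algebra_simps)
    qed
    have l_eq: "real l = of_int \<lfloor>Q * w\<rfloor>" unfolding l_def using Qw by simp
    have l: "real l \<le> Q * w" "Q * w < real l + 1" unfolding l_eq using floor_correct[of "Q * w"] by auto
    have l1: "1 \<le> l" "l + 2 \<le> q s"
    proof -
      show "1 \<le> l" using l Qw by linarith
      have "real l + 2 \<le> Q" using l Qw1 by linarith
      then show "l + 2 \<le> q s" unfolding Q_def by linarith
    qed
    have "l \<in> J ` {..<q s}" using J l1 by (simp add: bij_betw_def)
    then obtain i where i: "i < q s" "J i = l" by auto
    have z1: "(real l - 1) / Q \<le> frac (z + real i * \<alpha>)" "frac (z + real i * \<alpha>) \<le> (real l + 2) / Q"
      using Jz[OF i(1)] i l1 by (auto simp: Q_def)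
    have "\<bar>frac (z + real i * \<alpha>) - w\<bar> < r"
    proof -
      have "real l - 1 \<le> Q * frac (z + real i * \<alpha>)" "Q * frac (z + real i * \<alpha>) \<le> real l + 2"
        using z1 Q by (simp_all add: pos_divide_le_eq pos_le_divide_eq mult.commute)
      then have "\<bar>Q * frac (z + real i * \<alpha>) - Q * w\<bar> \<le> 2" using l by (simp add: abs_le_iff)
      then have "Q * \<bar>frac (z + real i * \<alpha>) - w\<bar> \<le> 2" using Q by (simp add: abs_mult flip: right_diff_distrib)
      also have "2 < Q * g" using gQ by (simp add: mult.commute)
      finally have "\<bar>frac (z + real i * \<alpha>) - w\<bar> < g" using Q by simp
      then show ?thesis using g by simp
    qed
    then have "c1 \<le> f (z + real i * \<alpha>)" using f_w f_frac by metis
    also have "\<dots> \<le> (\<Sum>j<q s. f (z + real j * \<alpha>))"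
      by (rule member_le_sum[where f="\<lambda>j. f (z + real j * \<alpha>)"]) (use i f_pos in \<open>auto intro: less_imp_le\<close>)
    finally show ?thesis .
  qed
  have blocks: "real m * c1 \<le> (\<Sum>j<m * q s. f (z + real j * \<alpha>))" for m z
  proof (induction m)
    case (Suc m)
    have "(\<Sum>j<Suc m * q s. f (z + real j * \<alpha>)) = (\<Sum>j<m * q s. f (z + real j * \<alpha>)) + (\<Sum>j<q s. f (z + real (m * q s + j) * \<alpha>))"
      using sum.nat_group[of "\<lambda>j. f (z + real j * \<alpha>)" "q s" "Suc m"] sum.nat_group[of "\<lambda>j. f (z + real j * \<alpha>)" "q s" m]
        sum.shift_bounds_nat_ivl[of "\<lambda>j. f (z + real j * \<alpha>)" 0 "m * q s" "q s"]
      by (simp add: atLeast0LessThan ac_simps)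
    also have "(\<Sum>j<q s. f (z + real (m * q s + j) * \<alpha>)) = (\<Sum>j<q s. f ((z + real (m * q s) * \<alpha>) + real j * \<alpha>))"
      by (simp add: algebra_simps)
    finally show ?case using Suc block[of "z + real (m * q s) * \<alpha>"] by (simp add: algebra_simps)
  qed simp
  show thesis
  proof (rule that[of "c1 / Q" c1])
    show "c1 / Q > 0" using c1 Q by simp
    fix n z
    define m where "m = n div q s"
    have "n < (m + 1) * q s" unfolding m_def using q_pos[of s] by (metis Suc_eq_plus1 dividend_less_div_times mult.commute mult_Suc_right add.commute)
    then have "real n \<le> (real m + 1) * Q" unfolding Q_def by (metis less_imp_le of_nat_1 of_nat_add of_nat_le_iff of_nat_mult)
    then have "real n * (c1 / Q) \<le> (real m + 1) * Q * (c1 / Q)" using c1 Q by (intro mult_right_mono) auto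
    then have "c1 / Q * real n - c1 \<le> real m * c1" using Q by (simp add: algebra_simps)
    also have "\<dots> \<le> (\<Sum>j<m * q s. f (z + real j * \<alpha>))" by (rule blocks)
    also have "\<dots> \<le> (\<Sum>j<n. f (z + real j * \<alpha>))"
      using f_pos by (intro sum_mono2) (auto simp: m_def intro: less_imp_le less_le_trans[OF _ div_times_less_eq_dividend])
    finally show "c1 / Q * real n - c1 \<le> (\<Sum>j<n. f (z + real j * \<alpha>))" .
  qed
qed

text \<open>
  A block of the backward orbit is a block of a forward orbit in reverse order.
\<close>

lemma orbit_block:
  "(\<Sum>j\<in>{n..<n + Q}. F (orbit_point \<alpha> fwd \<theta> j)) =
   (\<Sum>j<Q. F ((if fwd then \<theta> + real n * \<alpha> else \<theta> - real (n + Q) * \<alpha>) + real j * \<alpha>))"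
proof (cases fwd)
  case True
  have "(\<Sum>j\<in>{n..<n + Q}. F (orbit_point \<alpha> fwd \<theta> j)) = (\<Sum>j<Q. F (orbit_point \<alpha> fwd \<theta> (j + n)))"
    using sum.shift_bounds_nat_ivl[of "\<lambda>j. F (orbit_point \<alpha> fwd \<theta> j)" 0 n Q] by (simp add: atLeast0LessThan add.commute)
  also have "\<dots> = (\<Sum>j<Q. F ((\<theta> + real n * \<alpha>) + real j * \<alpha>))"
    using True by (intro sum.cong refl) (simp add: orbit_point_def algebra_simps)
  finally show ?thesis using True by simp
next
  case False
  have "(\<Sum>j\<in>{n..<n + Q}. F (orbit_point \<alpha> fwd \<theta> j)) = (\<Sum>j<Q. F (orbit_point \<alpha> fwd \<theta> (j + n)))"
    using sum.shift_bounds_nat_ivl[of "\<lambda>j. F (orbit_point \<alpha> fwd \<theta> j)" 0 n Q] by (simp add: atLeast0LessThan add.commute)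
  also have "\<dots> = (\<Sum>j<Q. F (orbit_point \<alpha> fwd \<theta> (Q - Suc j + n)))"
    by (rule sum.nat_diff_reindex[symmetric])
  also have "\<dots> = (\<Sum>j<Q. F ((\<theta> - real (n + Q) * \<alpha>) + real j * \<alpha>))"
    using False by (intro sum.cong refl) (simp add: orbit_point_def of_nat_diff algebra_simps)
  finally show ?thesis using False by simp
qed

lemma sum_blocks:
  fixes F :: "nat \<Rightarrow> real"
  shows "(\<Sum>j\<in>{n..<n + m * Q}. F j) = (\<Sum>i<m. \<Sum>j\<in>{n + i * Q..<n + i * Q + Q}. F j)"
proof (induction m)
  case (Suc m)
  have "(\<Sum>j\<in>{n..<n + Suc m * Q}. F j) = (\<Sum>j\<in>{n..<n + m * Q}. F j) + (\<Sum>j\<in>{n + m * Q..<n + Suc m * Q}. F j)"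
    by (rule sum.atLeastLessThan_concat[symmetric]) auto
  then show ?case using Suc by (simp add: ac_simps)
qed simp

text \<open>
  One intermediate point \<open>\<theta>\<close> serves for all times. With the weights \<open>1\<close> this yields the difference of
  two Birkhoff sums, and with signs as weights their total variation.
\<close>

lemma mean_value_sum:
  fixes w :: "nat \<Rightarrow> real"
  assumes xy: "y \<noteq> y'" and fin: "finite I"
    and reg: "\<And>\<theta> j. \<bar>\<theta> - y\<bar> \<le> \<bar>y - y'\<bar> \<Longrightarrow> j \<in> I \<Longrightarrow> regular (orbit_point \<alpha> fwd \<theta> j)"
  obtains \<theta> where "\<bar>\<theta> - y\<bar> \<le> \<bar>y - y'\<bar>"
    "(\<Sum>j\<in>I. w j * (f (orbit_point \<alpha> fwd y j) - f (orbit_point \<alpha> fwd y' j))) = (y - y') * (\<Sum>j\<in>I. w j * deriv f (orbit_point \<alpha> fwd \<theta> j))"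
proof -
  define F where "F \<theta> = (\<Sum>j\<in>I. w j * f (orbit_point \<alpha> fwd \<theta> j))" for \<theta>
  define F' where "F' \<theta> = (\<Sum>j\<in>I. w j * deriv f (orbit_point \<alpha> fwd \<theta> j))" for \<theta>
  have orb: "((\<lambda>\<theta>. orbit_point \<alpha> fwd \<theta> j) has_real_derivative 1) (at \<theta>)" for j \<theta>
    unfolding orbit_point_def by (cases fwd) (auto intro!: derivative_eq_intros)
  have dF: "(F has_real_derivative F' \<theta>) (at \<theta>)" if "\<bar>\<theta> - y\<bar> \<le> \<bar>y - y'\<bar>" for \<theta>
    unfolding F_def F'_def
  proof (rule DERIV_sum)
    fix j assume j: "j \<in> I"
    have "((\<lambda>\<theta>. f (orbit_point \<alpha> fwd \<theta> j)) has_real_derivative deriv f (orbit_point \<alpha> fwd \<theta> j) * 1) (at \<theta>)"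
      by (rule DERIV_chain2[OF f_has_deriv[OF reg[OF that j]] orb])
    then show "((\<lambda>\<theta>. w j * f (orbit_point \<alpha> fwd \<theta> j)) has_real_derivative w j * deriv f (orbit_point \<alpha> fwd \<theta> j)) (at \<theta>)"
      by (auto intro: DERIV_cmult)
  qed
  have diff: "(\<Sum>j\<in>I. w j * (f (orbit_point \<alpha> fwd y j) - f (orbit_point \<alpha> fwd y' j))) = F y - F y'"
    by (simp add: F_def sum_subtractf right_diff_distrib)
  show thesis
  proof (cases "y < y'")
    case True
    have "\<exists>z>y. z < y' \<and> F y' - F y = (y' - y) * F' z"
      by (rule MVT2[OF True]) (use dF in auto)
    then obtain z where z: "y < z" "z < y'" "F y' - F y = (y' - y) * F' z" by blast
    have "F y - F y' = (y - y') * F' z" using z(3) by (simp add: algebra_simps)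
    then show thesis by (intro that[of z]) (use z in \<open>auto simp: diff F'_def\<close>)
  next
    case False
    then have "y' < y" using xy by simp
    have "\<exists>z>y'. z < y \<and> F y - F y' = (y - y') * F' z"
      by (rule MVT2[OF \<open>y' < y\<close>]) (use dF in auto)
    then obtain z where z: "y' < z" "z < y" "F y - F y' = (y - y') * F' z" by blast
    then show thesis by (intro that[of z]) (use z in \<open>auto simp: diff F'_def\<close>)
  qed
qed

text \<open>
  The constants \<open>c1\<close> and \<open>c2\<close> do not depend on the required precision, so one compact set of time shifts
  is enough. Given \<open>y\<close> and \<open>y'\<close> at distance \<open>d\<close>, choose the scales \<open>t \<le> s\<close> and \<open>R = m q t\<close> for \<open>d\<close>, and the
  direction of time in which \<open>y\<close> has no visit at scale \<open>s\<close> up to time \<open>3 R\<close>. As \<open>d\<close> is much smaller than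
  \<open>x s\<close>, by the second half of condition 1, all points between \<open>y\<close> and \<open>y'\<close> stay at distance
  \<open>\<tau> = x s / (4 C)\<close> from the singularities. So the block estimates apply to all of them, and
  \<open>d m H t\<close> has order 1.
\<close>

theorem base_divergence:
  obtains c1 c2 where "c1 > 0" "\<And>n N. \<exists>\<delta>>0. \<forall>y\<in>good n. \<forall>y'. y \<noteq> y' \<and> \<bar>y - y'\<bar> < \<delta> \<longrightarrow> (\<exists>R\<ge>N. \<exists>fwd.
        (\<Sum>j<3 * R. \<bar>f (orbit_point \<alpha> fwd y j) - f (orbit_point \<alpha> fwd y' j)\<bar>) \<le> c2 \<and>
        (\<forall>n\<le>2 * R. c1 \<le> \<bar>\<Sum>j\<in>{n..<n + R}. f (orbit_point \<alpha> fwd y j) - f (orbit_point \<alpha> fwd y' j)\<bar>))"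
proof -
  obtain c0 V0 \<omega> q0 \<sigma> where c0: "c0 > 0" and \<omega>: "\<omega> > 0" and \<sigma>: "\<sigma> \<in> {1, -1}"
    and bd: "block_estimate c0 V0 \<omega> q0 \<sigma>"
    by (rule block_derivative[OF AB])
  obtain D :: nat where D: "24 * C \<le> real D" using real_arch_simple by blast
  have D1: "D \<ge> 1" using D C_gt_1 by linarith
  obtain L :: nat where L: "3 * D \<le> 2 ^ L"
    using less_exp[of "3 * D"] less_imp_le by blast
  define Mh where "Mh = (1 / min m0 1) ^ (2 * L)"
  have Mh: "Mh \<ge> 1"
  proof -
    define \<mu> where "\<mu> = min m0 1"
    have "0 < \<mu>" "\<mu> \<le> 1" using m0 by (auto simp: \<mu>_def)
    then have "1 \<le> 1 / \<mu>" by simp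
    then show ?thesis unfolding Mh_def \<mu>_def[symmetric] by (rule one_le_power)
  qed
  \<comment> \<open>the ratio by which \<open>H s\<close> may exceed \<open>H t\<close>\<close>
  define \<Lambda> where "\<Lambda> = 9 * real D * real D * Mh"
  have \<Lambda>: "\<Lambda> > 0" unfolding \<Lambda>_def using D1 Mh by (intro mult_pos_pos) auto
  define cc where "cc = 1 / (18 * real D * real D * Mh)"
  have cc: "cc > 0" unfolding cc_def using D1 Mh by (intro divide_pos_pos mult_pos_pos) auto
  obtain s0 where sw: "\<And>s n y. s \<ge> s0 \<Longrightarrow> n \<le> s \<Longrightarrow> y \<in> good n \<Longrightarrow>
    \<exists>fwd. \<forall>j. Suc j * D \<le> q (Suc s) \<longrightarrow> \<not> visits s (orbit_point \<alpha> fwd y j)"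
    by (rule switching[OF D]) (rule that; assumption)
  have H_eq: "real (q s) * h (1 / (2 * real (q s))) = H s" for s by (simp add: H_def hq_def)
  obtain s1 where s1: "\<And>s. s \<ge> s1 \<Longrightarrow> u (x s / (4 * C)) \<le> \<omega> / \<Lambda> * H s"
  proof -
    have "\<forall>\<^sub>F s in sequentially. dist (deriv h (x s / (4 * C)) / (real (q s) * h (1 / (2 * real (q s))))) 0 < \<omega> / \<Lambda>"
      by (rule tendstoD[OF cond_u]) (use \<omega> \<Lambda> in simp)
    then obtain s1 where s1: "\<And>s. s \<ge> s1 \<Longrightarrow> \<bar>deriv h (x s / (4 * C)) / H s\<bar> < \<omega> / \<Lambda>"
      unfolding eventually_sequentially H_eq by auto
    show thesis
    proof (rule that[of s1])
      fix s assume "s \<ge> s1"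
      then have "\<bar>deriv h (x s / (4 * C))\<bar> / H s < \<omega> / \<Lambda>" using s1[of s] H_pos[of s] by (simp add: abs_divide)
      then have "\<bar>deriv h (x s / (4 * C))\<bar> < \<omega> / \<Lambda> * H s" using H_pos[of s] by (simp only: pos_divide_less_eq)
      then show "u (x s / (4 * C)) \<le> \<omega> / \<Lambda> * H s" by (simp add: u_def)
    qed
  qed
  obtain s2 where s2: "\<And>s. s \<ge> s2 \<Longrightarrow> 12 * C * \<Lambda> \<le> x s * H s"
  proof -
    have "\<forall>\<^sub>F s in sequentially. 12 * C * \<Lambda> \<le> x s * real (q s) * h (1 / (2 * real (q s)))"
      using cond_x unfolding filterlim_at_top by blast
    then obtain s2 where "\<And>s. s \<ge> s2 \<Longrightarrow> 12 * C * \<Lambda> \<le> x s * real (q s) * h (1 / (2 * real (q s)))"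
      unfolding eventually_sequentially by blast
    then show thesis using that[of s2] H_eq by (simp add: mult.assoc)
  qed
  show thesis
  proof (rule that[of "c0 * cc" "3 * \<bar>V0\<bar>"])
    show "c0 * cc > 0" using c0 cc by simp
    fix n0 N :: nat
    define T0 where "T0 = s0 + s1 + s2 + n0 + N + q0"
    obtain \<delta> where \<delta>: "\<delta> > 0" and sel: "\<And>d. 0 < d \<Longrightarrow> d < \<delta> \<Longrightarrow> \<exists>t s m. T0 \<le> t \<and> t \<le> s \<and> s \<le> t + 2 * L \<and> 1 \<le> m
      \<and> 3 * (m * q t) * D \<le> q (Suc s) \<and> q s \<le> 9 * D * D * q t \<and> d * (real m * H t) \<le> 1
      \<and> 1 / (18 * real D * real D * (1 / min m0 1) ^ (2 * L)) \<le> d * (real m * H t)"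
      by (rule select_scales[OF D1 L, of T0]) (rule that; assumption)
    show "\<exists>\<delta>>0. \<forall>y\<in>good n0. \<forall>y'. y \<noteq> y' \<and> \<bar>y - y'\<bar> < \<delta> \<longrightarrow> (\<exists>R\<ge>N. \<exists>fwd.
        (\<Sum>j<3 * R. \<bar>f (orbit_point \<alpha> fwd y j) - f (orbit_point \<alpha> fwd y' j)\<bar>) \<le> 3 * \<bar>V0\<bar> \<and>
        (\<forall>n\<le>2 * R. c0 * cc \<le> \<bar>\<Sum>j\<in>{n..<n + R}. f (orbit_point \<alpha> fwd y j) - f (orbit_point \<alpha> fwd y' j)\<bar>))"
    proof (rule exI[of _ \<delta>], intro conjI ballI allI impI \<delta>)
      fix y y' assume y: "y \<in> good n0" and yy: "y \<noteq> y' \<and> \<bar>y - y'\<bar> < \<delta>"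
      define d where "d = \<bar>y - y'\<bar>"
      have d: "0 < d" "d < \<delta>" using yy by (auto simp: d_def)
      obtain t s m where t: "T0 \<le> t" "t \<le> s" "s \<le> t + 2 * L" and m: "1 \<le> m"
        and R: "3 * (m * q t) * D \<le> q (Suc s)" and qs: "q s \<le> 9 * D * D * q t"
        and up: "d * (real m * H t) \<le> 1" and lo: "cc \<le> d * (real m * H t)"
        using sel[OF d] unfolding cc_def Mh_def by blast
      define R where "R = m * q t"
      have tN: "s0 \<le> s" "n0 \<le> s" "s1 \<le> s" "s2 \<le> s" "N \<le> q t" "q0 \<le> q t"
        using t q_ge[of t] by (auto simp: T0_def)
      have Hs: "H s \<le> \<Lambda> * H t"
      proof -
        have "real (q s) \<le> 9 * real D * real D * real (q t)" using qs by (metis of_nat_le_iff of_nat_mult of_nat_numeral)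
        moreover have "hq s \<le> Mh * hq t" unfolding Mh_def using t by (intro hq_ratio_le) auto
        ultimately have "H s \<le> (9 * real D * real D * real (q t)) * (Mh * hq t)"
          unfolding H_def using hq_pos[of s] by (intro mult_mono) (auto intro: less_imp_le)
        then show ?thesis by (simp add: \<Lambda>_def H_def algebra_simps)
      qed
      have d_small: "d \<le> x s / (12 * C)"
      proof -
        have "d * H t \<le> d * (real m * H t)" using m d H_pos[of t] by (intro mult_left_mono) auto
        then have dH: "d * H t \<le> 1" using up by linarith
        have "d * (12 * C * \<Lambda>) \<le> d * (x s * H s)" using s2[OF tN(4)] d by (intro mult_left_mono) auto
        also have "\<dots> \<le> d * (x s * (\<Lambda> * H t))" using Hs d x_pos[of s] by (intro mult_left_mono) auto
        also have "\<dots> = x s * \<Lambda> * (d * H t)" by (simp add: algebra_simps)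
        also have "\<dots> \<le> x s * \<Lambda> * 1" using dH x_pos[of s] \<Lambda> by (intro mult_left_mono) auto
        finally have "(d * (12 * C)) * \<Lambda> \<le> x s * \<Lambda>" by (simp add: algebra_simps)
        then have "d * (12 * C) \<le> x s" using \<Lambda> by simp
        then show ?thesis using C_gt_1 by (simp add: field_simps)
      qed
      obtain fwd where fwd: "\<And>j. Suc j * D \<le> q (Suc s) \<Longrightarrow> \<not> visits s (orbit_point \<alpha> fwd y j)"
        using sw[OF tN(1,2) y] by blast
      define \<tau> where "\<tau> = x s / (4 * C)"
      have far: "\<tau> \<le> circle_norm (orbit_point \<alpha> fwd \<theta> j - a i)"
        if \<theta>: "\<bar>\<theta> - y\<bar> \<le> d" and j: "j < 3 * R" and i: "i \<in> {1..k}" for \<theta> j i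
      proof -
        have "Suc j * D \<le> 3 * R * D" using j by (intro mult_right_mono) auto
        then have "\<not> visits s (orbit_point \<alpha> fwd y j)" using R by (intro fwd) (simp add: R_def)
        then have "x s / (3 * C) < circle_norm (orbit_point \<alpha> fwd y j - a i)" using i by (auto simp: visits_def not_le)
        also have "orbit_point \<alpha> fwd y j - a i = (orbit_point \<alpha> fwd \<theta> j - a i) + (y - \<theta>)" by (simp add: orbit_point_def)
        also have "circle_norm \<dots> \<le> circle_norm (orbit_point \<alpha> fwd \<theta> j - a i) + circle_norm (y - \<theta>)" by (rule circle_norm_triangle)
        also have "circle_norm (y - \<theta>) \<le> x s / (12 * C)" using circle_norm_le_abs[of "y - \<theta>"] \<theta> d_small by simp
        finally have "x s / (3 * C) - x s / (12 * C) < circle_norm (orbit_point \<alpha> fwd \<theta> j - a i)" by simp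
        moreover have "x s / (3 * C) - x s / (12 * C) = \<tau>" unfolding \<tau>_def using C_gt_1 by (simp add: field_simps)
        ultimately show ?thesis by simp
      qed
      have \<tau>: "0 < \<tau>" "\<tau> \<le> 1 / (2 * real (q t))"
      proof -
        show "0 < \<tau>" using x_pos[of s] C_gt_1 by (simp add: \<tau>_def)
        have "\<tau> \<le> x s / 2" unfolding \<tau>_def using x_pos[of s] C_gt_1 by (intro divide_left_mono) auto
        also have "\<dots> \<le> 1 / real (q s) / 2" using x_less[of s] by (intro divide_right_mono) auto
        also have "\<dots> \<le> 1 / real (q t) / 2" using q_mono[OF t(2)] q_pos[of t] by (intro divide_right_mono divide_left_mono) auto
        finally show "\<tau> \<le> 1 / (2 * real (q t))" by simp
      qed
      have u\<tau>: "u \<tau> \<le> \<omega> * H t"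
      proof -
        have "u \<tau> \<le> \<omega> / \<Lambda> * H s" unfolding \<tau>_def by (rule s1[OF tN(3)])
        also have "\<dots> \<le> \<omega> / \<Lambda> * (\<Lambda> * H t)" using Hs \<omega> \<Lambda> by (intro mult_left_mono) auto
        finally show ?thesis using \<Lambda> by simp
      qed
      have fr: "\<tau> \<le> frac (orbit_point \<alpha> fwd \<theta> j - a i) \<and> \<tau> \<le> frac (a i - orbit_point \<alpha> fwd \<theta> j)"
        if "\<bar>\<theta> - y\<bar> \<le> d" "j < 3 * R" "i \<in> {1..k}" for \<theta> j i
      proof -
        let ?z = "orbit_point \<alpha> fwd \<theta> j - a i"
        have "circle_norm ?z = circle_norm (a i - orbit_point \<alpha> fwd \<theta> j)"
          using circle_norm_minus[of ?z] by simp
        also have "\<dots> \<le> frac (a i - orbit_point \<alpha> fwd \<theta> j)" by (rule circle_norm_le_frac)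
        finally have "circle_norm ?z \<le> frac (a i - orbit_point \<alpha> fwd \<theta> j)" .
        then show ?thesis using far[OF that] circle_norm_le_frac[of ?z] by linarith
      qed
      have reg: "regular (orbit_point \<alpha> fwd \<theta> j)" if "\<bar>\<theta> - y\<bar> \<le> d" "j < 3 * R" for \<theta> j
        unfolding regular_def
      proof
        fix i assume "i \<in> {1..k}"
        then have "frac (orbit_point \<alpha> fwd \<theta> j - a i) \<noteq> 0" using fr[OF that] \<tau>(1) by fastforce
        then show "orbit_point \<alpha> fwd \<theta> j - a i \<notin> \<int>" by (simp only: frac_eq_0_iff not_False_eq_True)
      qed
      have block: "c0 * H t \<le> \<sigma> * (\<Sum>j\<in>{n..<n + q t}. deriv f (orbit_point \<alpha> fwd \<theta> j))
          \<and> (\<Sum>j\<in>{n..<n + q t}. \<bar>deriv f (orbit_point \<alpha> fwd \<theta> j)\<bar>) \<le> V0 * H t"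
        if \<theta>: "\<bar>\<theta> - y\<bar> \<le> d" and n: "n + q t \<le> 3 * R" for \<theta> n
      proof -
        define \<theta>' where "\<theta>' = (if fwd then \<theta> + real n * \<alpha> else \<theta> - real (n + q t) * \<alpha>)"
        have "c0 * H t \<le> \<sigma> * (\<Sum>j<q t. deriv f (\<theta>' + real j * \<alpha>)) \<and> (\<Sum>j<q t. \<bar>deriv f (\<theta>' + real j * \<alpha>)\<bar>) \<le> V0 * H t"
          unfolding H_eq[symmetric]
        proof (rule bd[unfolded block_estimate_def, rule_format, OF tN(6) coprime_p_q norm_q_le(1) \<tau>])
          show "u \<tau> \<le> \<omega> * (real (q t) * h (1 / (2 * real (q t))))" using u\<tau> by (simp only: H_eq)
        next
          fix i j assume i: "i \<in> {1..k}" and j: "j < q t"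
          obtain j' where j': "j' < 3 * R" "\<theta>' + real j * \<alpha> = orbit_point \<alpha> fwd \<theta> j'"
          proof (cases fwd)
            case True
            show thesis by (rule that[of "n + j"]) (use True j n in \<open>auto simp: \<theta>'_def orbit_point_def algebra_simps\<close>)
          next
            case False
            define jj where "jj = n + (q t - Suc j)"
            have jj: "real (Suc jj) = real n + real (q t) - real j" using j by (simp add: jj_def of_nat_diff)
            have "orbit_point \<alpha> fwd \<theta> jj = \<theta> - (real n + real (q t) - real j) * \<alpha>"
              using False by (simp only: orbit_point_def if_False jj)
            then have "\<theta>' + real j * \<alpha> = orbit_point \<alpha> fwd \<theta> jj" using False by (simp add: \<theta>'_def algebra_simps)
            moreover have "jj < 3 * R" using j n by (simp add: jj_def)
            ultimately show thesis using that by blast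
          qed
          show "\<tau> \<le> frac (\<theta>' + real j * \<alpha> - a i) \<and> \<tau> \<le> frac (a i - (\<theta>' + real j * \<alpha>))"
            unfolding j'(2) by (rule fr[OF \<theta> j'(1) i])
        qed
        then show ?thesis unfolding \<theta>'_def
          using orbit_block[of "deriv f" fwd \<theta> n "q t"] orbit_block[of "\<lambda>z. \<bar>deriv f z\<bar>" fwd \<theta> n "q t"] by (simp only:)
      qed
      have blocks: "real l * (c0 * H t) \<le> \<sigma> * (\<Sum>j\<in>{n..<n + l * q t}. deriv f (orbit_point \<alpha> fwd \<theta> j))
          \<and> (\<Sum>j\<in>{n..<n + l * q t}. \<bar>deriv f (orbit_point \<alpha> fwd \<theta> j)\<bar>) \<le> real l * (V0 * H t)"
        if \<theta>: "\<bar>\<theta> - y\<bar> \<le> d" and n: "n + l * q t \<le> 3 * R" for \<theta> n l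
      proof -
        have i: "n + i * q t + q t \<le> 3 * R" if "i < l" for i
        proof -
          have "Suc i * q t \<le> l * q t" using that by (intro mult_right_mono) auto
          then show ?thesis using n by simp
        qed
        have "(\<Sum>i<l. c0 * H t) \<le> (\<Sum>i<l. \<sigma> * (\<Sum>j\<in>{n + i * q t..<n + i * q t + q t}. deriv f (orbit_point \<alpha> fwd \<theta> j)))"
          using block[OF \<theta> i] by (intro sum_mono) auto
        moreover have "(\<Sum>i<l. \<Sum>j\<in>{n + i * q t..<n + i * q t + q t}. \<bar>deriv f (orbit_point \<alpha> fwd \<theta> j)\<bar>) \<le> (\<Sum>i<l. V0 * H t)"
          using block[OF \<theta> i] by (intro sum_mono) auto
        ultimately show ?thesis unfolding sum_blocks by (simp add: sum_distrib_left)
      qed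
      have \<sigma>1: "\<bar>\<sigma>\<bar> = 1" using \<sigma> by auto
      have var: "(\<Sum>j<3 * R. \<bar>f (orbit_point \<alpha> fwd y j) - f (orbit_point \<alpha> fwd y' j)\<bar>) \<le> 3 * \<bar>V0\<bar>"
      proof -
        \<comment> \<open>these weights turn the weighted sum of the differences into their total variation\<close>
        define w where "w j = sgn (f (orbit_point \<alpha> fwd y j) - f (orbit_point \<alpha> fwd y' j))" for j
        obtain \<theta> where \<theta>: "\<bar>\<theta> - y\<bar> \<le> \<bar>y - y'\<bar>"
          and eq: "(\<Sum>j\<in>{..<3 * R}. w j * (f (orbit_point \<alpha> fwd y j) - f (orbit_point \<alpha> fwd y' j))) = (y - y') * (\<Sum>j\<in>{..<3 * R}. w j * deriv f (orbit_point \<alpha> fwd \<theta> j))"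
          by (rule mean_value_sum[of y y' "{..<3 * R}" fwd w]) (use yy reg in \<open>auto simp: d_def\<close>)
        have "(\<Sum>j<3 * R. \<bar>f (orbit_point \<alpha> fwd y j) - f (orbit_point \<alpha> fwd y' j)\<bar>)
            = (\<Sum>j\<in>{..<3 * R}. w j * (f (orbit_point \<alpha> fwd y j) - f (orbit_point \<alpha> fwd y' j)))"
          unfolding w_def by (simp add: abs_sgn mult.commute)
        also have "\<dots> \<le> d * \<bar>\<Sum>j\<in>{..<3 * R}. w j * deriv f (orbit_point \<alpha> fwd \<theta> j)\<bar>"
          unfolding eq d_def by (simp add: abs_mult[symmetric])
        also have "\<dots> \<le> d * (\<Sum>j<3 * R. \<bar>deriv f (orbit_point \<alpha> fwd \<theta> j)\<bar>)"
        proof (intro mult_left_mono order.trans[OF sum_abs] sum_mono)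
          fix j
          have "\<bar>w j\<bar> \<le> 1" by (simp add: w_def abs_sgn_eq)
          then show "\<bar>w j * deriv f (orbit_point \<alpha> fwd \<theta> j)\<bar> \<le> \<bar>deriv f (orbit_point \<alpha> fwd \<theta> j)\<bar>"
            unfolding abs_mult by (intro mult_left_le_one_le) auto
        qed (use d in simp)
        also have "\<dots> \<le> d * (real (3 * m) * (V0 * H t))"
        proof (intro mult_left_mono)
          have "0 + 3 * m * q t \<le> 3 * R" by (simp add: R_def)
          from blocks[OF \<theta>[folded d_def] this]
          show "(\<Sum>j<3 * R. \<bar>deriv f (orbit_point \<alpha> fwd \<theta> j)\<bar>) \<le> real (3 * m) * (V0 * H t)"
            by (simp add: R_def atLeast0LessThan mult.assoc)
        qed (use d in simp)
        also have "\<dots> = 3 * V0 * (d * (real m * H t))" by (simp add: algebra_simps)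
        also have "\<dots> \<le> 3 * \<bar>V0\<bar> * (d * (real m * H t))"
          using d H_pos[of t] by (intro mult_right_mono) auto
        also have "\<dots> \<le> 3 * \<bar>V0\<bar> * 1" using up by (intro mult_left_mono) auto
        finally show ?thesis by simp
      qed
      have div: "c0 * cc \<le> \<bar>\<Sum>j\<in>{n..<n + R}. f (orbit_point \<alpha> fwd y j) - f (orbit_point \<alpha> fwd y' j)\<bar>" if n: "n \<le> 2 * R" for n
      proof -
        obtain \<theta> where \<theta>: "\<bar>\<theta> - y\<bar> \<le> \<bar>y - y'\<bar>"
          and eq: "(\<Sum>j\<in>{n..<n + R}. 1 * (f (orbit_point \<alpha> fwd y j) - f (orbit_point \<alpha> fwd y' j))) = (y - y') * (\<Sum>j\<in>{n..<n + R}. 1 * deriv f (orbit_point \<alpha> fwd \<theta> j))"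
          by (rule mean_value_sum[of y y' "{n..<n + R}" fwd "\<lambda>_. 1"]) (use yy reg n in \<open>auto simp: d_def\<close>)
        have "n + m * q t \<le> 3 * R" using n by (simp add: R_def)
        from blocks[OF \<theta>[folded d_def] this]
        have "real m * (c0 * H t) \<le> \<sigma> * (\<Sum>j\<in>{n..<n + R}. deriv f (orbit_point \<alpha> fwd \<theta> j))" by (simp add: R_def)
        also have "\<dots> \<le> \<bar>\<Sum>j\<in>{n..<n + R}. deriv f (orbit_point \<alpha> fwd \<theta> j)\<bar>"
          using \<sigma> by auto
        finally have "d * (real m * (c0 * H t)) \<le> d * \<bar>\<Sum>j\<in>{n..<n + R}. deriv f (orbit_point \<alpha> fwd \<theta> j)\<bar>"
          using d by (intro mult_left_mono) auto
        also have "\<dots> = \<bar>\<Sum>j\<in>{n..<n + R}. f (orbit_point \<alpha> fwd y j) - f (orbit_point \<alpha> fwd y' j)\<bar>"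
          using eq by (simp add: d_def abs_mult)
        finally have "c0 * (d * (real m * H t)) \<le> \<bar>\<Sum>j\<in>{n..<n + R}. f (orbit_point \<alpha> fwd y j) - f (orbit_point \<alpha> fwd y' j)\<bar>"
          by (simp add: algebra_simps)
        moreover have "c0 * cc \<le> c0 * (d * (real m * H t))" using lo c0 by (intro mult_left_mono) auto
        ultimately show ?thesis by linarith
      qed
      have "N \<le> R"
      proof -
        have "1 * q t \<le> R" unfolding R_def using m by (intro mult_right_mono) auto
        then show ?thesis using tN by simp
      qed
      then show "\<exists>R\<ge>N. \<exists>fwd.
        (\<Sum>j<3 * R. \<bar>f (orbit_point \<alpha> fwd y j) - f (orbit_point \<alpha> fwd y' j)\<bar>) \<le> 3 * \<bar>V0\<bar> \<and>
        (\<forall>n\<le>2 * R. c0 * cc \<le> \<bar>\<Sum>j\<in>{n..<n + R}. f (orbit_point \<alpha> fwd y j) - f (orbit_point \<alpha> fwd y' j)\<bar>)"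
        using var div by blast
    qed
  qed
qed

end

section \<open>The SWR-property\<close>

theorem theorem2:
  fixes \<alpha> C m\<^sub>0 :: real and q :: "nat \<Rightarrow> nat" and k :: nat
    and f h :: "real \<Rightarrow> real" and a A B x :: "nat \<Rightarrow> real"
  assumes "\<alpha> \<notin> \<rat>"
    and "denominators \<alpha> q"
    and "a ` {1..k} \<subseteq> space circle" and "inj_on a {1..k}"
    and "singularity_type h"
    and "circle_function f" and "\<And>y. f y > 0" and "integrable circle f"
    and "has_singularities h f k a A B"
    and "badly_approximable \<alpha> q C (a ` {1..k})"
    and "(\<Sum>i=1..k. A i) \<noteq> (\<Sum>i=1..k. B i)"
    and "m\<^sub>0 > 0"
    and "\<And>s. 0 < x s" and "\<And>s. x s < 1 / real (q s)"
    and "(\<lambda>s. deriv h (x s / (4 * C)) / (real (q s) * h (1 / (2 * real (q s))))) \<longlonglongrightarrow> 0"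
    and "filterlim (\<lambda>s. x s * real (q s) * h (1 / (2 * real (q s)))) at_top sequentially"
    and "(\<lambda>i. real (q i) * x i) summable_on (- {s. real (q (Suc s)) < 1 / x s})"
    and "\<And>s. h (1 / (2 * real (q s))) / h (1 / (2 * real (q (Suc s)))) > m\<^sub>0"
  shows "SWR_property (flow_measure circle f) (flow_dist circle_dist)
           (special_flow (space circle) (rotation \<alpha>) f)"
proof -
  interpret ratner_setting \<alpha> q h f k a A B C "m\<^sub>0" x
    using assms by unfold_locales (simp_all only: space_circle not_False_eq_True)
  obtain c b where c: "c > 0" and growth: "\<And>n z. c * real n - b \<le> (\<Sum>j<n. f (z + real j * \<alpha>))"
    by (rule f_growth) (rule that; assumption)
  interpret flow: rotation_flow \<alpha> c b f
    using assms(1,6,7,8) c growth by unfold_locales (simp_all add: circle_function_def)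
  obtain c1 c2 where c1: "c1 > 0" and base: "\<And>n N. \<exists>\<delta>>0. \<forall>y\<in>good n. \<forall>y'. y \<noteq> y' \<and> \<bar>y - y'\<bar> < \<delta> \<longrightarrow> (\<exists>R\<ge>N. \<exists>fwd.
        (\<Sum>j<3 * R. \<bar>f (orbit_point \<alpha> fwd y j) - f (orbit_point \<alpha> fwd y' j)\<bar>) \<le> c2 \<and>
        (\<forall>n\<le>2 * R. c1 \<le> \<bar>\<Sum>j\<in>{n..<n + R}. f (orbit_point \<alpha> fwd y j) - f (orbit_point \<alpha> fwd y' j)\<bar>))"
    by (rule base_divergence) (rule that; assumption)
  define P where "P = {p. c1 / 2 \<le> \<bar>p\<bar> \<and> \<bar>p\<bar> \<le> c2}"
  have "closed P"
    unfolding P_def by (intro closed_Collect_conj closed_Collect_le continuous_intros)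
  moreover have "bounded P"
    by (rule boundedI[of _ c2]) (simp add: P_def)
  ultimately have P: "compact P" "0 \<notin> P"
    using c1 by (auto simp: compact_eq_bounded_closed P_def)
  have switch: "switchable_R (flow_measure circle f) (flow_dist circle_dist) (special_flow {0..<1} (rotation \<alpha>) f) t P"
    if "t > 0" for t
    unfolding P_def
    by (rule flow.switchable_R_criterion[OF good_sets good_mono AE_good base that])
  have "{0<..<1::real} \<subseteq> {t. t > 0 \<and> switchable_R (flow_measure circle f) (flow_dist circle_dist) (special_flow {0..<1} (rotation \<alpha>) f) t P}"
    using switch by auto
  then have "uncountable {t. t > 0 \<and> switchable_R (flow_measure circle f) (flow_dist circle_dist) (special_flow {0..<1} (rotation \<alpha>) f) t P}"
    using countable_subset uncountable_open_interval[of 0 "1::real"] by auto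
  then show ?thesis
    unfolding SWR_property_def space_circle
    using flow.prob_space_M flow.standard_borel_M flow.Metric_space_M flow.ergodic_flow_M P by blast
qed

end
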